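(* Let $k$, $F$, $N$, $A$, $k(C)$, $\tilde C$, $A'$, $\mathfrak{C}_A$, $\mathfrak{C}_{A'}$ be as in the context. For $\phi=\phi(x,y)\in A$ put $\phi' := \phi(x,y)/x^{N-3}\in k(C)$. Then, inside the space of rational differential forms of $k(C)/k$, \[ H^0(\tilde C,\Omega_{\tilde C})=\left\{\left.\frac{\phi(x,y)}{F_y}\,dx\ \right|\ \phi\in\mathfrak{C}_A,\ \phi'\in\mathfrak{C}_{A'}\right\}, \] where $F_y=\partial F/\partial y$. (In particular, the condition $\phi'\in\mathfrak{C}_{A'}$ for $\phi \in \mathfrak{C}_A$ requires $\deg(\phi)\le N-3$, i.e. $\phi$ is represented by a polynomial in $x,y$ of total degree at most $N-3$.)
   Context: $k$ is a perfect field of characteristic $p>0$. $F=F(x,y)\in k[x,y]$ is a polynomial of total degree $N$, irreducible over the algebraic closure of $k$; $A=k[x,y]/\langle F\rangle$ and $C=\operatorname{Spec}A$. Denote by $k(C)$ the fraction field of $A$; the images of $x,y$ in $k(C)$ are again written $x,y$. It is assumed that $x\in k(C)$ is transcendental over $k$ and that $F(x,y)$ is monic in $y$ over $k[x]$ of degree $N$ (equal to the total degree of $F$) and separable as a polynomial in $y$ over $k(x)$. Embed $\mathbb{A}^2=\operatorname{Spec}k[x,y]$ in $\mathbb{P}^2=\operatorname{Proj}k[X,Y,Z]$ by $x=X/Z$, $y=Y/Z$; $C'$ is the Zariski closure of $C$ in $\mathbb{P}^2$ and $\tilde C$ is the desingularization (normalization) of $C'$, whose function field is $k(C)$. $\Omega_{\tilde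 C}$ is the sheaf of regular differential forms on $\tilde C$. Put $(x',y')=(1/x,\,y/x)$, let $F'(x',y')=F(x,y)/x^N$, which is a polynomial in $x',y'$ over $k$, and let $A'=k[x',y']/\langle F'\rangle$, regarded as a subring of $k(C)$ via $x'=1/x$, $y'=y/x$. For a domain $B$ with fraction field $k(C)$ and integral closure $\overline B$ in $k(C)$, the conductor is $\mathfrak{C}_B=\{z\in B\mid z\overline B\subset B\}$. *)

theory Defs
  imports
    "HOL-Computational_Algebra.Computational_Algebra"
    "HOL-Algebra.Algebraic_Closure_Type"
    "HOL-Library.Poly_Mapping"
begin

text \<open>
  A polynomial in \<open>k[x,y]\<close> is an element of \<^typ>\<open>'k poly poly\<close>: the outer variable is \<open>y\<close> and the
  inner variable is \<open>x\<close>, so that \<open>coeff (coeff P j) i\<close> is the coefficient of \<open>x\<^sup>i y\<^sup>j\<close>, \<^const>\<open>degree\<close>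
  and \<^const>\<open>lead_coeff\<close> refer to \<open>y\<close> over \<open>k[x]\<close>, and \<^const>\<open>pderiv\<close> is \<open>\<partial>/\<partial>y\<close>.
\<close>

text \<open>For \<open>P = 0\<close> the value is the dummy 0 (instead of \<open>-\<infinity>\<close>).\<close>

definition total_degree :: "'a::zero poly poly \<Rightarrow> nat" where
  "total_degree P = Max (insert 0 {i + j |i j. coeff (coeff P j) i \<noteq> 0})"

definition perfect_of_pos_char :: "'k::field itself \<Rightarrow> bool" where
  "perfect_of_pos_char _ \<longleftrightarrow> CHAR('k) > 0 \<and> (\<forall>a::'k. \<exists>b. b ^ CHAR('k) = a)"

definition geometrically_irreducible :: "'k::field poly poly \<Rightarrow> bool" where
  "geometrically_irreducible F \<longleftrightarrow>
     irreducible (map_poly (map_poly to_ac) F :: 'k alg_closure poly poly)"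

text \<open>Separability in \<open>y\<close> over the field \<open>k(x)\<close>, here \<^typ>\<open>'k poly fract\<close>.\<close>

definition separable_in_y :: "'k::field poly poly \<Rightarrow> bool" where
  "separable_in_y F \<longleftrightarrow>
     coprime (map_poly to_fract F :: 'k poly fract poly) (pderiv (map_poly to_fract F))"

text \<open>\<open>P(u,v)\<close> for \<open>u, v\<close> in an overfield, given by an embedding \<open>\<iota>\<close> of \<open>k\<close>.\<close>

definition eval2 :: "('k::field \<Rightarrow> 'K::field) \<Rightarrow> 'k poly poly \<Rightarrow> 'K \<Rightarrow> 'K \<Rightarrow> 'K" where
  "eval2 \<iota> P u v = poly (map_poly (\<lambda>q. poly (map_poly \<iota> q) u) P) v"

text \<open>The subring \<open>k[u,v]\<close>.\<close>

definition coord_ring :: "('k::field \<Rightarrow> 'K::field) \<Rightarrow> 'K \<Rightarrow> 'K \<Rightarrow> 'K set" where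
  "coord_ring \<iota> u v = range (\<lambda>P. eval2 \<iota> P u v)"

text \<open>
  The field \<^typ>\<open>'K\<close>, with the embedding \<open>\<iota>\<close> of \<open>k\<close> and the elements \<open>x, y\<close>, is the fraction field of
  \<open>k[x,y]/\<langle>F\<rangle>\<close>: evaluation at \<open>(x,y)\<close> has kernel \<open>\<langle>F\<rangle>\<close>, and every element is a quotient of values.
  In particular \<open>k[x,y]/\<langle>F\<rangle>\<close> is identified with \<open>coord_ring \<iota> x y\<close>.
\<close>

definition is_function_field ::
    "('k::field \<Rightarrow> 'K::field) \<Rightarrow> 'k poly poly \<Rightarrow> 'K \<Rightarrow> 'K \<Rightarrow> bool" where
  "is_function_field \<iota> F x y \<longleftrightarrow>
     \<iota> \<in> ring_hom ring_of_type_algebra ring_of_type_algebra \<and>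
     (\<forall>P. eval2 \<iota> P x y = 0 \<longleftrightarrow> F dvd P) \<and>
     (\<forall>z. \<exists>P Q. eval2 \<iota> Q x y \<noteq> 0 \<and> z = eval2 \<iota> P x y / eval2 \<iota> Q x y)"

definition transcendental_over :: "('k::field \<Rightarrow> 'K::field) \<Rightarrow> 'K \<Rightarrow> bool" where
  "transcendental_over \<iota> z \<longleftrightarrow> (\<forall>q. q \<noteq> 0 \<longrightarrow> poly (map_poly \<iota> q) z \<noteq> 0)"

definition integral_closure :: "'K::field set \<Rightarrow> 'K set" where
  "integral_closure B =
     {z. \<exists>q. lead_coeff q = 1 \<and> (\<forall>i. coeff q i \<in> B) \<and> poly q z = 0}"

definition conductor :: "'K::field set \<Rightarrow> 'K set" where
  "conductor B = {z \<in> B. \<forall>w \<in> integral_closure B. z * w \<in> B}"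


subsection \<open>The normalized projective closure\<close>

text \<open>
  The Zariski closure of the affine curve in \<open>\<P>\<^sup>2\<close> is the integral closed subscheme whose generic
  point is \<open>[x : y : 1]\<close>.  Its intersection with a standard affine open set, given by the
  nonvanishing of one homogeneous coordinate, is empty if that coordinate of \<open>[x : y : 1]\<close> is zero;
  otherwise it is \<open>Spec\<close> of the subring of the function field generated over \<open>k\<close> by the two affine
  coordinates.  The coordinate 1 gives \<open>k[x,y]\<close>.
\<close>

definition closure_charts :: "('k::field \<Rightarrow> 'K::field) \<Rightarrow> 'K \<Rightarrow> 'K \<Rightarrow> 'K set set" where
  "closure_charts \<iota> x y =
     {coord_ring \<iota> x y} \<union>
     (if x = 0 then {} else {coord_ring \<iota> (1 / x) (y / x)}) \<union>
     (if y = 0 then {} else {coord_ring \<iota> (x / y) (1 / y)})"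

definition localization :: "'K::field set \<Rightarrow> 'K set \<Rightarrow> 'K set" where
  "localization B \<pp> = {a / s |a s. a \<in> B \<and> s \<in> B \<and> s \<notin> \<pp>}"

text \<open>
  The normalization is covered by the spectra of the integral closures of the chart rings; its local
  rings (at all points, the generic one included) are the localizations of these at prime ideals.
\<close>

definition normalization_local_rings :: "('k::field \<Rightarrow> 'K::field) \<Rightarrow> 'K \<Rightarrow> 'K \<Rightarrow> 'K set set" where
  "normalization_local_rings \<iota> x y =
     {localization (integral_closure B) \<pp> |B \<pp>. B \<in> closure_charts \<iota> x y \<and>
        primeideal \<pp> (ring_of_type_algebra\<lparr>carrier := integral_closure B\<rparr>)}"


subsection \<open>Differential forms\<close>

text \<open>
  \<open>\<Omega>\<^bsub>K/k\<^esub>\<close> is the free \<open>K\<close>-vector space on symbols \<open>dg\<close> (\<open>g \<in> K\<close>) modulo additivity, the Leibniz rule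
  and \<open>dc = 0\<close> for \<open>c \<in> k\<close>.  The finitely supported function \<open>v\<close> stands for \<open>\<Sum>\<^sub>g v(g) dg\<close>, so
  \<open>Poly_Mapping.single g f\<close> stands for \<open>f dg\<close>.
\<close>

definition pm_scale :: "'K::field \<Rightarrow> ('K \<Rightarrow>\<^sub>0 'K) \<Rightarrow> ('K \<Rightarrow>\<^sub>0 'K)" where
  "pm_scale c v = Poly_Mapping.map (\<lambda>a. c * a) v"

definition kaehler_relators :: "('k::field \<Rightarrow> 'K::field) \<Rightarrow> ('K \<Rightarrow>\<^sub>0 'K) set" where
  "kaehler_relators \<iota> =
     {Poly_Mapping.single (a + b) 1 - Poly_Mapping.single a 1 - Poly_Mapping.single b 1 |a b. True} \<union>
     {Poly_Mapping.single (a * b) 1 - Poly_Mapping.single b a - Poly_Mapping.single a b |a b. True} \<union>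
     {Poly_Mapping.single (\<iota> c) 1 |c. True}"

definition kaehler_rel :: "('k::field \<Rightarrow> 'K::field) \<Rightarrow> (('K \<Rightarrow>\<^sub>0 'K) \<times> ('K \<Rightarrow>\<^sub>0 'K)) set" where
  "kaehler_rel \<iota> = {(v, w). v - w \<in> module.span pm_scale (kaehler_relators \<iota>)}"

definition rational_forms :: "('k::field \<Rightarrow> 'K::field) \<Rightarrow> ('K \<Rightarrow>\<^sub>0 'K) set set" where
  "rational_forms \<iota> = UNIV // kaehler_rel \<iota>"

text \<open>The rational form \<open>f dg\<close>.\<close>

definition form :: "('k::field \<Rightarrow> 'K::field) \<Rightarrow> 'K \<Rightarrow> 'K \<Rightarrow> ('K \<Rightarrow>\<^sub>0 'K) set" where
  "form \<iota> f g = kaehler_rel \<iota> `` {Poly_Mapping.single g f}"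

text \<open>
  The form \<open>\<omega>\<close> is regular at a point with local ring \<open>R\<close> if it is a finite sum \<open>\<Sum> f\<^sub>i dg\<^sub>i\<close> with
  \<open>f\<^sub>i, g\<^sub>i \<in> R\<close>, i.e. if it lies in the image of the stalk \<open>\<Omega>\<^bsub>R/k\<^esub>\<close>.
\<close>

definition regular_at :: "('k::field \<Rightarrow> 'K::field) \<Rightarrow> 'K set \<Rightarrow> ('K \<Rightarrow>\<^sub>0 'K) set \<Rightarrow> bool" where
  "regular_at \<iota> R \<omega> \<longleftrightarrow>
     (\<exists>v. Poly_Mapping.keys v \<subseteq> R \<and> (\<forall>g. Poly_Mapping.lookup v g \<in> R) \<and>
        \<omega> = kaehler_rel \<iota> `` {v})"

text \<open>
  Global sections of the sheaf of regular differential forms on the normalization of the projective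
  closure.  On this smooth curve the stalks embed into the rational forms, so a global section is a
  rational form that is regular at every point.
\<close>

definition global_regular_forms ::
    "('k::field \<Rightarrow> 'K::field) \<Rightarrow> 'K \<Rightarrow> 'K \<Rightarrow> ('K \<Rightarrow>\<^sub>0 'K) set set" where
  "global_regular_forms \<iota> x y =
     {\<omega> \<in> rational_forms \<iota>. \<forall>R \<in> normalization_local_rings \<iota> x y. regular_at \<iota> R \<omega>}"

end

(*
  Over k[x], Euler's formula says that F_y^-1 A is the dual of A under the trace form, so the
  conductor of A is F_y times the dual of the integral closure B: a description that depends on the
  generator y only through the factor F_y.  Let P be a maximal ideal of B.  Since k is perfect, the
  residue field at P is generated by a single separable element, which lifts to some b with B = k[x,b]
  near P.  If G is the equation of b, then G_x dx + G_b db = 0 with G_x, G_b coprime at P, so the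
  regular forms at P are exactly the multiples of dx / G_b.  Replacing b by y, the form f dx is regular
  at P iff s F_y f lies in the conductor of A for some s outside P; hence it is regular on the whole
  affine curve iff F_y f lies in the conductor.

  The chart with coordinates x' = 1/x, y' = y/x is again such a curve, with dx = -x^2 dx' and
  F_y = x^(N-1) F'_y', which gives the condition on phi / x^(N-3).  As F is monic in y of degree N, the
  point [0:1:0] does not lie on the curve, so the third chart contributes no condition.
*)

theory Submission
  imports Defs "Jordan_Normal_Form.Char_Poly"
begin

section \<open>Integral elements\<close>

text \<open>All rings are subsets of the one field \<open>'K\<close>, and residue fields are
  subfields of \<open>'k alg_closure\<close>. Finiteness comes from a single source:
  \<open>Fy\<close> carries the integral closure into \<open>A\<close>, so every k[x]-module in play
  has a basis of \<open>N\<close> elements, and determinants and traces become available. The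
  obstacle is the local generator. A lift b of a residue generator can fail to generate the integral
  closure near P for two reasons: \<mu>(b) may vanish to higher order at P, and other primes of the
  integral closure may lie over P \<inter> k[x,b]. A correction by a uniformizer repairs the former.
  For the latter, b is altered by a multiple of a square of an element of P, which preserves the
  repair and puts b into every other prime above \<pi>, while b stays outside P. Then Nakayama's
  lemma applies over k[x,b]. Forms are turned into functions by a derivation D with D x = 1, which
  exists because \<open>Fy\<close> is nonzero: dx is a basis of the rational forms, and f dx is
  regular at P iff f lies in the span of D R over the local ring R. The step from points to the
  whole affine curve uses the ideal of all s with s Fy f in the conductor: regularity keeps it out
  of every prime.\<close>

locale unital_subring =
  fixes S :: "'a::comm_ring_1 set"
  assumes one_mem: "1 \<in> S"
    and diff_mem: "a \<in> S \<Longrightarrow> b \<in> S \<Longrightarrow> a - b \<in> S"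
    and mult_mem: "a \<in> S \<Longrightarrow> b \<in> S \<Longrightarrow> a * b \<in> S"
begin

lemma zero_mem: "0 \<in> S"
  using diff_mem[OF one_mem one_mem] by simp

lemma uminus_mem: "a \<in> S \<Longrightarrow> - a \<in> S"
  using diff_mem[OF zero_mem] by simp

lemma add_mem: "a \<in> S \<Longrightarrow> b \<in> S \<Longrightarrow> a + b \<in> S"
  using diff_mem[OF _ uminus_mem, of a b] by simp

lemma sum_mem: "(\<And>i. i \<in> I \<Longrightarrow> f i \<in> S) \<Longrightarrow> sum f I \<in> S"
  by (induction I rule: infinite_finite_induct) (auto intro: zero_mem add_mem)

lemma prod_mem: "(\<And>i. i \<in> I \<Longrightarrow> f i \<in> S) \<Longrightarrow> prod f I \<in> S"
  by (induction I rule: infinite_finite_induct) (auto intro: one_mem mult_mem)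

lemma power_mem: "a \<in> S \<Longrightarrow> a ^ n \<in> S"
  by (induction n) (auto intro: one_mem mult_mem)

lemma of_nat_mem: "of_nat n \<in> S"
  by (induction n) (auto intro: one_mem zero_mem add_mem)

lemma of_int_mem: "of_int n \<in> S"
  by (cases n) (auto intro!: of_nat_mem diff_mem uminus_mem add_mem one_mem)

lemma poly_mem: "(\<And>i. coeff q i \<in> S) \<Longrightarrow> z \<in> S \<Longrightarrow> poly q z \<in> S"
  unfolding poly_altdef by (intro sum_mem mult_mem power_mem) auto

lemma unital_subring_poly: "unital_subring {q. \<forall>i. coeff q i \<in> S}"
  by unfold_locales
    (auto simp: coeff_mult coeff_1 intro!: sum_mem mult_mem diff_mem one_mem zero_mem)

text \<open>Each step of long division only multiplies by the leading coefficient of the dividend,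
  since that of \<open>g\<close> is 1; hence quotient and remainder stay over S. The alternative r =
  0 is needed because 0 has degree 0, for instance when g = 1.\<close>

lemma monic_division:
  assumes "lead_coeff g = 1" and "\<forall>i. coeff g i \<in> S" and "\<forall>i. coeff p i \<in> S"
  shows "\<exists>q r. (\<forall>i. coeff q i \<in> S) \<and> (\<forall>i. coeff r i \<in> S) \<and> p = g * q + r
           \<and> (r = 0 \<or> degree r < degree g)"
  using assms(3)
proof (induction "degree p" arbitrary: p rule: less_induct)
  case less
  interpret P: unital_subring "{q. \<forall>i. coeff q i \<in> S}" by (rule unital_subring_poly)
  show ?case
  proof (cases "p = 0 \<or> degree p < degree g")
    case True
    then show ?thesis using less.prems by (intro exI[of _ 0] exI[of _ p]) (auto intro: zero_mem)
  next
    case False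
    define m where "m = monom (lead_coeff p) (degree p - degree g)"
    have m: "\<forall>i. coeff m i \<in> S" using less.prems zero_mem by (auto simp: m_def coeff_monom)
    define p' where "p' = p - g * m"
    have p': "\<forall>i. coeff p' i \<in> S"
      using P.diff_mem[of p "g * m"] P.mult_mem[of g m] assms(2) m less.prems by (auto simp: p'_def)
    have dm: "degree (g * m) \<le> degree p"
      using False by (intro order.trans[OF degree_mult_le]) (auto simp: m_def intro: order.trans[OF add_mono[OF order.refl degree_monom_le]])
    have "coeff (g * m) (degree p) = lead_coeff p"
      using False assms(1) by (simp add: m_def mult.commute[of g] coeff_monom_mult)
    then have c0: "coeff p' (degree p) = 0" by (simp add: p'_def)
    have dp': "degree p' \<le> degree p" unfolding p'_def using dm by (intro degree_diff_le) auto
    show ?thesis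
    proof (cases "degree p = 0")
      case True
      then have "p' = 0" using c0 dp' by (metis le_zero_eq leading_coeff_0_iff)
      then show ?thesis using m by (intro exI[of _ m] exI[of _ 0]) (auto simp: p'_def zero_mem)
    next
      case dp: False
      have "degree p' < degree p"
        using c0 dp' dp by (metis coeff_eq_0 degree_0 le_neq_implies_less leading_coeff_0_iff not_gr_zero)
      from less.hyps[OF this p'] obtain q r where qr: "\<forall>i. coeff q i \<in> S" "\<forall>i. coeff r i \<in> S"
        "p' = g * q + r" "r = 0 \<or> degree r < degree g" by blast
      have "p = g * (q + m) + r" using qr(3) by (simp add: p'_def algebra_simps)
      moreover have "\<forall>i. coeff (q + m) i \<in> S" using qr(1) m add_mem by simp
      ultimately show ?thesis using qr by blast
    qed
  qed
qed

text \<open>By the Leibniz formula the characteristic polynomial is a sum of signed products of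
  entries of X - A, which lie in the subring S[X].\<close>

lemma char_poly_coeff_mem:
  assumes A: "A \<in> carrier_mat n n" and "\<And>i j. i < n \<Longrightarrow> j < n \<Longrightarrow> A $$ (i, j) \<in> S"
  shows "coeff (char_poly A) i \<in> S"
proof -
  interpret P: unital_subring "{q. \<forall>i. coeff q i \<in> S}" by (rule unital_subring_poly)
  have *: "char_poly_matrix A $$ (i, j) \<in> {q. \<forall>i. coeff q i \<in> S}" if "i < n" "j < n" for i j
    using A that assms(2)[OF that]
    by (auto simp: char_poly_matrix_def coeff_pCons split: nat.splits
        intro!: uminus_mem zero_mem one_mem diff_mem)
  have dim: "dim_row (char_poly_matrix A) = n" "dim_col (char_poly_matrix A) = n"
    using char_poly_matrix_closed[OF A] by auto
  have "(\<Sum>p | p permutes {0..<n}. of_int (sign p) * (\<Prod>i = 0..<n. char_poly_matrix A $$ (i, p i)))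
          \<in> {q. \<forall>i. coeff q i \<in> S}"
  proof (intro P.sum_mem P.mult_mem P.prod_mem P.of_int_mem)
    fix p i assume "p \<in> {p. p permutes {0..<n}}" "i \<in> {0..<n}"
    then show "char_poly_matrix A $$ (i, p i) \<in> {q. \<forall>i. coeff q i \<in> S}"
      using permutes_in_image[of p "{0..<n}" i] by (intro *) auto
  qed
  then have "char_poly A \<in> {q. \<forall>i. coeff q i \<in> S}"
    by (simp add: char_poly_def det_def dim)
  then show ?thesis by blast
qed

end

text \<open>The equations say that v is an eigenvector of the matrix for z; the nonzero entry at
  \<open>i0\<close> makes it a legitimate one.\<close>

lemma root_char_poly:
  fixes z :: "'a::field"
  assumes v: "i0 < n" "v i0 \<noteq> 0"
    and eq: "\<And>i. i < n \<Longrightarrow> z * v i = (\<Sum>j<n. m i j * v j)"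
  shows "poly (char_poly (mat n n (\<lambda>(i, j). m i j))) z = 0"
proof -
  let ?A = "mat n n (\<lambda>(i, j). m i j)"
  have A: "?A \<in> carrier_mat n n" by simp
  have "eigenvector ?A (vec n v) z"
    unfolding eigenvector_def using v eq
    by (auto simp: vec_eq_iff scalar_prod_def lessThan_atLeast0)
  then show ?thesis using eigenvalue_root_char_poly[OF A] by (auto simp: eigenvalue_def)
qed

lemma integral_closureI:
  assumes "lead_coeff q = 1" "\<And>i. coeff q i \<in> B" "poly q z = 0"
  shows "z \<in> integral_closure B"
  using assms by (auto simp: integral_closure_def)

lemma integral_closureE:
  assumes "z \<in> integral_closure B"
  obtains q where "lead_coeff q = 1" "\<And>i. coeff q i \<in> B" "poly q z = 0"
  using assms by (auto simp: integral_closure_def)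

lemma integral_closure_mono: "B \<subseteq> C \<Longrightarrow> integral_closure B \<subseteq> integral_closure C"
  unfolding integral_closure_def by blast

locale field_subring = unital_subring S for S :: "'a::field set"
begin

lemma subset_integral_closure: "S \<subseteq> integral_closure S"
  by (auto intro!: integral_closureI[of "[:- _, 1:]"] simp: coeff_pCons uminus_mem zero_mem one_mem
      split: nat.splits)

text \<open>The determinant trick.\<close>

lemma integral_if_stable_family:
  assumes fin: "finite I" and v: "k \<in> I" "v k \<noteq> 0"
    and eq: "\<And>i. i \<in> I \<Longrightarrow> z * v i = (\<Sum>j\<in>I. m i j * v j)"
    and m: "\<And>i j. i \<in> I \<Longrightarrow> j \<in> I \<Longrightarrow> m i j \<in> S"
  shows "z \<in> integral_closure S"
proof -
  define n where "n = card I"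
  obtain f where f: "bij_betw f {..<n} I"
    using ex_bij_betw_nat_finite[OF fin] by (auto simp: n_def lessThan_atLeast0)
  have fI: "f i \<in> I" if "i < n" for i using f that by (auto simp: bij_betw_def)
  obtain k0 where k0: "k0 < n" "f k0 = k" using f v(1) by (auto simp: bij_betw_def)
  let ?A = "mat n n (\<lambda>(i, j). m (f i) (f j))"
  have A: "?A \<in> carrier_mat n n" by simp
  have "poly (char_poly ?A) z = 0"
  proof (rule root_char_poly[of k0 n "\<lambda>i. v (f i)"])
    show "z * v (f i) = (\<Sum>j<n. m (f i) (f j) * v (f j))" if "i < n" for i
      unfolding eq[OF fI[OF that]] by (rule sum.reindex_bij_betw[OF f, symmetric])
  qed (use k0 v in auto)
  moreover have "coeff (char_poly ?A) i \<in> S" for i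
    using m fI by (intro char_poly_coeff_mem[OF A]) auto
  moreover have "lead_coeff (char_poly ?A) = 1" using degree_monic_char_poly[OF A] by simp
  ultimately show ?thesis by (intro integral_closureI)
qed

lemma monic_rewrite_power:
  assumes "lead_coeff q = 1" "\<And>i. coeff q i \<in> S" "poly q z = 0"
  obtains c where "\<And>i. c i \<in> S" "z ^ degree q = (\<Sum>i<degree q. c i * z ^ i)"
proof -
  have "0 = (\<Sum>i<degree q. coeff q i * z ^ i) + z ^ degree q"
    using assms(1,3) by (simp add: poly_altdef lessThan_Suc_atMost[symmetric])
  then have "z ^ degree q = - (\<Sum>i<degree q. coeff q i * z ^ i)" by (simp add: eq_neg_iff_add_eq_0 add.commute)
  also have "\<dots> = (\<Sum>i<degree q. (- coeff q i) * z ^ i)" by (simp add: sum_negf)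
  finally show thesis using assms(2) uminus_mem by (intro that[of "\<lambda>i. - coeff q i"]) auto
qed

text \<open>The products a^i b^j below the degrees of monic equations of a and b form a family
  stable under both elements. If A and B are the matrices of multiplication by a and b on it, then A
  - B and the matrix product A B serve for a - b and a b.\<close>

lemma integral_closure_pair:
  assumes a: "a \<in> integral_closure S" and b: "b \<in> integral_closure S"
  shows "a - b \<in> integral_closure S" "a * b \<in> integral_closure S"
proof -
  obtain q where q: "lead_coeff q = 1" "\<And>i. coeff q i \<in> S" "poly q a = 0"
    using a by (rule integral_closureE) blast
  obtain r where r: "lead_coeff r = 1" "\<And>i. coeff r i \<in> S" "poly r b = 0"
    using b by (rule integral_closureE) blast
  have pos: "0 < degree q" "0 < degree r"
    using q r by (metis degree_0_id leading_coeff_0_iff gr0I one_neq_zero poly_1 monom_0 one_pCons poly_pCons lead_coeff_pCons(1) mult_zero_right add.right_neutral degree_eq_zeroE)+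
  obtain c where c: "\<And>i. c i \<in> S" "a ^ degree q = (\<Sum>i<degree q. c i * a ^ i)"
    using monic_rewrite_power[OF q] by blast
  obtain d where d: "\<And>i. d i \<in> S" "b ^ degree r = (\<Sum>i<degree r. d i * b ^ i)"
    using monic_rewrite_power[OF r] by blast
  let ?m = "degree q" and ?n = "degree r"
  define I where "I = {..<?m} \<times> {..<?n}"
  define v where "v = (\<lambda>(i, j). a ^ i * b ^ j)"
  \<comment> \<open>\<open>A\<close> is the companion matrix of q acting on the first index,
    \<open>B\<close> that of r acting on the second.\<close>
  define A :: "nat \<times> nat \<Rightarrow> nat \<times> nat \<Rightarrow> 'a" where "A = (\<lambda>(i, j) (i', j'). if j' = j then (if Suc i < ?m then (if i' = Suc i then 1 else 0) else c i') else 0)"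
  define B :: "nat \<times> nat \<Rightarrow> nat \<times> nat \<Rightarrow> 'a" where "B = (\<lambda>(i, j) (i', j'). if i' = i then (if Suc j < ?n then (if j' = Suc j then 1 else 0) else d j') else 0)"
  have AS: "A k l \<in> S" and BS: "B k l \<in> S" for k l
    using c(1) d(1) one_mem zero_mem by (auto simp: A_def B_def split: prod.splits)
  have Aeq: "a * v k = (\<Sum>l\<in>I. A k l * v l)" if kI: "k \<in> I" for k
  proof -
    obtain i j where k: "k = (i, j)" "i < ?m" "j < ?n" using kI by (auto simp: I_def)
    have "(\<Sum>l\<in>I. A k l * v l) = (\<Sum>i'<?m. \<Sum>j'<?n. A (i, j) (i', j') * (a ^ i' * b ^ j'))"
      by (simp add: I_def k v_def sum.cartesian_product case_prod_beta')
    also have "\<dots> = (\<Sum>i'<?m. (if Suc i < ?m then (if i' = Suc i then 1 else 0) else c i') * (a ^ i' * b ^ j))"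
      by (intro sum.cong refl, subst sum.remove[of _ j]) (use k in \<open>auto simp: A_def intro!: sum.neutral\<close>)
    also have "\<dots> = (\<Sum>i'<?m. (if Suc i < ?m then (if i' = Suc i then 1 else 0) else c i') * a ^ i') * b ^ j"
      by (simp add: sum_distrib_right mult.assoc)
    also have "(\<Sum>i'<?m. (if Suc i < ?m then (if i' = Suc i then 1 else 0) else c i') * a ^ i') = a ^ Suc i"
    proof (cases "Suc i < ?m")
      case True
      then show ?thesis by (subst sum.remove[of _ "Suc i"]) (auto intro!: sum.neutral)
    next
      case False
      then have "?m = Suc i" using k by simp
      then show ?thesis using c(2) by simp
    qed
    finally show ?thesis by (simp add: k v_def mult.assoc)
  qed
  have Beq: "b * v k = (\<Sum>l\<in>I. B k l * v l)" if kI: "k \<in> I" for k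
  proof -
    obtain i j where k: "k = (i, j)" "i < ?m" "j < ?n" using kI by (auto simp: I_def)
    have "(\<Sum>l\<in>I. B k l * v l) = (\<Sum>i'<?m. \<Sum>j'<?n. B (i, j) (i', j') * (a ^ i' * b ^ j'))"
      by (simp add: I_def k v_def sum.cartesian_product case_prod_beta')
    also have "\<dots> = (\<Sum>j'<?n. (if Suc j < ?n then (if j' = Suc j then 1 else 0) else d j') * (a ^ i * b ^ j'))"
      by (subst sum.remove[of _ i]) (use k in \<open>auto simp: B_def intro!: sum.neutral\<close>)
    also have "\<dots> = a ^ i * (\<Sum>j'<?n. (if Suc j < ?n then (if j' = Suc j then 1 else 0) else d j') * b ^ j')"
      by (simp add: sum_distrib_left mult_ac)
    also have "(\<Sum>j'<?n. (if Suc j < ?n then (if j' = Suc j then 1 else 0) else d j') * b ^ j') = b ^ Suc j"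
    proof (cases "Suc j < ?n")
      case True
      then show ?thesis by (subst sum.remove[of _ "Suc j"]) (auto intro!: sum.neutral)
    next
      case False
      then have "?n = Suc j" using k by simp
      then show ?thesis using d(2) by simp
    qed
    finally show ?thesis by (simp add: k v_def mult_ac)
  qed
  have fin: "finite I" by (simp add: I_def)
  have i0: "(0, 0) \<in> I" "v (0, 0) \<noteq> 0" using pos by (auto simp: I_def v_def)
  show "a - b \<in> integral_closure S"
    by (rule integral_if_stable_family[where v = v, OF fin i0, of _ "\<lambda>k l. A k l - B k l"])
      (auto simp: left_diff_distrib sum_subtractf Aeq Beq AS BS diff_mem)
  show "a * b \<in> integral_closure S"
  proof (rule integral_if_stable_family[where v = v, OF fin i0, of _ "\<lambda>k l. \<Sum>h\<in>I. A k h * B h l"])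
    show "a * b * v k = (\<Sum>l\<in>I. (\<Sum>h\<in>I. A k h * B h l) * v l)" if k: "k \<in> I" for k
    proof -
      have "a * b * v k = b * (\<Sum>h\<in>I. A k h * v h)" using Aeq[OF k] by (simp add: mult_ac)
      also have "\<dots> = (\<Sum>h\<in>I. A k h * (b * v h))" by (simp add: sum_distrib_left mult_ac)
      also have "\<dots> = (\<Sum>h\<in>I. A k h * (\<Sum>l\<in>I. B h l * v l))" using Beq by simp
      also have "\<dots> = (\<Sum>l\<in>I. (\<Sum>h\<in>I. A k h * B h l) * v l)"
        by (simp add: sum_distrib_left sum_distrib_right mult.assoc) (rule sum.swap)
      finally show ?thesis .
    qed
  qed (intro sum_mem mult_mem AS BS)
qed

lemma field_subring_integral_closure: "field_subring (integral_closure S)"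
  using integral_closure_pair subset_integral_closure one_mem by unfold_locales auto

end

text \<open>Nakayama's lemma with explicit denominators. Modulo Q the system is diagonal with
  entries outside Q, so its determinant stays outside Q; Gaussian elimination of one unknown at a
  time produces a multiplier \<sigma> outside Q without any localization. The unknowns
  \<open>a i\<close> need not lie in B.\<close>

lemma nakayama_elimination:
  fixes B Q :: "'a::comm_ring_1 set" and n :: nat
  assumes B: "unital_subring B" and QB: "Q \<subseteq> B"
    and Qdiff: "\<And>u v. u \<in> Q \<Longrightarrow> v \<in> Q \<Longrightarrow> u - v \<in> Q"
    and Qmult: "\<And>u v. u \<in> B \<Longrightarrow> v \<in> Q \<Longrightarrow> u * v \<in> Q"
    and Qprime: "\<And>u v. u \<in> B \<Longrightarrow> v \<in> B \<Longrightarrow> u \<notin> Q \<Longrightarrow> v \<notin> Q \<Longrightarrow> u * v \<notin> Q"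
    and Q1: "1 \<notin> Q"
    and "\<And>i. i < n \<Longrightarrow> s i \<in> B - Q" "\<And>i. i < n \<Longrightarrow> \<beta> i \<in> B"
    and "\<And>i j. i < n \<Longrightarrow> j < n \<Longrightarrow> q i j \<in> Q"
    and "\<And>i. i < n \<Longrightarrow> s i * a i = \<beta> i + (\<Sum>j<n. q i j * a j)"
  shows "\<exists>\<sigma>\<in>B - Q. \<forall>i<n. \<sigma> * a i \<in> B"
  using assms(7-)
proof (induction n arbitrary: s \<beta> q)
  case 0
  then show ?case using unital_subring.one_mem[OF B] Q1 by auto
next
  case (Suc n)
  interpret unital_subring B by (rule B)
  have Qadd: "u + v \<in> Q" if "u \<in> Q" "v \<in> Q" for u v
    using Qdiff[OF that(1) Qdiff[OF Qdiff[OF that(2) that(2)] that(2)]] by simp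
  \<comment> \<open>The coefficient of the last unknown once its own term is moved to the left. It
    is outside Q because \<open>s n\<close> is, and multiplying the other relations by it allows the
    substitution for \<tau> \<open>a n\<close>.\<close>
  define \<tau> where "\<tau> = s n - q n n"
  have \<tau>B: "\<tau> \<in> B" using Suc.prems(1,3)[of n] QB diff_mem by (auto simp: \<tau>_def)
  have \<tau>Q: "\<tau> \<notin> Q" using Qadd[of \<tau> "q n n"] Suc.prems(1,3)[of n] by (auto simp: \<tau>_def)
  have \<tau>a: "\<tau> * a n = \<beta> n + (\<Sum>j<n. q n j * a j)"
    using Suc.prems(4)[of n] by (simp add: \<tau>_def algebra_simps)
  define s' where "s' i = \<tau> * s i" for i
  define \<beta>' where "\<beta>' i = \<tau> * \<beta> i + q i n * \<beta> n" for i
  define q' where "q' i j = \<tau> * q i j + q i n * q n j" for i j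
  have "\<exists>\<sigma>\<in>B - Q. \<forall>i<n. \<sigma> * a i \<in> B"
  proof (rule Suc.IH[of s' \<beta>' q'])
    fix i assume i: "i < n"
    show "s' i \<in> B - Q"
      using Suc.prems(1)[of i] i \<tau>B \<tau>Q Qprime[of \<tau> "s i"] mult_mem by (auto simp: s'_def)
    have qin: "q i n \<in> Q" using Suc.prems(3)[of i n] i by simp
    then show "\<beta>' i \<in> B"
      using Suc.prems(2) i \<tau>B QB by (auto simp: \<beta>'_def intro!: add_mem mult_mem)
    show "q' i j \<in> Q" if "j < n" for j
      unfolding q'_def using Suc.prems(3) i that \<tau>B QB qin by (intro Qadd Qmult) auto
    have "s' i * a i = \<tau> * (\<beta> i + (\<Sum>j<n. q i j * a j)) + q i n * (\<tau> * a n)"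
      using Suc.prems(4)[of i] i by (simp add: s'_def algebra_simps)
    also have "\<dots> = \<beta>' i + (\<Sum>j<n. q' i j * a j)"
      unfolding \<tau>a \<beta>'_def q'_def
      by (simp add: algebra_simps sum_distrib_left sum.distrib)
    finally show "s' i * a i = \<beta>' i + (\<Sum>j<n. q' i j * a j)" .
  qed
  then obtain \<sigma> where \<sigma>: "\<sigma> \<in> B - Q" "\<And>i. i < n \<Longrightarrow> \<sigma> * a i \<in> B" by blast
  have "\<sigma> * \<tau> \<in> B - Q" using \<sigma> \<tau>B \<tau>Q Qprime mult_mem by auto
  moreover have "\<sigma> * \<tau> * a i \<in> B" if "i < Suc n" for i
  proof (cases "i = n")
    case True
    have "\<sigma> * \<tau> * a n = \<sigma> * \<beta> n + (\<Sum>j<n. q n j * (\<sigma> * a j))"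
      unfolding mult.assoc \<tau>a by (simp add: algebra_simps sum_distrib_left)
    then show ?thesis
      using True \<sigma> Suc.prems(2,3) QB by (auto intro!: add_mem sum_mem mult_mem[of "q _ _"] mult_mem[of \<sigma> "\<beta> _"])
  next
    case False
    then show ?thesis using that mult_mem[OF \<tau>B \<sigma>(2)[of i]] by (simp add: mult_ac)
  qed
  ultimately show ?case by blast
qed

section \<open>Plane models of a function field\<close>

lemma poly_reduce_monic:
  fixes F P :: "'a::idom poly"
  assumes "lead_coeff F = 1"
  shows "\<exists>Q R. P = F * Q + R \<and> (R = 0 \<or> degree R < degree F)"
proof -
  interpret unital_subring "UNIV :: 'a set" by unfold_locales auto
  show ?thesis using monic_division[of F P] assms by auto
qed

lemma common_denominator:
  fixes c :: "'i \<Rightarrow> 'a::idom fract"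
  assumes "finite I"
  shows "\<exists>d a. d \<noteq> 0 \<and> (\<forall>i\<in>I. to_fract d * c i = to_fract (a i))"
  using assms
proof (induction I)
  case empty
  then show ?case by (intro exI[of _ 1]) auto
next
  case (insert j I)
  then obtain d a where d: "d \<noteq> 0" "\<And>i. i \<in> I \<Longrightarrow> to_fract d * c i = to_fract (a i)" by blast
  obtain u v where uv: "c j = Fraction_Field.Fract u v" "v \<noteq> 0" by (cases "c j") auto
  have cj: "to_fract v * c j = to_fract u"
    using uv by (simp add: to_fract_def eq_fract)
  define a' where "a' i = (if i = j then d * u else v * a i)" for i
  have "to_fract (d * v) * c i = to_fract (a' i)" if "i \<in> insert j I" for i
  proof (cases "i = j")
    case True
    then show ?thesis using cj by (simp add: a'_def mult.assoc)
  next
    case False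
    then have "to_fract d * c i = to_fract (a i)" using that d by auto
    then show ?thesis using False by (simp add: a'_def mult_ac)
  qed
  then show ?case using d uv by (intro exI[of _ "d * v"] exI[of _ a']) auto
qed

section \<open>The subring k[x], the subfield k(x), and traces over it\<close>

locale rational_subfield = base: idom_hom \<iota>
  for \<iota> :: "'k::field \<Rightarrow> 'K::field" +
  fixes x :: 'K
  assumes transcendental: "transcendental_over \<iota> x"
begin

definition xpoly :: "'k poly \<Rightarrow> 'K" where
  "xpoly q = poly (map_poly \<iota> q) x"

lemma xpoly_eq_0_iff: "xpoly q = 0 \<longleftrightarrow> q = 0"
  using transcendental by (auto simp: xpoly_def transcendental_over_def)

sublocale xpoly: idom_hom xpoly
proof -
  interpret map_poly_idom_hom \<iota> ..
  show "idom_hom xpoly"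
    by unfold_locales (simp_all add: xpoly_def hom_distribs)
qed

sublocale xpoly: inj_comm_ring_hom xpoly
  by unfold_locales (simp add: xpoly_eq_0_iff)

sublocale xpoly: inj_idom_hom xpoly ..

lemma xpoly_const [simp]: "xpoly [:c:] = \<iota> c"
  by (simp add: xpoly_def Polynomial.map_poly_pCons)

lemma xpoly_X [simp]: "xpoly [:0, 1:] = x"
  by (simp add: xpoly_def Polynomial.map_poly_pCons)

abbreviation kx :: "'K set" where "kx \<equiv> range xpoly"

sublocale kx: field_subring kx
proof
  show "1 \<in> kx" using xpoly.hom_one by (metis rangeI)
  show "a - b \<in> kx" "a * b \<in> kx" if "a \<in> kx" "b \<in> kx" for a b
    using that by (auto simp flip: xpoly.hom_minus xpoly.hom_mult)
qed

abbreviation kx_bar :: "'K set" where "kx_bar \<equiv> integral_closure kx"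

sublocale kx_bar: field_subring kx_bar
  by (rule kx.field_subring_integral_closure)

lemma x_in_kx: "x \<in> kx"
  using xpoly_X by (metis rangeI)

lemma kx_subset_kx_bar: "kx \<subseteq> kx_bar"
  by (rule kx.subset_integral_closure)

text \<open>Powers of X are split off until the constant term is nonzero; this preserves the root
  because w is nonzero. The remaining equation reads w p(w) = a.\<close>

lemma algebraic_relation:
  assumes "q \<noteq> 0" "\<And>i. coeff q i \<in> kx" "poly q w = 0" "w \<noteq> 0"
  shows "\<exists>p a. a \<noteq> 0 \<and> a \<in> kx \<and> (\<forall>i. coeff p i \<in> kx) \<and> w * poly p w = a"
  using assms
proof (induction q)
  case 0
  then show ?case by simp
next
  case (pCons a q)
  have cq: "coeff q i \<in> kx" for i using pCons.prems(2)[of "Suc i"] by simp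
  have a: "a \<in> kx" using pCons.prems(2)[of 0] by simp
  have e: "a + w * poly q w = 0" using pCons.prems(3) by simp
  show ?case
  proof (cases "a = 0")
    case True
    then have "q \<noteq> 0" "poly q w = 0" using pCons e by auto
    then show ?thesis using pCons.IH cq pCons.prems(4) by blast
  next
    case False
    have "w * poly q w = - a" using e by (simp add: eq_neg_iff_add_eq_0 add.commute)
    then show ?thesis using False cq kx.uminus_mem[OF a] by (intro exI[of _ q] exI[of _ "- a"]) auto
  qed
qed

text \<open>A nonzero integral element divides a nonzero element of k[x], with a cofactor polynomial
  in the element itself. This is what allows all denominators to be taken in k[x].\<close>

lemma integral_inverse:
  assumes "w \<in> kx_bar" "w \<noteq> 0"
  obtains p c where "c \<noteq> 0" "\<And>i. coeff p i \<in> kx" "w * poly p w = xpoly c"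
proof -
  obtain q where q: "lead_coeff q = 1" "\<And>i. coeff q i \<in> kx" "poly q w = 0"
    using assms(1) by (rule integral_closureE) blast
  then have "q \<noteq> 0" by auto
  from algebraic_relation[OF this q(2,3) assms(2)] obtain p a where
    "a \<noteq> 0" "a \<in> kx" and p: "\<forall>i. coeff p i \<in> kx" "w * poly p w = a" by blast
  then obtain c where "c \<noteq> 0" "a = xpoly c" by auto
  with p show thesis by (intro that[of c p]) auto
qed

text \<open>The field k(x) is the type \<open>'k poly fract\<close>; this is the extension of
  \<open>xpoly\<close> to it. \<open>emb_Fract\<close> shows independence of the chosen fraction. It
  supplies the scalars that make K a vector space over k(x).\<close>

definition emb :: "'k poly fract \<Rightarrow> 'K" where
  "emb c = (THE w. \<exists>a b. b \<noteq> 0 \<and> c = Fraction_Field.Fract a b \<and> w = xpoly a / xpoly b)"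

lemma emb_Fract: "b \<noteq> 0 \<Longrightarrow> emb (Fraction_Field.Fract a b) = xpoly a / xpoly b"
  unfolding emb_def
  by (rule the_equality) (auto simp: eq_fract frac_eq_eq xpoly_eq_0_iff simp flip: xpoly.hom_mult)

lemma emb_to_fract [simp]: "emb (to_fract a) = xpoly a"
  by (simp add: to_fract_def emb_Fract)

sublocale emb: field_hom emb
proof
  show "emb 0 = 0" "emb 1 = 1" using emb_to_fract[of 0] emb_to_fract[of 1] by simp_all
  fix c d :: "'k poly fract"
  obtain a b where c: "c = Fraction_Field.Fract a b" "b \<noteq> 0" by (cases c) auto
  obtain a' b' where d: "d = Fraction_Field.Fract a' b'" "b' \<noteq> 0" by (cases d) auto
  show "emb (c + d) = emb c + emb d" "emb (c * d) = emb c * emb d"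
    using c d by (simp_all add: emb_Fract xpoly.hom_add xpoly.hom_mult xpoly_eq_0_iff add_frac_eq)
qed

sublocale vector_space "\<lambda>c z. emb c * z"
  by unfold_locales (simp_all add: emb.hom_add emb.hom_mult algebra_simps)

text \<open>The trace over k(x) of multiplication by w, as the sum of the diagonal entries of its
  matrix in the basis B.\<close>

definition trace_wrt :: "'K set \<Rightarrow> 'K \<Rightarrow> 'k poly fract" where
  "trace_wrt B w = (\<Sum>b\<in>B. representation B (w * b) b)"

text \<open>Inserting the expansion in C into the trace over B gives a double sum of products of two
  coefficient matrices. Exchanging the sums is tr(M M') = tr(M' M), and the result is the trace over
  C.\<close>

lemma trace_wrt_basis_independent:
  assumes B: "finite B" "independent B" "span B = UNIV"
    and C: "finite C" "independent C" "span C = UNIV"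
  shows "trace_wrt B w = trace_wrt C w"
proof -
  have r: "(\<Sum>b\<in>D. emb (representation D v b) * b) = v"
    if "finite D" "independent D" "span D = UNIV" for D v
    using sum_representation_eq[of D v D] that by auto
  have s: "representation D (\<Sum>i\<in>I. emb (c i) * v i) d = (\<Sum>i\<in>I. c i * representation D (v i) d)"
    if "independent D" "span D = UNIV" for D v d c and I :: "'K set"
    using that by (simp add: representation_sum representation_scale)
  have "trace_wrt B w = (\<Sum>b\<in>B. representation B (\<Sum>c\<in>C. emb (representation C (w * b) c) * c) b)"
    unfolding trace_wrt_def r[OF C] ..
  also have "\<dots> = (\<Sum>b\<in>B. \<Sum>c\<in>C. representation C (w * b) c * representation B c b)"
    by (simp add: s[OF B(2,3)])
  also have "\<dots> = (\<Sum>c\<in>C. \<Sum>b\<in>B. representation B c b * representation C (w * b) c)"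
    by (subst sum.swap) (simp add: mult.commute)
  also have "\<dots> = (\<Sum>c\<in>C. representation C (\<Sum>b\<in>B. emb (representation B c b) * (w * b)) c)"
    by (simp add: s[OF C(2,3)])
  also have "\<dots> = (\<Sum>c\<in>C. representation C (w * (\<Sum>b\<in>B. emb (representation B c b) * b)) c)"
    by (simp add: sum_distrib_left mult_ac)
  also have "\<dots> = trace_wrt C w" unfolding trace_wrt_def r[OF B] ..
  finally show ?thesis .
qed

lemma eval2_xpoly: "eval2 \<iota> P x y = poly (map_poly xpoly P) y"
  by (simp add: eval2_def xpoly_def[abs_def])

lemma eval2_hom: "idom_hom (\<lambda>P. eval2 \<iota> P x y)"
proof -
  interpret map_poly_idom_hom xpoly ..
  show ?thesis
    by unfold_locales (simp_all add: eval2_xpoly hom_distribs)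
qed

lemma eval2_sum_coeff:
  assumes "degree P < n"
  shows "eval2 \<iota> P x y = (\<Sum>i<n. xpoly (coeff P i) * y ^ i)"
proof -
  have "degree (map_poly xpoly P) < n" using assms by (simp add: xpoly.degree_map_poly_hom)
  then have "poly (map_poly xpoly P) y = (\<Sum>i<n. coeff (map_poly xpoly P) i * y ^ i)"
    unfolding poly_altdef by (intro sum.mono_neutral_left) (auto simp: coeff_eq_0)
  then show ?thesis by (simp add: eval2_xpoly)
qed

lemma field_subring_coord_ring: "field_subring (coord_ring \<iota> x y)"
proof -
  interpret ev: idom_hom "\<lambda>P. eval2 \<iota> P x y" by (rule eval2_hom)
  show ?thesis
  proof
    show "1 \<in> coord_ring \<iota> x y" unfolding coord_ring_def using ev.hom_one by (metis rangeI)
    show "a - b \<in> coord_ring \<iota> x y" "a * b \<in> coord_ring \<iota> x y"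
      if "a \<in> coord_ring \<iota> x y" "b \<in> coord_ring \<iota> x y" for a b
      using that unfolding coord_ring_def by (auto simp flip: ev.hom_minus ev.hom_mult)
  qed
qed

lemma eval2_const [simp]: "eval2 \<iota> [:a:] x y = xpoly a"
  by (simp add: eval2_xpoly Polynomial.map_poly_pCons)

lemma eval2_Y [simp]: "eval2 \<iota> [:0, 1:] x y = y"
  by (simp add: eval2_xpoly Polynomial.map_poly_pCons)

lemma eval2_monom: "eval2 \<iota> (monom a i) x y = xpoly a * y ^ i"
  by (simp add: eval2_xpoly map_poly_monom poly_monom)

lemma kx_subset_coord_ring: "kx \<subseteq> coord_ring \<iota> x y"
  unfolding coord_ring_def using eval2_const by (metis image_subset_iff rangeI)

lemma gen_in_coord_ring: "y \<in> coord_ring \<iota> x y"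
  unfolding coord_ring_def using eval2_Y by (metis rangeI)

lemma coord_ring_subset:
  assumes "unital_subring S" "kx \<subseteq> S" "y \<in> S"
  shows "coord_ring \<iota> x y \<subseteq> S"
proof -
  interpret unital_subring S by fact
  show ?thesis
    using assms(2,3) by (auto simp: coord_ring_def eval2_xpoly intro!: poly_mem)
qed

end

text \<open>That \<open>F\<close> generates all relations is expressed by the absence of a nonzero
  relation of smaller degree in y. This form can be checked by a dimension count for another
  generator, or by clearing powers of x in another chart.\<close>

locale plane_curve = rational_subfield \<iota> x
  for \<iota> :: "'k::field \<Rightarrow> 'K::field" and x :: 'K +
  fixes y :: 'K and F :: "'k poly poly"
  assumes monic: "lead_coeff F = 1"
    and root: "eval2 \<iota> F x y = 0"
    and no_smaller_relation: "degree P < degree F \<Longrightarrow> eval2 \<iota> P x y = 0 \<Longrightarrow> P = 0"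
    and quotients: "\<exists>P Q. eval2 \<iota> Q x y \<noteq> 0 \<and> z = eval2 \<iota> P x y / eval2 \<iota> Q x y"
begin

sublocale ev: idom_hom "\<lambda>P. eval2 \<iota> P x y"
  by (rule eval2_hom)

abbreviation A :: "'K set" where "A \<equiv> coord_ring \<iota> x y"

abbreviation N :: nat where "N \<equiv> degree F"

sublocale A: field_subring A
  by (rule field_subring_coord_ring)

lemma N_pos: "0 < N"
proof (rule ccontr)
  assume "\<not> 0 < N"
  then have "F = [:1:]" using monic by (metis degree_eq_zeroE gr0I lead_coeff_pCons(2) pCons_eq_0_iff coeff_pCons_0 degree_0_id)
  then show False using root by simp
qed

lemma eval2_eq_0_iff: "eval2 \<iota> P x y = 0 \<longleftrightarrow> F dvd P"
proof
  assume "eval2 \<iota> P x y = 0"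
  obtain Q R where P: "P = F * Q + R" "R = 0 \<or> degree R < N"
    using poly_reduce_monic[OF monic] by blast
  then have "eval2 \<iota> R x y = 0" using \<open>eval2 \<iota> P x y = 0\<close> root by (simp add: ev.hom_add ev.hom_mult)
  then have "R = 0" using P(2) no_smaller_relation by blast
  then show "F dvd P" using P by simp
qed (auto simp: ev.hom_mult root elim!: dvdE)

lemma A_cases:
  assumes "z \<in> A"
  obtains P where "degree P < N" "z = eval2 \<iota> P x y"
proof -
  obtain P where z: "z = eval2 \<iota> P x y" using assms by (auto simp: coord_ring_def)
  obtain Q R where P: "P = F * Q + R" "R = 0 \<or> degree R < N"
    using poly_reduce_monic[OF monic] by blast
  then show thesis using that[of R] z root N_pos by (auto simp: ev.hom_add ev.hom_mult)
qed

lemma eval2_in_A [simp]: "eval2 \<iota> P x y \<in> A"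
  by (auto simp: coord_ring_def)

lemma eval2_smult: "eval2 \<iota> (smult a P) x y = xpoly a * eval2 \<iota> P x y"
  using ev.hom_mult[of "[:a:]" P] by simp

lemma xpoly_in_A [simp]: "xpoly a \<in> A"
  using kx_subset_coord_ring by auto

lemma y_in_A [simp]: "y \<in> A"
  by (rule gen_in_coord_ring)

lemma A_coordinates: "\<exists>c. \<forall>z\<in>A. z = (\<Sum>i<N. xpoly (c z i) * y ^ i)"
proof -
  have "\<forall>z\<in>A. \<exists>c. z = (\<Sum>i<N. xpoly (c i) * y ^ i)"
    by (metis A_cases eval2_sum_coeff)
  then show ?thesis by (rule bchoice)
qed

lemma A_subset_kx_bar: "A \<subseteq> kx_bar"
proof
  fix z assume z: "z \<in> A"
  obtain c where c: "\<And>z. z \<in> A \<Longrightarrow> z = (\<Sum>i<N. xpoly (c z i) * y ^ i)"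
    using A_coordinates by blast
  show "z \<in> kx_bar"
  proof (rule kx.integral_if_stable_family[where I = "{..<N}" and v = "\<lambda>i. y ^ i" and k = 0
        and m = "\<lambda>i j. xpoly (c (z * y ^ i) j)"])
    show "z * y ^ i = (\<Sum>j<N. xpoly (c (z * y ^ i) j) * y ^ j)" for i
      using z by (intro c A.mult_mem A.power_mem) auto
  qed (use N_pos in auto)
qed

text \<open>Transitivity of integrality: if z satisfies a monic equation of degree n over
  \<open>A\<close>, the products y^i z^j with i < N and j < n form a family over k[x] stable under
  z.\<close>

lemma integral_closure_A: "integral_closure A = kx_bar"
proof
  show "kx_bar \<subseteq> integral_closure A"
    by (rule integral_closure_mono) auto
  show "integral_closure A \<subseteq> kx_bar"
  proof
    fix z assume "z \<in> integral_closure A"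
    then obtain q where q: "lead_coeff q = 1" "\<And>i. coeff q i \<in> A" "poly q z = 0"
      by (rule integral_closureE) blast
    obtain d where d: "\<And>i. d i \<in> A" "z ^ degree q = (\<Sum>i<degree q. d i * z ^ i)"
      using A.monic_rewrite_power[OF q] by blast
    obtain c where c: "\<And>z. z \<in> A \<Longrightarrow> z = (\<Sum>i<N. xpoly (c z i) * y ^ i)"
      using A_coordinates by blast
    let ?n = "degree q"
    have n: "0 < ?n" using q by (metis degree_eq_zeroE gr0I lead_coeff_pCons(2) poly_pCons mult_zero_right add.right_neutral poly_0 one_neq_zero coeff_pCons_0)
    \<comment> \<open>Below the top power of z the matrix only shifts j. At the top, z^n is replaced
      by the sum of d_j' z^j', and each d_j' y^i is expanded in powers of y by the coordinate
      function c.\<close>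
    define M where "M = (\<lambda>(i, j) (i', j'). if Suc j < ?n then (if i' = i \<and> j' = Suc j then 1 else 0)
                          else xpoly (c (d j' * y ^ i) i'))"
    show "z \<in> kx_bar"
    proof (rule kx.integral_if_stable_family[where I = "{..<N} \<times> {..<?n}"
          and v = "\<lambda>(i, j). y ^ i * z ^ j" and k = "(0, 0)" and m = M])
      fix k assume kI: "k \<in> {..<N} \<times> {..<?n}"
      obtain i j where k: "k = (i, j)" "i < N" "j < ?n" using kI by auto
      have *: "(\<Sum>l\<in>{..<N} \<times> {..<?n}. M k l * (case l of (i, j) \<Rightarrow> y ^ i * z ^ j))
              = (\<Sum>j'<?n. \<Sum>i'<N. M (i, j) (i', j') * (y ^ i' * z ^ j'))"
        by (subst sum.swap) (simp add: k sum.cartesian_product case_prod_beta')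
      show "z * (case k of (i, j) \<Rightarrow> y ^ i * z ^ j)
          = (\<Sum>l\<in>{..<N} \<times> {..<?n}. M k l * (case l of (i, j) \<Rightarrow> y ^ i * z ^ j))"
      proof (cases "Suc j < ?n")
        case True
        have "(\<Sum>j'<?n. \<Sum>i'<N. M (i, j) (i', j') * (y ^ i' * z ^ j'))
            = (\<Sum>i'<N. M (i, j) (i', Suc j) * (y ^ i' * z ^ Suc j))"
          using True by (subst sum.remove[of _ "Suc j"]) (auto simp: M_def intro!: sum.neutral)
        also have "\<dots> = y ^ i * z ^ Suc j"
          using True k(2) by (subst sum.remove[of _ i]) (auto simp: M_def intro!: sum.neutral)
        finally show ?thesis unfolding * by (simp add: k mult_ac)
      next
        case False
        then have j: "?n = Suc j" using k by simp
        have "(\<Sum>j'<?n. \<Sum>i'<N. M (i, j) (i', j') * (y ^ i' * z ^ j'))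
            = (\<Sum>j'<?n. (\<Sum>i'<N. xpoly (c (d j' * y ^ i) i') * y ^ i') * z ^ j')"
          using False by (simp add: M_def sum_distrib_right mult.assoc)
        also have "\<dots> = (\<Sum>j'<?n. (d j' * y ^ i) * z ^ j')"
          by (intro sum.cong refl arg_cong2[of _ _ _ _ "(*)"] c[symmetric] A.mult_mem A.power_mem d) auto
        also have "\<dots> = y ^ i * (\<Sum>j'<?n. d j' * z ^ j')"
          by (simp add: sum_distrib_left mult_ac)
        also have "\<dots> = z * (y ^ i * z ^ j)"
          using d(2) unfolding j by (simp add: mult_ac)
        finally show ?thesis unfolding * by (simp add: k)
      qed
    qed (use N_pos n kx.one_mem kx.zero_mem in \<open>auto simp: M_def split: prod.splits\<close>)
  qed
qed

text \<open>The denominator Q(x,y) is integral over k[x], hence divides some c(x) within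
  \<open>A\<close>; extending the fraction by the cofactor leaves only c(x) below.\<close>

lemma quotient_xpoly:
  obtains a c where "a \<in> A" "c \<noteq> 0" "xpoly c * z = a"
proof -
  obtain P Q where PQ: "eval2 \<iota> Q x y \<noteq> 0" "z = eval2 \<iota> P x y / eval2 \<iota> Q x y"
    using quotients by blast
  have "eval2 \<iota> Q x y \<in> kx_bar" using A_subset_kx_bar by auto
  from integral_inverse[OF this PQ(1)] obtain p c where p: "c \<noteq> 0" "\<And>i. coeff p i \<in> kx"
    "eval2 \<iota> Q x y * poly p (eval2 \<iota> Q x y) = xpoly c" by blast
  have "coeff p i \<in> A" for i using p(2)[of i] by auto
  then have "poly p (eval2 \<iota> Q x y) \<in> A" by (intro A.poly_mem) auto
  moreover have "xpoly c * z = eval2 \<iota> P x y * poly p (eval2 \<iota> Q x y)"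
  proof -
    have "eval2 \<iota> Q x y * z = eval2 \<iota> P x y" using PQ by simp
    then show ?thesis unfolding p(3)[symmetric] by (metis mult.commute mult.left_commute)
  qed
  ultimately show thesis using that[of "xpoly c * z" c] p(1) A.mult_mem by simp
qed

section \<open>The power basis of K over k(x), and bases of lattices over k[x]\<close>

definition Y :: "'K set" where "Y = (\<lambda>i. y ^ i) ` {..<N}"

text \<open>After clearing denominators the combination is a relation P(x,y) = 0 of degree below
  \<open>N\<close> in y, so P = 0.\<close>

lemma combination_eq_0:
  assumes "(\<Sum>i<N. emb (c i) * y ^ i) = 0" "i < N"
  shows "c i = 0"
proof -
  obtain d a where d: "d \<noteq> 0" "\<And>i. i < N \<Longrightarrow> to_fract d * c i = to_fract (a i)"
    using common_denominator[of "{..<N}" c] by auto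
  define P where "P = (\<Sum>i<N. monom (a i) i)"
  have coeff: "coeff P i = (if i < N then a i else 0)" for i
    by (auto simp: P_def coeff_sum coeff_monom)
  have "degree P < N"
    by (rule degree_lessI) (simp_all add: N_pos coeff)
  then have "eval2 \<iota> P x y = (\<Sum>i<N. emb (to_fract d * c i) * y ^ i)"
    using eval2_sum_coeff[of P N y] by (simp add: coeff d(2))
  also have "\<dots> = emb (to_fract d) * (\<Sum>i<N. emb (c i) * y ^ i)"
    by (simp only: emb.hom_mult sum_distrib_left mult.assoc)
  finally have "eval2 \<iota> P x y = 0" unfolding assms(1) by simp
  then have "P = 0" by (rule no_smaller_relation[OF \<open>degree P < N\<close>])
  then have "a i = 0" using coeff[of i] assms(2) by simp
  then have "to_fract d * c i = 0" using d(2)[OF assms(2)] by simp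
  then show ?thesis using d(1) by simp
qed

lemma inj_powers: "inj_on (\<lambda>i. y ^ i) {..<N}"
proof (rule inj_onI)
  fix i j assume ij: "i \<in> {..<N}" "j \<in> {..<N}" "y ^ i = y ^ j"
  show "i = j"
  proof (rule ccontr)
    assume ne: "i \<noteq> j"
    define c :: "nat \<Rightarrow> 'k poly fract" where "c l = (if l = i then 1 else if l = j then -1 else 0)" for l
    have "(\<Sum>l<N. emb (c l) * y ^ l) = (\<Sum>l\<in>{i, j}. emb (c l) * y ^ l)"
      using ij by (intro sum.mono_neutral_right) (auto simp: c_def)
    also have "\<dots> = 0" using ne ij by (simp add: c_def emb.hom_uminus)
    finally have "c i = 0" using ij combination_eq_0 by blast
    then show False by (simp add: c_def)
  qed
qed

lemma card_Y: "card Y = N" and finite_Y: "finite Y"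
  unfolding Y_def using card_image[OF inj_powers] by auto

lemma sum_Y: "(\<Sum>b\<in>Y. f b) = (\<Sum>i<N. f (y ^ i))"
  unfolding Y_def by (simp add: sum.reindex[OF inj_powers])

lemma independent_Y: "independent Y"
proof (rule independent_if_scalars_zero[OF finite_Y])
  fix f b assume f: "(\<Sum>b\<in>Y. emb (f b) * b) = 0" and "b \<in> Y"
  then obtain i where i: "i < N" "b = y ^ i" unfolding Y_def by (elim imageE) simp
  show "f b = 0"
    unfolding i(2) by (rule combination_eq_0[of "\<lambda>i. f (y ^ i)", OF _ i(1)]) (rule f[unfolded sum_Y])
qed

lemma A_subset_span_Y: "A \<subseteq> span Y"
proof
  fix z assume "z \<in> A"
  then obtain P where "degree P < N" "z = eval2 \<iota> P x y" by (rule A_cases)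
  then have "z = (\<Sum>i<N. emb (to_fract (coeff P i)) * y ^ i)"
    using eval2_sum_coeff[of P N y] by simp
  also have "\<dots> \<in> span Y"
    by (intro span_sum span_scale span_base) (auto simp: Y_def)
  finally show "z \<in> span Y" .
qed

lemma span_eq_UNIV:
  assumes "A \<subseteq> span B"
  shows "span B = UNIV"
proof -
  have "z \<in> span B" for z
  proof -
    obtain a c where ac: "a \<in> A" "c \<noteq> 0" "xpoly c * z = a" by (rule quotient_xpoly)
    have "emb (inverse (to_fract c)) * a \<in> span B" using ac assms by (intro span_scale) auto
    moreover have "emb (inverse (to_fract c)) * a = z"
      unfolding ac(3)[symmetric] using ac(2) by (simp add: emb.hom_inverse xpoly_eq_0_iff)
    ultimately show ?thesis by simp
  qed
  then show ?thesis by auto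
qed

lemma span_Y: "span Y = UNIV"
  by (rule span_eq_UNIV[OF A_subset_span_Y])

sublocale fd: finite_dimensional_vector_space "\<lambda>c z. emb c * z" Y
  by unfold_locales (auto simp: finite_Y independent_Y span_Y)

lemma small_spanning_family:
  assumes "span (g ` {..<N}) = UNIV"
  shows "inj_on g {..<N}" "independent (g ` {..<N})"
proof -
  have "card Y \<le> card (g ` {..<N})"
    using independent_span_bound[of "g ` {..<N}" Y] independent_Y assms by auto
  moreover have "card (g ` {..<N}) \<le> N" using card_image_le[of "{..<N}" g] by simp
  ultimately have c: "card (g ` {..<N}) = N" using card_Y by simp
  then show "inj_on g {..<N}" by (intro eq_card_imp_inj_on) auto
  show "independent (g ` {..<N})"
    using fd.card_eq_dim[of "g ` {..<N}" UNIV] c assms card_Y by simp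
qed

text \<open>Hermite normal form. For each i choose g_i in M of degree i in y whose leading
  coefficient, a polynomial in x, has least degree. The leading coefficient of any P in M of degree
  i is then divisible by it, since a nonzero remainder would be the leading coefficient of an
  element violating the choice; so P can be reduced to lower degree.\<close>

lemma lattice_triangular_basis:
  fixes M :: "'k poly poly set"
  assumes add: "\<And>P Q. P \<in> M \<Longrightarrow> Q \<in> M \<Longrightarrow> P + Q \<in> M"
    and smult: "\<And>a P. P \<in> M \<Longrightarrow> smult a P \<in> M"
    and deg: "\<And>P. P \<in> M \<Longrightarrow> degree P < n"
    and full: "\<And>i. i < n \<Longrightarrow> \<exists>P\<in>M. P \<noteq> 0 \<and> degree P = i"
  shows "\<exists>g. (\<forall>i<n. g i \<in> M) \<and> (\<forall>P\<in>M. \<exists>a. P = (\<Sum>i<n. smult (a i) (g i)))"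
proof -
  define least_at where "least_at i P \<longleftrightarrow> (P \<in> M \<and> P \<noteq> 0 \<and> degree P = i) \<and>
          (\<forall>Q. Q \<in> M \<and> Q \<noteq> 0 \<and> degree Q = i \<longrightarrow> degree (lead_coeff P) \<le> degree (lead_coeff Q))" for i P
  have "\<exists>P. least_at i P" if i: "i \<in> {..<n}" for i
  proof -
    obtain P where "P \<in> M \<and> P \<noteq> 0 \<and> degree P = i" using full i by auto
    then show ?thesis unfolding least_at_def
      by (rule ex_has_least_nat[where m = "\<lambda>P. degree (lead_coeff P)"])
  qed
  then have "\<forall>i\<in>{..<n}. \<exists>P. least_at i P" by simp
  from bchoice[OF this] obtain g where lg: "\<forall>i\<in>{..<n}. least_at i (g i)" by (elim exE)
  have g: "g i \<in> M" "g i \<noteq> 0" "degree (g i) = i" if "i < n" for i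
    using lg that by (auto simp: least_at_def)
  have least: "degree (lead_coeff (g i)) \<le> degree (lead_coeff Q)"
    if "i < n" "Q \<in> M" "Q \<noteq> 0" "degree Q = i" for i Q
    using lg that unfolding least_at_def by blast
  have neg: "P - Q \<in> M" if "P \<in> M" "Q \<in> M" for P Q
    using add[OF that(1) smult[OF that(2), of "-1"]] by simp
  have "\<exists>a. P = (\<Sum>i<n. smult (a i) (g i))" if "P \<in> M" for P
    using that
  \<comment> \<open>The shift by \<open>Suc\<close> puts the zero polynomial strictly below the
    nonzero constants, which share its degree 0.\<close>
  proof (induction "if P = 0 then 0 else Suc (degree P)" arbitrary: P rule: less_induct)
    case less
    show ?case
    proof (cases "P = 0")
      case True
      then show ?thesis by (intro exI[of _ "\<lambda>_. 0"]) simp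
    next
      case False
      define i where "i = degree P"
      have i: "i < n" using deg less.prems by (simp add: i_def)
      define c where "c = lead_coeff P div lead_coeff (g i)"
      define P' where "P' = P - smult c (g i)"
      have P'M: "P' \<in> M" unfolding P'_def using less.prems g(1)[OF i] smult neg by simp
      have le: "degree P' \<le> i"
        unfolding P'_def using g(3)[OF i] by (intro degree_diff_le order.trans[OF degree_smult_le]) (auto simp: i_def)
      have ci: "coeff P' i = lead_coeff P mod lead_coeff (g i)"
        using g(3)[OF i] by (simp add: P'_def c_def i_def minus_div_mult_eq_mod)
      have "coeff P' i = 0"
      proof (rule ccontr)
        assume nz: "coeff P' i \<noteq> 0"
        then have "degree P' = i" using le by (simp add: le_degree order.antisym)
        moreover have "P' \<noteq> 0" using nz by auto
        ultimately have "degree (lead_coeff (g i)) \<le> degree (coeff P' i)"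
          using least[OF i P'M] by simp
        moreover have "degree (lead_coeff P mod lead_coeff (g i)) < degree (lead_coeff (g i))"
          using nz g(2)[OF i] unfolding ci by (metis degree_mod_less leading_coeff_0_iff)
        ultimately show False unfolding ci by simp
      qed
      then have "P' = 0 \<or> degree P' < i"
        using le by (metis leading_coeff_0_iff order_le_imp_less_or_eq)
      then have "(if P' = 0 then 0 else Suc (degree P')) < (if P = 0 then 0 else Suc (degree P))"
        using False by (auto simp: i_def)
      from less.hyps[OF this P'M] obtain a where a: "P' = (\<Sum>i<n. smult (a i) (g i))" by blast
      have "(\<Sum>j<n. smult (if j = i then c else 0) (g j)) = smult c (g i)"
        by (subst sum.remove[of _ i]) (use i in \<open>auto intro!: sum.neutral\<close>)
      moreover have "P = P' + smult c (g i)" by (simp add: P'_def)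
      ultimately have "P = (\<Sum>j<n. smult (a j + (if j = i then c else 0)) (g j))"
        unfolding smult_add_left sum.distrib a[symmetric] by simp
      then show ?thesis by (intro exI[where x = "\<lambda>j. a j + (if j = i then c else 0)"])
    qed
  qed
  then show ?thesis using g(1) by blast
qed

text \<open>M lies between two lattices: \<open>full\<close> makes it span K, and the common
  denominator \<delta> embeds it in \<open>A\<close>. Polynomials of degree below \<open>N\<close>
  in y then represent the elements of \<delta> M, and the triangular basis of these is divided by
  \<delta>.\<close>

lemma lattice_basis:
  assumes add: "\<And>u v. u \<in> M \<Longrightarrow> v \<in> M \<Longrightarrow> u + v \<in> M"
    and scale: "\<And>a u. u \<in> M \<Longrightarrow> xpoly a * u \<in> M"
    and \<delta>: "\<delta> \<noteq> 0" "\<And>u. u \<in> M \<Longrightarrow> \<delta> * u \<in> A"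
    and full: "\<And>z. \<exists>c. c \<noteq> 0 \<and> xpoly c * z \<in> M"
  obtains g where "\<And>i. i < N \<Longrightarrow> g i \<in> M" "\<And>u. u \<in> M \<Longrightarrow> \<exists>a. u = (\<Sum>i<N. xpoly (a i) * g i)"
    "inj_on g {..<N}" "independent (g ` {..<N})" "span (g ` {..<N}) = UNIV"
proof -
  define M' where "M' = {P. degree P < N \<and> eval2 \<iota> P x y / \<delta> \<in> M}"
  have "\<exists>g. (\<forall>i<N. g i \<in> M') \<and> (\<forall>P\<in>M'. \<exists>a. P = (\<Sum>i<N. smult (a i) (g i)))"
  proof (rule lattice_triangular_basis)
    show "P + Q \<in> M'" if "P \<in> M'" "Q \<in> M'" for P Q
      using that add by (auto simp: M'_def ev.hom_add add_divide_distrib intro: degree_add_less)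
    show "smult a P \<in> M'" if "P \<in> M'" for a P
    proof -
      have "eval2 \<iota> (smult a P) x y / \<delta> = xpoly a * (eval2 \<iota> P x y / \<delta>)"
        by (simp add: eval2_smult)
      moreover have "degree (smult a P) < N"
        using that by (auto simp: M'_def intro: le_less_trans[OF degree_smult_le])
      ultimately show ?thesis using that scale unfolding M'_def by (metis (lifting) mem_Collect_eq)
    qed
    show "degree P < N" if "P \<in> M'" for P using that by (simp add: M'_def)
    show "\<exists>P\<in>M'. P \<noteq> 0 \<and> degree P = i" if "i < N" for i
    proof -
      obtain c where c: "c \<noteq> 0" "xpoly c * (y ^ i / \<delta>) \<in> M" using full by blast
      then have "monom c i \<in> M'" using that by (simp add: M'_def eval2_monom degree_monom_eq)
      then show ?thesis using c(1) by (intro bexI[of _ "monom c i"]) (simp_all add: degree_monom_eq)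
    qed
  qed
  then obtain h where h: "\<forall>i<N. h i \<in> M'" "\<forall>P\<in>M'. \<exists>a. P = (\<Sum>i<N. smult (a i) (h i))"
    by (elim exE conjE)
  define g where "g i = eval2 \<iota> (h i) x y / \<delta>" for i
  have gM: "g i \<in> M" if "i < N" for i using h(1) that by (simp add: M'_def g_def)
  have gspan: "\<exists>a. u = (\<Sum>i<N. xpoly (a i) * g i)" if "u \<in> M" for u
  proof -
    have "\<delta> * u \<in> A" using \<delta>(2) that by simp
    then obtain P where P: "degree P < N" "\<delta> * u = eval2 \<iota> P x y" by (rule A_cases)
    have u: "u = eval2 \<iota> P x y / \<delta>" using \<delta>(1) unfolding P(2)[symmetric] by simp
    have "P \<in> M'" using P(1) that unfolding u by (simp add: M'_def)
    from bspec[OF h(2) this] obtain a where a: "P = (\<Sum>i<N. smult (a i) (h i))" by (elim exE)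
    have "eval2 \<iota> P x y = (\<Sum>i<N. xpoly (a i) * eval2 \<iota> (h i) x y)"
      unfolding a ev.hom_sum eval2_smult ..
    then have "u = (\<Sum>i<N. xpoly (a i) * g i)" unfolding u g_def
      by (simp only: sum_divide_distrib times_divide_eq_right)
    then show ?thesis by (intro exI[where x = a])
  qed
  have sp: "span (g ` {..<N}) = UNIV"
  proof -
    have "z \<in> span (g ` {..<N})" for z
    proof -
      obtain c where c: "c \<noteq> 0" "xpoly c * z \<in> M" using full by blast
      from gspan[OF c(2)] obtain a where a: "xpoly c * z = (\<Sum>i<N. xpoly (a i) * g i)" by (elim exE)
      have "(\<Sum>i<N. emb (to_fract (a i)) * g i) \<in> span (g ` {..<N})"
        by (intro span_sum span_scale span_base) auto
      then have "emb (inverse (to_fract c)) * (xpoly c * z) \<in> span (g ` {..<N})"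
        unfolding a by (intro span_scale) simp
      moreover have "emb (inverse (to_fract c)) * (xpoly c * z) = z"
        using c(1) by (simp add: emb.hom_inverse xpoly_eq_0_iff)
      ultimately show ?thesis by simp
    qed
    then show ?thesis by auto
  qed
  show thesis
    by (rule that[of g, OF gM gspan small_spanning_family[OF sp] sp])
qed

end

section \<open>Trace and conductor\<close>

lemma unital_subring_range_to_fract: "unital_subring (range to_fract)"
proof
  show "1 \<in> range to_fract" by (metis rangeI to_fract_1)
  show "a - b \<in> range to_fract" "a * b \<in> range to_fract"
    if "a \<in> range to_fract" "b \<in> range to_fract" for a b :: "'a fract"
    using that by (auto simp flip: to_fract_diff to_fract_mult)
qed

context rational_subfield
begin

sublocale poly_fract: unital_subring "range to_fract :: 'k poly fract set"
  by (rule unital_subring_range_to_fract)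

lemma xpoly_of_nat: "xpoly (of_nat n) = of_nat n"
  by (induction n) (simp_all add: xpoly.hom_add)

lemma representation_family:
  fixes n :: nat
  assumes "inj_on g {..<n}" "independent (g ` {..<n})" "i < n"
  shows "representation (g ` {..<n}) (\<Sum>j<n. emb (c j) * g j) (g i) = c i"
proof -
  let ?B = "g ` {..<n}"
  have sp: "g j \<in> span ?B" if "j < n" for j using that by (intro span_base) auto
  have "representation ?B (\<Sum>j<n. emb (c j) * g j) (g i) = (\<Sum>j<n. representation ?B (emb (c j) * g j) (g i))"
    by (subst representation_sum[OF assms(2)]) (auto intro: span_scale sp)
  also have "\<dots> = (\<Sum>j<n. c j * (if g i = g j then 1 else 0))"
  proof (rule sum.cong)
    fix j assume "j \<in> {..<n}"
    then show "representation ?B (emb (c j) * g j) (g i) = c j * (if g i = g j then 1 else 0)"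
      by (subst representation_scale[OF assms(2) sp]) (auto simp: representation_basis[OF assms(2)])
  qed simp
  also have "\<dots> = (\<Sum>j<n. if j = i then c i else 0)"
    using assms(1,3) by (intro sum.cong) (auto simp: inj_on_def)
  also have "\<dots> = c i" using assms(3) by (subst sum.delta) simp_all
  finally show ?thesis .
qed

end

context plane_curve
begin

section \<open>Coordinates in the power basis and Euler's formula\<close>

definition crd :: "nat \<Rightarrow> 'K \<Rightarrow> 'k poly fract" where
  "crd i z = representation Y z (y ^ i)"

lemma crd_sum: "i < N \<Longrightarrow> crd i (\<Sum>j<N. emb (c j) * y ^ j) = c i"
  unfolding crd_def Y_def
  by (rule representation_family[OF inj_powers]) (use independent_Y in \<open>auto simp: Y_def\<close>)

lemma expand: "(\<Sum>i<N. emb (crd i z) * y ^ i) = z"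
proof -
  have "(\<Sum>b\<in>Y. emb (representation Y z b) * b) = z"
    by (rule sum_representation_eq[OF independent_Y]) (auto simp: span_Y finite_Y)
  then show ?thesis unfolding sum_Y crd_def .
qed

lemma crd_add: "crd i (z + w) = crd i z + crd i w"
  unfolding crd_def by (subst representation_add[OF independent_Y]) (simp_all add: span_Y)

lemma crd_scale: "crd i (emb c * z) = c * crd i z"
  unfolding crd_def by (subst representation_scale[OF independent_Y]) (simp_all add: span_Y)

lemma crd_0: "crd i 0 = 0"
  using crd_scale[of i 0 0] by simp

lemma crd_finite_sum: "crd i (sum f I) = (\<Sum>j\<in>I. crd i (f j))"
  by (induction I rule: infinite_finite_induct) (simp_all add: crd_0 crd_add)

lemma crd_in_range:
  assumes "z \<in> A" "i < N"
  shows "crd i z \<in> range to_fract"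
proof -
  obtain P where P: "degree P < N" "z = eval2 \<iota> P x y" using assms(1) by (rule A_cases)
  have "z = (\<Sum>j<N. emb (to_fract (coeff P j)) * y ^ j)"
    unfolding P(2) emb_to_fract by (rule eval2_sum_coeff[OF P(1)])
  then have "crd i z = to_fract (coeff P i)" by (simp only: crd_sum[OF assms(2)])
  then show ?thesis by simp
qed

lemma in_A_if_crd:
  assumes "\<And>i. i < N \<Longrightarrow> crd i z \<in> range to_fract"
  shows "z \<in> A"
proof -
  have "emb (crd i z) * y ^ i \<in> A" if i: "i < N" for i
  proof -
    obtain a where "crd i z = to_fract a" using assms[OF i] by (elim rangeE)
    then show ?thesis by (simp add: A.mult_mem A.power_mem)
  qed
  then have "(\<Sum>i<N. emb (crd i z) * y ^ i) \<in> A" by (intro A.sum_mem) simp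
  then show ?thesis unfolding expand .
qed

text \<open>The linear functional of Euler's formula: its value at \<open>Fy * w\<close> is the
  trace of w, see \<open>trace_Y\<close>.\<close>

definition lam :: "'K \<Rightarrow> 'k poly fract" where
  "lam z = crd (N - 1) z"

text \<open>Multiplication by y shifts the coordinates; the overflow \<open>lam z\<close> y^N is
  folded back by the equation of y.\<close>

lemma crd_y_mult:
  assumes "i < N"
  shows "crd i (y * z) = (if i = 0 then 0 else crd (i - 1) z) - to_fract (coeff F i) * lam z"
proof -
  obtain n where n: "N = Suc n" using N_pos by (cases N) auto
  have "0 = (\<Sum>i<Suc N. xpoly (coeff F i) * y ^ i)"
    using eval2_sum_coeff[of F "Suc N" y] root by simp
  then have yN: "y ^ N = - (\<Sum>i<N. xpoly (coeff F i) * y ^ i)"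
    using monic by (simp add: eq_neg_iff_add_eq_0 add.commute)
  have "y * z = y * (\<Sum>i<N. emb (crd i z) * y ^ i)" unfolding expand ..
  also have "\<dots> = (\<Sum>i<N. emb (crd i z) * y ^ Suc i)"
    by (simp add: sum_distrib_left mult_ac)
  also have "\<dots> = (\<Sum>i<n. emb (crd i z) * y ^ Suc i) + emb (lam z) * y ^ N"
    by (simp add: n lam_def)
  also have "(\<Sum>i<n. emb (crd i z) * y ^ Suc i) = (\<Sum>i<N. emb (if i = 0 then 0 else crd (i - 1) z) * y ^ i)"
    unfolding n by (subst sum.lessThan_Suc_shift) simp
  also have "emb (lam z) * y ^ N = - (\<Sum>i<N. emb (to_fract (coeff F i) * lam z) * y ^ i)"
    unfolding yN by (simp add: sum_distrib_left emb.hom_mult mult_ac)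
  also have "(\<Sum>i<N. emb (if i = 0 then 0 else crd (i - 1) z) * y ^ i)
      + - (\<Sum>i<N. emb (to_fract (coeff F i) * lam z) * y ^ i)
      = (\<Sum>i<N. emb ((if i = 0 then 0 else crd (i - 1) z) - to_fract (coeff F i) * lam z) * y ^ i)"
    by (simp add: emb.hom_minus left_diff_distrib sum_subtractf)
  finally have "y * z = (\<Sum>i<N. emb ((if i = 0 then 0 else crd (i - 1) z) - to_fract (coeff F i) * lam z) * y ^ i)" .
  from arg_cong[OF this, of "crd i"] show ?thesis unfolding crd_sum[OF assms] .
qed

text \<open>The Horner scheme of \<open>F\<close> at \<open>y\<close>; its values form, up to order, the dual basis of the powers
  of \<open>y\<close> with respect to \<^term>\<open>lam\<close>.\<close>

fun horner :: "nat \<Rightarrow> 'K" where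
  "horner 0 = 1"
| "horner (Suc m) = y * horner m + xpoly (coeff F (N - Suc m))"

lemma horner_in_A: "horner m \<in> A"
  by (induction m) (simp_all add: A.one_mem A.add_mem A.mult_mem)

text \<open>\<open>crd_y_mult\<close>, solved for the lower coordinate, expresses it by the next
  higher coordinate of y z and \<open>lam z\<close>. Descending from the top coordinate
  \<open>lam\<close>, the multipliers of z follow the Horner recursion.\<close>

lemma crd_eq_lam: "m < N \<Longrightarrow> crd (N - Suc m) z = lam (horner m * z)"
proof (induction m arbitrary: z)
  case 0
  then show ?case by (simp add: lam_def)
next
  case (Suc m)
  have i: "N - Suc m < N" "N - Suc m \<noteq> 0" "N - Suc m - 1 = N - Suc (Suc m)" using Suc.prems by auto
  have "crd (N - Suc (Suc m)) z = crd (N - Suc m) (y * z) + to_fract (coeff F (N - Suc m)) * lam z"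
    using crd_y_mult[OF i(1), of z] i(2,3) by simp
  also have "crd (N - Suc m) (y * z) = lam (horner m * (y * z))"
    using Suc.IH Suc.prems by simp
  also have "to_fract (coeff F (N - Suc m)) * lam z = lam (emb (to_fract (coeff F (N - Suc m))) * z)"
    unfolding lam_def crd_scale ..
  also have "lam (horner m * (y * z)) + \<dots> = lam (horner m * (y * z) + emb (to_fract (coeff F (N - Suc m))) * z)"
    unfolding lam_def crd_add ..
  also have "horner m * (y * z) + emb (to_fract (coeff F (N - Suc m))) * z = horner (Suc m) * z"
    by (simp add: algebra_simps)
  finally show ?case .
qed

text \<open>\<open>horner m\<close> consists of the top m + 1 coefficients of F with exponents m -
  j; the factor y^(N-1-m) lifts them to exponents independent of m, so that they can be summed over
  m.\<close>

lemma horner_closed: "m < N \<Longrightarrow> horner m * y ^ (N - Suc m) = (\<Sum>j<Suc m. xpoly (coeff F (N - j)) * y ^ (N - Suc j))"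
proof (induction m)
  case 0
  then show ?case using monic by simp
next
  case (Suc m)
  have "y ^ (N - Suc m) = y * y ^ (N - Suc (Suc m))"
    using Suc.prems by (metis Suc_diff_Suc power_Suc)
  then have "horner (Suc m) * y ^ (N - Suc (Suc m))
      = horner m * y ^ (N - Suc m) + xpoly (coeff F (N - Suc m)) * y ^ (N - Suc (Suc m))"
    by (simp add: algebra_simps)
  also have "horner m * y ^ (N - Suc m) = (\<Sum>j<Suc m. xpoly (coeff F (N - j)) * y ^ (N - Suc j))"
    using Suc by simp
  finally show ?case by simp
qed

abbreviation Fy :: 'K where "Fy \<equiv> eval2 \<iota> (pderiv F) x y"

text \<open>By \<open>horner_closed\<close> the term with index j occurs once for each m with j
  \<le> m < n. For n = N the resulting factor N - j is exactly the exponent that differentiation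
  brings down.\<close>

lemma sum_horner:
  assumes "n \<le> N"
  shows "(\<Sum>m<n. horner m * y ^ (N - Suc m))
    = (\<Sum>j<n. of_nat (n - j) * (xpoly (coeff F (N - j)) * y ^ (N - Suc j)))"
  using assms
proof (induction n)
  case (Suc n)
  let ?u = "\<lambda>j. xpoly (coeff F (N - j)) * y ^ (N - Suc j)"
  have "(\<Sum>m<Suc n. horner m * y ^ (N - Suc m)) = (\<Sum>j<n. of_nat (n - j) * ?u j) + (\<Sum>j<Suc n. ?u j)"
    using Suc horner_closed[of n] by simp
  also have "(\<Sum>j<n. of_nat (n - j) * ?u j) = (\<Sum>j<Suc n. of_nat (n - j) * ?u j)" by simp
  also have "\<dots> + (\<Sum>j<Suc n. ?u j) = (\<Sum>j<Suc n. of_nat (Suc n - j) * ?u j)"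
    unfolding sum.distrib[symmetric]
    by (rule sum.cong) (auto simp: Suc_diff_le algebra_simps)
  finally show ?case .
qed simp

lemma Fy_eq_sum_horner: "Fy = (\<Sum>m<N. horner m * y ^ (N - Suc m))"
proof -
  have "degree (pderiv F) < N"
    by (rule degree_lessI) (simp_all add: N_pos coeff_pderiv coeff_eq_0)
  then have "Fy = (\<Sum>i<N. of_nat (Suc i) * (xpoly (coeff F (Suc i)) * y ^ i))"
    by (simp add: eval2_sum_coeff[of _ N] coeff_pderiv xpoly.hom_mult xpoly.hom_add xpoly_of_nat mult.assoc)
  also have "\<dots> = (\<Sum>j<N. of_nat (Suc (N - Suc j)) * (xpoly (coeff F (Suc (N - Suc j))) * y ^ (N - Suc j)))"
    by (rule sum.nat_diff_reindex[symmetric])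
  also have "\<dots> = (\<Sum>j<N. of_nat (N - j) * (xpoly (coeff F (N - j)) * y ^ (N - Suc j)))"
    by (rule sum.cong) (auto simp: Suc_diff_Suc simp del: of_nat_Suc)
  finally show ?thesis by (simp add: sum_horner)
qed

text \<open>Euler's formula. Every diagonal entry of multiplication by w is a coordinate, hence
  \<open>lam\<close> of a Horner value times w and a power of y; by \<open>Fy_eq_sum_horner\<close>
  the multipliers add up to \<open>Fy\<close>.\<close>

lemma trace_Y: "trace_wrt Y w = lam (Fy * w)"
proof -
  have "trace_wrt Y w = (\<Sum>i<N. crd i (w * y ^ i))"
    unfolding trace_wrt_def sum_Y crd_def ..
  also have "\<dots> = (\<Sum>m<N. crd (N - Suc m) (w * y ^ (N - Suc m)))"
    by (rule sum.nat_diff_reindex[symmetric])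
  also have "\<dots> = (\<Sum>m<N. lam (horner m * (w * y ^ (N - Suc m))))"
    by (rule sum.cong) (simp_all add: crd_eq_lam)
  also have "\<dots> = lam (\<Sum>m<N. horner m * (w * y ^ (N - Suc m)))"
    unfolding lam_def crd_finite_sum ..
  also have "(\<Sum>m<N. horner m * (w * y ^ (N - Suc m))) = Fy * w"
    unfolding Fy_eq_sum_horner sum_distrib_right by (rule sum.cong) (simp_all add: mult_ac)
  finally show ?thesis .
qed

text \<open>\<open>A\<close> is its own dual under \<open>lam\<close>: the coordinates of v are the
  values of \<open>lam\<close> at v times the Horner values, and those lie in
  \<open>A\<close>.\<close>

lemma in_A_iff_lam: "v \<in> A \<longleftrightarrow> (\<forall>a\<in>A. lam (v * a) \<in> range to_fract)"
proof
  assume "v \<in> A"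
  then show "\<forall>a\<in>A. lam (v * a) \<in> range to_fract"
    using N_pos by (auto simp: lam_def intro!: crd_in_range A.mult_mem)
next
  assume R: "\<forall>a\<in>A. lam (v * a) \<in> range to_fract"
  show "v \<in> A"
  proof (rule in_A_if_crd)
    fix i assume "i < N"
    then have "crd i v = lam (v * horner (N - Suc i))"
      using crd_eq_lam[of "N - Suc i" v] by (simp add: mult.commute Suc_diff_Suc)
    then show "crd i v \<in> range to_fract" using R horner_in_A by simp
  qed
qed

text \<open>The monic equation g of w reduces every q(w) to degree below deg g without leaving
  \<open>A\<close>, so only finitely many powers of w have to be cleared; \<delta> is the product of
  their denominators.\<close>

lemma bounded_denominators:
  assumes "w \<in> kx_bar"
  obtains \<delta> where "\<delta> \<noteq> 0" "\<And>q. (\<And>i. coeff q i \<in> A) \<Longrightarrow> \<delta> * poly q w \<in> A"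
proof -
  obtain g where g: "lead_coeff g = 1" "\<And>i. coeff g i \<in> kx" "poly g w = 0"
    using assms by (rule integral_closureE) blast
  then have gA: "\<forall>i. coeff g i \<in> A" using kx_subset_coord_ring by blast
  have "\<forall>j. \<exists>c. c \<noteq> 0 \<and> xpoly c * w ^ j \<in> A"
  proof
    fix j
    obtain a c where "a \<in> A" "c \<noteq> 0" "xpoly c * w ^ j = a" by (rule quotient_xpoly)
    then show "\<exists>c. c \<noteq> 0 \<and> xpoly c * w ^ j \<in> A" by auto
  qed
  from choice[OF this] obtain c where c: "\<forall>j. c j \<noteq> 0 \<and> xpoly (c j) * w ^ j \<in> A" by (elim exE)
  define \<delta> where "\<delta> = (\<Prod>j\<le>degree g. xpoly (c j))"
  have "\<delta> \<noteq> 0" using c by (simp add: \<delta>_def xpoly_eq_0_iff)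
  have pw: "\<delta> * w ^ j \<in> A" if "j \<le> degree g" for j
  proof -
    have "\<delta> = xpoly (c j) * (\<Prod>i\<in>{..degree g} - {j}. xpoly (c i))"
      unfolding \<delta>_def using that by (subst prod.remove[of _ j]) auto
    from this have "\<delta> * w ^ j = (\<Prod>i\<in>{..degree g} - {j}. xpoly (c i)) * (xpoly (c j) * w ^ j)"
      by (simp add: mult_ac)
    also have "\<dots> \<in> A" by (rule A.mult_mem[OF A.prod_mem]) (use c in auto)
    finally show ?thesis .
  qed
  have "\<delta> * poly q w \<in> A" if q: "\<And>i. coeff q i \<in> A" for q
  proof -
    have "\<forall>i. coeff q i \<in> A" using q by simp
    from A.monic_division[OF g(1) gA this] obtain p r where pr: "\<forall>i. coeff r i \<in> A" "q = g * p + r"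
      "r = 0 \<or> degree r < degree g" by blast
    have "poly q w = poly r w" using g(3) pr(2) by simp
    also have "\<delta> * \<dots> = (\<Sum>j\<le>degree r. coeff r j * (\<delta> * w ^ j))"
      by (simp add: poly_altdef sum_distrib_left mult_ac)
    also have "\<dots> \<in> A" using pr by (intro A.sum_mem A.mult_mem pw) auto
    finally show ?thesis .
  qed
  then show thesis using that \<open>\<delta> \<noteq> 0\<close> by simp
qed

text \<open>The ring A[w] is a lattice stable under w. In a k[x]-basis of it, multiplication by w
  has entries in k[x], and the trace may be computed in that basis.\<close>

lemma trace_integral:
  assumes w: "w \<in> kx_bar"
  shows "trace_wrt Y w \<in> range to_fract"
proof -
  define M where "M = {poly q w |q. \<forall>i. coeff q i \<in> A}"
  obtain \<delta> where \<delta>: "\<delta> \<noteq> 0" "\<And>q. (\<And>i. coeff q i \<in> A) \<Longrightarrow> \<delta> * poly q w \<in> A"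
    using bounded_denominators[OF w] by blast
  have MI: "poly q w \<in> M" if "\<And>i. coeff q i \<in> A" for q using that by (auto simp: M_def)
  obtain g where g: "\<And>i. i < N \<Longrightarrow> g i \<in> M" "\<And>u. u \<in> M \<Longrightarrow> \<exists>a. u = (\<Sum>i<N. xpoly (a i) * g i)"
    "inj_on g {..<N}" "independent (g ` {..<N})" "span (g ` {..<N}) = UNIV"
  proof (rule lattice_basis[of M \<delta>])
    show "u + v \<in> M" if "u \<in> M" "v \<in> M" for u v
    proof -
      obtain p q where "\<forall>i. coeff p i \<in> A" "\<forall>i. coeff q i \<in> A" "u = poly p w" "v = poly q w"
        using \<open>u \<in> M\<close> \<open>v \<in> M\<close> by (auto simp: M_def)
      then show ?thesis using MI[of "p + q"] A.add_mem by simp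
    qed
    show "xpoly a * u \<in> M" if "u \<in> M" for a u
    proof -
      obtain p where "\<forall>i. coeff p i \<in> A" "u = poly p w" using \<open>u \<in> M\<close> by (auto simp: M_def)
      then show ?thesis using MI[of "smult (xpoly a) p"] A.mult_mem by simp
    qed
    show "\<delta> * u \<in> A" if "u \<in> M" for u
      using that \<delta>(2) by (auto simp: M_def)
    show "\<exists>c. c \<noteq> 0 \<and> xpoly c * z \<in> M" for z
    proof -
      obtain a c where ac: "a \<in> A" "c \<noteq> 0" "xpoly c * z = a" by (rule quotient_xpoly)
      then have "a \<in> M" using MI[of "[:a:]"] A.zero_mem by (simp add: coeff_pCons split: nat.splits)
      then show ?thesis using ac by auto
    qed
  qed (use \<delta> in auto)
  let ?B = "g ` {..<N}"
  have "representation ?B (w * g i) (g i) \<in> range to_fract" if i: "i < N" for i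
  proof -
    obtain q where q: "\<forall>i. coeff q i \<in> A" "g i = poly q w" using g(1)[OF i] by (auto simp: M_def)
    then have "w * g i \<in> M" using MI[of "pCons 0 q"] A.zero_mem by (simp add: coeff_pCons split: nat.splits)
    from g(2)[OF this] obtain a where a: "w * g i = (\<Sum>i<N. xpoly (a i) * g i)" by (elim exE)
    have "w * g i = (\<Sum>i<N. emb (to_fract (a i)) * g i)" unfolding a emb_to_fract ..
    then have "representation ?B (w * g i) (g i) = to_fract (a i)"
      using representation_family[OF g(3,4) i, of "\<lambda>i. to_fract (a i)"] by simp
    then show ?thesis by simp
  qed
  then have "trace_wrt ?B w \<in> range to_fract"
    unfolding trace_wrt_def by (intro poly_fract.sum_mem) auto
  then show ?thesis
    using trace_wrt_basis_independent[OF finite_Y independent_Y span_Y, of ?B] g(4,5) by simp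
qed

text \<open>For a in \<open>A\<close> the value \<open>lam (Fy * w * a)\<close> is the trace of the
  integral element w a, hence in k[x]; self-duality of \<open>A\<close> gives the claim. This bounds
  the denominators of integral elements uniformly.\<close>

lemma Fy_mult_integral:
  assumes "w \<in> kx_bar"
  shows "Fy * w \<in> A"
proof -
  have "lam (Fy * w * a) \<in> range to_fract" if "a \<in> A" for a
  proof -
    have "w * a \<in> kx_bar" by (rule kx_bar.mult_mem[OF assms subsetD[OF A_subset_kx_bar that]])
    from trace_integral[OF this] show ?thesis unfolding trace_Y mult.assoc .
  qed
  then show ?thesis unfolding in_A_iff_lam[of "_ * _"] by blast
qed

text \<open>Membership of Fy f w in \<open>A\<close> is tested by
  \<open>lam (Fy * f * w * a)\<close>, which is the trace of f w a, and w a again runs through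
  integral elements. The right side mentions y only through the basis in which the trace is
  computed.\<close>

lemma conductor_iff_trace:
  "Fy * f \<in> conductor A \<longleftrightarrow> (\<forall>z\<in>kx_bar. trace_wrt Y (f * z) \<in> range to_fract)"
proof
  assume f: "Fy * f \<in> conductor A"
  show "\<forall>z\<in>kx_bar. trace_wrt Y (f * z) \<in> range to_fract"
  proof
    fix z assume "z \<in> kx_bar"
    then have "Fy * f * z \<in> A" using f unfolding conductor_def integral_closure_A by blast
    then have "lam (Fy * f * z) \<in> range to_fract" unfolding lam_def by (rule crd_in_range) (use N_pos in simp)
    then show "trace_wrt Y (f * z) \<in> range to_fract" unfolding trace_Y mult.assoc .
  qed
next
  assume R: "\<forall>z\<in>kx_bar. trace_wrt Y (f * z) \<in> range to_fract"
  have *: "Fy * f * w \<in> A" if w: "w \<in> kx_bar" for w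
  proof -
    have "lam (Fy * f * w * a) \<in> range to_fract" if "a \<in> A" for a
    proof -
      have "w * a \<in> kx_bar" by (rule kx_bar.mult_mem[OF w subsetD[OF A_subset_kx_bar that]])
      from bspec[OF R this] show ?thesis unfolding trace_Y mult.assoc .
    qed
    then show ?thesis unfolding in_A_iff_lam[of "_ * _"] by blast
  qed
  show "Fy * f \<in> conductor A"
    unfolding conductor_def integral_closure_A
  proof (intro CollectI conjI ballI)
    show "Fy * f \<in> A" using *[OF kx_bar.one_mem] by simp
  qed (rule *)
qed

end

section \<open>Finiteness of the integral closure and change of generator\<close>

locale separable_plane_curve = plane_curve \<iota> x y F
  for \<iota> :: "'k::field \<Rightarrow> 'K::field" and x y F +
  assumes Fy_nonzero: "Fy \<noteq> 0"
begin

text \<open>Since \<open>Fy\<close> is nonzero and carries the integral closure into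
  \<open>A\<close>, it is a common denominator for M. The element d ensures full rank. Both the
  integral closure and its nonzero primes are treated this way.\<close>

lemma integral_lattice_basis:
  assumes add: "\<And>u v. u \<in> M \<Longrightarrow> v \<in> M \<Longrightarrow> u + v \<in> M"
    and scale: "\<And>a u. u \<in> M \<Longrightarrow> xpoly a * u \<in> M"
    and M: "M \<subseteq> kx_bar"
    and d: "d \<noteq> 0" "\<And>a. a \<in> A \<Longrightarrow> xpoly d * a \<in> M"
  obtains g where "\<And>i. i < N \<Longrightarrow> g i \<in> M" "\<And>u. u \<in> M \<Longrightarrow> \<exists>a. u = (\<Sum>i<N. xpoly (a i) * g i)"
    "inj_on g {..<N}" "independent (g ` {..<N})" "span (g ` {..<N}) = UNIV"
proof (rule lattice_basis[of M Fy])
  show "\<exists>c. c \<noteq> 0 \<and> xpoly c * z \<in> M" for z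
  proof -
    obtain a c where ac: "a \<in> A" "c \<noteq> 0" "xpoly c * z = a" by (rule quotient_xpoly)
    then have "xpoly (d * c) * z \<in> M" using d(2)[of a] by (simp add: xpoly.hom_mult mult.assoc)
    then show ?thesis using ac(2) d(1) by (intro exI[of _ "d * c"]) simp
  qed
  show "Fy * u \<in> A" if "u \<in> M" for u
    using that M Fy_mult_integral by blast
qed (use Fy_nonzero add scale that in auto)

text \<open>G is the characteristic polynomial of multiplication by b on a k[x]-basis of the
  integral closure. It has degree exactly \<open>N\<close>, so it becomes the minimal equation as
  soon as b generates K over k(x).\<close>

lemma characteristic_relation:
  assumes b: "b \<in> kx_bar"
  obtains G where "lead_coeff G = 1" "degree G = N" "eval2 \<iota> G x b = 0"
proof -
  obtain g where g: "\<And>i. i < N \<Longrightarrow> g i \<in> kx_bar"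
    "\<And>u. u \<in> kx_bar \<Longrightarrow> \<exists>a. u = (\<Sum>i<N. xpoly (a i) * g i)"
    "inj_on g {..<N}" "independent (g ` {..<N})"
  proof (rule integral_lattice_basis[of kx_bar 1])
    show "xpoly a * u \<in> kx_bar" if "u \<in> kx_bar" for a u
      using that kx_subset_kx_bar by (intro kx_bar.mult_mem) auto
  qed (use kx_bar.add_mem A_subset_kx_bar in auto)
  have "\<forall>i\<in>{..<N}. \<exists>a. b * g i = (\<Sum>j<N. xpoly (a j) * g j)"
  proof
    fix i assume "i \<in> {..<N}"
    then have "b * g i \<in> kx_bar" using g(1) b kx_bar.mult_mem by simp
    then show "\<exists>a. b * g i = (\<Sum>j<N. xpoly (a j) * g j)" by (rule g(2))
  qed
  from bchoice[OF this] obtain m where m: "\<forall>i\<in>{..<N}. b * g i = (\<Sum>j<N. xpoly (m i j) * g j)"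
    by (elim exE)
  define G where "G = char_poly (mat N N (\<lambda>(i, j). m i j))"
  have "g 0 \<noteq> 0"
    using g(4) N_pos dependent_zero by (metis image_eqI lessThan_iff)
  then have "poly (char_poly (mat N N (\<lambda>(i, j). xpoly (m i j)))) b = 0"
    using m N_pos by (intro root_char_poly[of 0 N g]) simp_all
  also have "char_poly (mat N N (\<lambda>(i, j). xpoly (m i j))) = map_poly xpoly G"
    unfolding G_def by (subst xpoly.char_poly_hom[symmetric, of _ N]) (auto intro!: arg_cong[of _ _ char_poly])
  finally have "eval2 \<iota> G x b = 0" by (simp add: eval2_xpoly)
  moreover have "degree G = N \<and> coeff G N = 1" unfolding G_def by (rule degree_monic_char_poly) simp
  ultimately show thesis by (intro that) simp_all
qed

text \<open>The rationalisation of denominators of \<open>quotient_xpoly\<close>, for a generator b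
  that is not yet known to satisfy \<open>plane_curve\<close>.\<close>

lemma coord_ring_lattice:
  assumes b: "b \<in> kx_bar"
    and frac: "\<And>z. \<exists>P Q. eval2 \<iota> Q x b \<noteq> 0 \<and> z = eval2 \<iota> P x b / eval2 \<iota> Q x b"
  shows "\<exists>c. c \<noteq> 0 \<and> xpoly c * z \<in> coord_ring \<iota> x b"
proof -
  interpret B: field_subring "coord_ring \<iota> x b" by (rule field_subring_coord_ring)
  obtain P Q where PQ: "eval2 \<iota> Q x b \<noteq> 0" "z = eval2 \<iota> P x b / eval2 \<iota> Q x b" using frac by blast
  have PB: "eval2 \<iota> P x b \<in> coord_ring \<iota> x b" and QB: "eval2 \<iota> Q x b \<in> coord_ring \<iota> x b"
    by (auto simp: coord_ring_def)
  have "coord_ring \<iota> x b \<subseteq> kx_bar"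
    using kx_subset_kx_bar b by (intro coord_ring_subset) (auto intro: kx_bar.unital_subring_axioms)
  then have "eval2 \<iota> Q x b \<in> kx_bar" using QB by blast
  from integral_inverse[OF this PQ(1)] obtain p c where p: "c \<noteq> 0" "\<And>i. coeff p i \<in> kx"
    "eval2 \<iota> Q x b * poly p (eval2 \<iota> Q x b) = xpoly c" by blast
  have "poly p (eval2 \<iota> Q x b) \<in> coord_ring \<iota> x b"
    using p(2) kx_subset_coord_ring QB by (intro B.poly_mem) blast+
  moreover have "xpoly c * z = eval2 \<iota> P x b * poly p (eval2 \<iota> Q x b)"
  proof -
    have "eval2 \<iota> Q x b * z = eval2 \<iota> P x b" using PQ by simp
    then show ?thesis unfolding p(3)[symmetric] by (metis mult.commute mult.left_commute)
  qed
  ultimately show ?thesis using p(1) PB B.mult_mem by auto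
qed

text \<open>A relation of degree d below \<open>N\<close> would make 1, b, ..., b^(d-1) span a space
  closed under b, hence all of K over k(x), against its dimension \<open>N\<close>.\<close>

lemma generator_no_smaller_relation:
  assumes b: "b \<in> kx_bar"
    and frac: "\<And>z. \<exists>P Q. eval2 \<iota> Q x b \<noteq> 0 \<and> z = eval2 \<iota> P x b / eval2 \<iota> Q x b"
    and P: "degree P < N" "eval2 \<iota> P x b = 0"
  shows "P = 0"
proof (rule ccontr)
  assume "P \<noteq> 0"
  define d where "d = degree P"
  define c where "c = lead_coeff P"
  have c: "c \<noteq> 0" using \<open>P \<noteq> 0\<close> by (simp add: c_def)
  define S where "S = (\<lambda>i. b ^ i) ` {..<d}"
  have bd: "b ^ d \<in> span S"
  proof -
    have "0 = (\<Sum>i<d. xpoly (coeff P i) * b ^ i) + xpoly c * b ^ d"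
      using eval2_sum_coeff[of P "Suc d" b] P(2) by (simp add: d_def c_def)
    then have "xpoly c * b ^ d = - (\<Sum>i<d. xpoly (coeff P i) * b ^ i)"
      by (simp add: eq_neg_iff_add_eq_0 add.commute)
    moreover have "(\<Sum>i<d. emb (to_fract (coeff P i)) * b ^ i) \<in> span S"
      by (intro span_sum span_scale span_base) (auto simp: S_def)
    ultimately have "xpoly c * b ^ d \<in> span S" using span_neg by simp
    then have "emb (inverse (to_fract c)) * (xpoly c * b ^ d) \<in> span S" by (rule span_scale)
    moreover have "emb (inverse (to_fract c)) * (xpoly c * b ^ d) = b ^ d"
      using c by (simp add: emb.hom_inverse xpoly_eq_0_iff)
    ultimately show ?thesis by simp
  qed
  have mult_b: "b * z \<in> span S" if "z \<in> span S" for z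
    using that
  proof (induction rule: span_induct_alt)
    case base
    then show ?case by (simp add: span_zero)
  next
    case (step e s z)
    then obtain i where i: "i < d" "s = b ^ i" by (auto simp: S_def)
    have "b * s \<in> span S"
    proof (cases "Suc i = d")
      case True
      then show ?thesis using bd i by auto
    next
      case False
      then show ?thesis using i by (intro span_base) (auto simp: S_def intro!: image_eqI[of _ _ "Suc i"])
    qed
    then have "emb e * (b * s) + b * z \<in> span S" using step by (intro span_add span_scale)
    then show ?case by (simp add: algebra_simps)
  qed
  have "d \<noteq> 0"
  proof
    assume "d = 0"
    then obtain a where "P = [:a:]" unfolding d_def by (rule degree_eq_zeroE)
    then show False using P(2) \<open>P \<noteq> 0\<close> by (simp add: xpoly_eq_0_iff)
  qed
  then have one: "1 \<in> span S" by (intro span_base) (auto simp: S_def intro!: image_eqI[of _ _ 0])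
  have pow: "b ^ n \<in> span S" for n by (induction n) (auto intro: one mult_b)
  have B: "coord_ring \<iota> x b \<subseteq> span S"
  proof
    fix z assume "z \<in> coord_ring \<iota> x b"
    then obtain Q where "z = eval2 \<iota> Q x b" by (auto simp: coord_ring_def)
    then have "z = (\<Sum>i<Suc (degree Q). emb (to_fract (coeff Q i)) * b ^ i)"
      using eval2_sum_coeff[of Q "Suc (degree Q)" b] by simp
    also have "\<dots> \<in> span S" by (intro span_sum span_scale pow)
    finally show "z \<in> span S" .
  qed
  have "z \<in> span S" for z
  proof -
    obtain e where e: "e \<noteq> 0" "xpoly e * z \<in> coord_ring \<iota> x b"
      using coord_ring_lattice[OF b frac] by blast
    then have "emb (inverse (to_fract e)) * (xpoly e * z) \<in> span S" using B by (intro span_scale) auto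
    moreover have "emb (inverse (to_fract e)) * (xpoly e * z) = z"
      using e by (simp add: emb.hom_inverse xpoly_eq_0_iff)
    ultimately show ?thesis by simp
  qed
  then have "card Y \<le> card S"
    using independent_span_bound[of S Y] independent_Y by (auto simp: S_def)
  also have "card S \<le> d" unfolding S_def using card_image_le[of "{..<d}" "\<lambda>i. b ^ i"] by simp
  finally show False using P(1) by (simp add: card_Y d_def)
qed

text \<open>Changing the generator multiplies the conductor by the quotient of the \<open>y\<close>-derivatives, since
  both sides describe the dual of the integral closure under the trace.\<close>

lemma change_generator:
  assumes b: "b \<in> kx_bar"
    and frac: "\<And>z. \<exists>P Q. eval2 \<iota> Q x b \<noteq> 0 \<and> z = eval2 \<iota> P x b / eval2 \<iota> Q x b"
  obtains G where "separable_plane_curve \<iota> x b G"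
    "\<And>f. eval2 \<iota> (pderiv G) x b * f \<in> conductor (coord_ring \<iota> x b) \<longleftrightarrow> Fy * f \<in> conductor A"
proof -
  obtain G where G: "lead_coeff G = 1" "degree G = N" "eval2 \<iota> G x b = 0"
    using characteristic_relation[OF b] by blast
  interpret G: plane_curve \<iota> x b G
    by unfold_locales (use G frac generator_no_smaller_relation[OF b frac] in auto)
  have tr: "trace_wrt G.Y w = trace_wrt Y w" for w
    by (rule trace_wrt_basis_independent)
      (simp_all add: G.finite_Y G.independent_Y G.span_Y finite_Y independent_Y span_Y)
  \<comment> \<open>If it were 0, Euler's formula for b would make the trace vanish identically; but
    Euler's formula for y gives y^(N-1) / Fy the trace 1.\<close>
  have "G.Fy \<noteq> 0"
  proof
    assume "G.Fy = 0"
    then have "trace_wrt Y w = 0" for w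
      using G.trace_Y[of w] by (simp add: tr G.lam_def G.crd_0)
    then have "lam (Fy * (y ^ (N - 1) / Fy)) = 0" using trace_Y by metis
    then have "crd (N - 1) (y ^ (N - 1)) = 0" using Fy_nonzero by (simp add: lam_def)
    moreover have "crd (N - 1) (\<Sum>j<N. emb (if j = N - 1 then 1 else 0) * y ^ j) = 1"
      using crd_sum[of "N - 1" "\<lambda>j. if j = N - 1 then 1 else 0"] N_pos by simp
    moreover have "(\<Sum>j<N. emb (if j = N - 1 then 1 else 0) * y ^ j) = y ^ (N - 1)"
      by (subst sum.remove[of _ "N - 1"]) (use N_pos in \<open>auto intro!: sum.neutral\<close>)
    ultimately show False by simp
  qed
  then have "separable_plane_curve \<iota> x b G" by unfold_locales
  moreover have "G.Fy * f \<in> conductor G.A \<longleftrightarrow> Fy * f \<in> conductor A" for f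
    unfolding G.conductor_iff_trace conductor_iff_trace tr ..
  ultimately show thesis by (rule that)
qed

end

section \<open>Local rings of the integral closure\<close>

lemma poly_ideal_generator:
  fixes I :: "'k::field poly set"
  assumes add: "\<And>a b. a \<in> I \<Longrightarrow> b \<in> I \<Longrightarrow> a + b \<in> I"
    and mult: "\<And>a b. b \<in> I \<Longrightarrow> a * b \<in> I"
    and nz: "c \<in> I" "c \<noteq> 0"
  obtains d where "d \<noteq> 0" "\<And>a. a \<in> I \<longleftrightarrow> d dvd a"
proof -
  have "c \<in> I \<and> c \<noteq> 0" using nz by simp
  from ex_has_least_nat[where P = "\<lambda>d. d \<in> I \<and> d \<noteq> 0" and m = degree, OF this]
  obtain d where d: "d \<in> I" "d \<noteq> 0" "\<forall>b. b \<in> I \<and> b \<noteq> 0 \<longrightarrow> degree d \<le> degree b" by blast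
  have "d dvd a" if "a \<in> I" for a
  proof -
    have "a mod d = a + (- (a div d)) * d" by (simp add: minus_div_mult_eq_mod[symmetric])
    then have m: "a mod d \<in> I" using add[OF that mult[OF d(1), of "- (a div d)"]] by simp
    have "a mod d = 0"
    proof (rule ccontr)
      assume "a mod d \<noteq> 0"
      then have "degree (a mod d) < degree d" using d(2) degree_mod_less[of d a] by auto
      then show False using d(3) m \<open>a mod d \<noteq> 0\<close> by (meson not_le)
    qed
    then show ?thesis by (rule mod_0_imp_dvd)
  qed
  moreover have "a \<in> I" if "d dvd a" for a
    using that mult[OF d(1)] unfolding mult.commute[of _ d] by (elim dvdE) simp
  ultimately have "a \<in> I \<longleftrightarrow> d dvd a" for a by (intro iffI)
  then show thesis by (rule that[OF d(2)])
qed

text \<open>The nonzero primes of the integral closure are the closed points of the normalized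
  affine curve; the zero ideal, its generic point, is treated separately. Maximality is not assumed
  but comes out of \<open>inverse_mod_P\<close>.\<close>

locale curve_prime = separable_plane_curve \<iota> x y F
  for \<iota> :: "'k::field \<Rightarrow> 'K::field" and x y F +
  fixes P :: "'K set"
  assumes P_subset: "P \<subseteq> kx_bar"
    and P_add: "u \<in> P \<Longrightarrow> v \<in> P \<Longrightarrow> u + v \<in> P"
    and P_mult: "a \<in> kx_bar \<Longrightarrow> u \<in> P \<Longrightarrow> a * u \<in> P"
    and P_one: "1 \<notin> P"
    and P_prime: "a \<in> kx_bar \<Longrightarrow> b \<in> kx_bar \<Longrightarrow> a * b \<in> P \<Longrightarrow> a \<in> P \<or> b \<in> P"
    and P_nonzero: "\<exists>u\<in>P. u \<noteq> 0"
begin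

lemma P_mem: "u \<in> P \<Longrightarrow> u \<in> kx_bar"
  using P_subset by blast

lemma xpoly_mem: "xpoly a \<in> kx_bar"
  using kx_subset_kx_bar by blast

lemma P_zero: "0 \<in> P"
  using P_nonzero P_mult[OF kx_bar.zero_mem] by auto

lemma P_uminus: "u \<in> P \<Longrightarrow> - u \<in> P"
  using P_mult[OF kx_bar.uminus_mem[OF kx_bar.one_mem], of u] by simp

lemma P_diff: "u \<in> P \<Longrightarrow> v \<in> P \<Longrightarrow> u - v \<in> P"
  using P_add[OF _ P_uminus, of u v] by simp

lemma P_sum: "(\<And>i. i \<in> I \<Longrightarrow> f i \<in> P) \<Longrightarrow> sum f I \<in> P"
  by (induction I rule: infinite_finite_induct) (simp_all add: P_zero P_add)

lemma not_P_mult: "a \<in> kx_bar - P \<Longrightarrow> b \<in> kx_bar - P \<Longrightarrow> a * b \<in> kx_bar - P"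
  using P_prime[of a b] kx_bar.mult_mem[of a b] by blast

lemma not_P_power: "a \<in> kx_bar - P \<Longrightarrow> a ^ n \<in> kx_bar - P"
  by (induction n) (simp_all add: P_one kx_bar.one_mem not_P_mult del: Diff_iff, simp add: P_one kx_bar.one_mem)

lemma not_P_add: "a \<in> kx_bar - P \<Longrightarrow> u \<in> P \<Longrightarrow> a + u \<in> kx_bar - P"
  using P_diff[of "a + u" u] P_mem[of u] kx_bar.add_mem[of a u] by auto

lemma not_P_nonzero: "s \<in> kx_bar - P \<Longrightarrow> s \<noteq> 0"
  using P_zero by auto

text \<open>P meets k[x] in a nonzero ideal because a nonzero element of P divides a nonzero
  polynomial in x; the ideal is principal.\<close>

lemma polynomial_in_P:
  obtains \<pi> where "\<pi> \<noteq> 0" "\<And>a. xpoly a \<in> P \<longleftrightarrow> \<pi> dvd a"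
proof -
  obtain u where u: "u \<in> P" "u \<noteq> 0" using P_nonzero by blast
  obtain p c where p: "c \<noteq> 0" "\<And>i. coeff p i \<in> kx" "u * poly p u = xpoly c"
    using integral_inverse[OF P_mem[OF u(1)] u(2)] by blast
  have "poly p u \<in> kx_bar"
    using p(2) kx_subset_kx_bar P_mem[OF u(1)] by (intro kx_bar.poly_mem) blast+
  then have "xpoly c \<in> P" unfolding p(3)[symmetric] mult.commute[of u] by (rule P_mult[OF _ u(1)])
  have *: "\<exists>d. d \<noteq> 0 \<and> (\<forall>a. a \<in> {a. xpoly a \<in> P} \<longleftrightarrow> d dvd a)"
  proof (rule poly_ideal_generator[of "{a. xpoly a \<in> P}" c])
    show "c \<in> {a. xpoly a \<in> P}" using \<open>xpoly c \<in> P\<close> by simp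
  qed (simp_all add: xpoly.hom_add xpoly.hom_mult P_add P_mult[OF xpoly_mem] p(1), blast)
  then show thesis using that unfolding mem_Collect_eq by blast
qed

definition \<pi> :: "'k poly" where
  "\<pi> = (SOME \<pi>. \<pi> \<noteq> 0 \<and> (\<forall>a. xpoly a \<in> P \<longleftrightarrow> \<pi> dvd a))"

lemma pi_nonzero: "\<pi> \<noteq> 0" and xpoly_in_P_iff: "xpoly a \<in> P \<longleftrightarrow> \<pi> dvd a"
proof -
  have "\<exists>\<pi>. \<pi> \<noteq> 0 \<and> (\<forall>a. xpoly a \<in> P \<longleftrightarrow> \<pi> dvd a)" by (rule polynomial_in_P) blast
  then have "\<pi> \<noteq> 0 \<and> (\<forall>a. xpoly a \<in> P \<longleftrightarrow> \<pi> dvd a)" unfolding \<pi>_def by (rule someI_ex)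
  then show "\<pi> \<noteq> 0" "xpoly a \<in> P \<longleftrightarrow> \<pi> dvd a" by auto
qed

lemma pi_in_P: "xpoly \<pi> \<in> P"
  by (simp add: xpoly_in_P_iff)

text \<open>A Bezout argument: \<pi> is prime and does not divide c, so c and \<pi> generate the
  unit ideal of k[x].\<close>

lemma xpoly_inverse_mod_P:
  assumes "xpoly c \<notin> P"
  obtains c' where "xpoly c' * xpoly c - 1 \<in> P"
proof -
  let ?I = "{a * c + b * \<pi> |a b. True}"
  obtain d where d: "d \<noteq> 0" "\<And>a. a \<in> ?I \<longleftrightarrow> d dvd a"
  proof (rule poly_ideal_generator[of ?I \<pi>])
    show "u + v \<in> ?I" if uv: "u \<in> ?I" "v \<in> ?I" for u v
    proof -
      obtain a b a' b' where "u = a * c + b * \<pi>" "v = a' * c + b' * \<pi>" using uv by blast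
      then have "u + v = (a + a') * c + (b + b') * \<pi>" by (simp add: algebra_simps)
      then show ?thesis by blast
    qed
    show "w * u \<in> ?I" if u: "u \<in> ?I" for u w
    proof -
      obtain a b where "u = a * c + b * \<pi>" using u by blast
      then have "w * u = (w * a) * c + (w * b) * \<pi>" by (simp add: algebra_simps)
      then show ?thesis by blast
    qed
    have "\<pi> = 0 * c + 1 * \<pi>" by simp
    then show "\<pi> \<in> ?I" by blast
  qed (use pi_nonzero in auto)
  have "c = 1 * c + 0 * \<pi>" "\<pi> = 0 * c + 1 * \<pi>" by simp_all
  then have "c \<in> ?I" "\<pi> \<in> ?I" by blast+
  then have "d dvd c" "d dvd \<pi>" using d(2) by simp_all
  then obtain d' where d': "\<pi> = d * d'" by blast
  have "xpoly d \<notin> P"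
    using assms \<open>d dvd c\<close> dvd_trans[of \<pi> d c] by (auto simp: xpoly_in_P_iff)
  \<comment> \<open>The gcd d is not in P, because \<pi> dividing d would divide c. Primality moves
    P to the cofactor d', so \<pi> divides d' and d must be a unit.\<close>
  then have "xpoly d' \<in> P"
    using P_prime[OF xpoly_mem xpoly_mem, of d d'] pi_in_P unfolding d' by (simp add: xpoly.hom_mult)
  then obtain r where r: "d' = \<pi> * r" unfolding xpoly_in_P_iff by (elim dvdE)
  have "d * r = 1"
  proof -
    have "\<pi> * (d * r) = \<pi> * 1" using d' unfolding r by (simp add: mult_ac)
    then show ?thesis using pi_nonzero mult_left_cancel by blast
  qed
  moreover have "d \<in> ?I" using d(2) by simp
  then obtain a b where "d = a * c + b * \<pi>" by blast
  ultimately have "(r * a) * c - 1 = - (r * b) * \<pi>" by (simp add: algebra_simps)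
  then have "xpoly (r * a) * xpoly c - 1 = xpoly (- (r * b) * \<pi>)"
    by (metis xpoly.hom_minus xpoly.hom_mult xpoly.hom_one)
  then have "xpoly (r * a) * xpoly c - 1 \<in> P" by (simp add: xpoly_in_P_iff)
  then show thesis by (rule that)
qed

text \<open>The low coefficients that lie in P are multiples of \<pi> and are collected in the last
  term; c is the lowest coefficient outside P.\<close>

lemma lowest_unit_coefficient:
  assumes u: "u \<in> kx_bar" and "\<And>i. coeff q i \<in> kx" "\<exists>i. coeff q i \<notin> P"
  shows "\<exists>i c p w. xpoly c \<notin> P \<and> (\<forall>i. coeff p i \<in> kx) \<and> w \<in> kx_bar
           \<and> poly q u = u ^ i * (xpoly c + u * poly p u) + xpoly \<pi> * w"
  using assms(2-)
proof (induction q)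
  case 0
  then show ?case using P_zero by simp
next
  case (pCons a q)
  have cq: "coeff q i \<in> kx" for i using pCons.prems(1)[of "Suc i"] by simp
  obtain c where a: "a = xpoly c" using pCons.prems(1)[of 0] by auto
  show ?case
  proof (cases "a \<in> P")
    case False
    then show ?thesis using a cq
      by (intro exI[of _ 0] exI[of _ c] exI[of _ q] exI[of _ 0]) (auto simp: kx_bar.zero_mem)
  next
    case True
    then obtain e where e: "c = \<pi> * e" unfolding a xpoly_in_P_iff by (elim dvdE)
    have "\<exists>i. coeff q i \<notin> P"
    proof -
      obtain i where i: "coeff (pCons a q) i \<notin> P" using pCons.prems(2) by blast
      then show ?thesis using True by (cases i) auto
    qed
    from pCons.IH[OF cq this] obtain i c' p w where *: "xpoly c' \<notin> P" "\<forall>i. coeff p i \<in> kx" "w \<in> kx_bar"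
      "poly q u = u ^ i * (xpoly c' + u * poly p u) + xpoly \<pi> * w" by blast
    have "poly (pCons a q) u = u ^ Suc i * (xpoly c' + u * poly p u) + xpoly \<pi> * (xpoly e + u * w)"
      using *(4) by (simp add: a e xpoly.hom_mult algebra_simps)
    moreover have "xpoly e + u * w \<in> kx_bar" using * u xpoly_mem by (intro kx_bar.add_mem kx_bar.mult_mem)
    ultimately show ?thesis using * by blast
  qed
qed

text \<open>Applied to a monic equation of u, whose leading coefficient 1 is outside P. The outcome
  serves both cases: for u outside P the bracket must lie in P and yields an inverse of u modulo P;
  for u in P the bracket is outside P and some power of u is divisible by \<pi> up to a unit at
  P.\<close>

lemma integral_normal_form:
  assumes u: "u \<in> kx_bar"
  obtains i c p w where "xpoly c \<notin> P" "\<And>i. coeff p i \<in> kx" "poly p u \<in> kx_bar" "w \<in> kx_bar"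
    "u ^ i * (xpoly c + u * poly p u) = xpoly \<pi> * w"
proof -
  obtain q where q: "lead_coeff q = 1" "\<And>i. coeff q i \<in> kx" "poly q u = 0"
    using u by (rule integral_closureE) blast
  have "\<exists>i. coeff q i \<notin> P" using q(1) P_one by metis
  from lowest_unit_coefficient[OF u q(2) this] obtain i c p w where *: "xpoly c \<notin> P" "\<forall>i. coeff p i \<in> kx"
    "w \<in> kx_bar" "poly q u = u ^ i * (xpoly c + u * poly p u) + xpoly \<pi> * w" by blast
  have "poly p u \<in> kx_bar" using *(2) kx_subset_kx_bar u by (intro kx_bar.poly_mem) blast+
  moreover have "u ^ i * (xpoly c + u * poly p u) = xpoly \<pi> * (- w)"
    using *(4) q(3) by (simp add: eq_neg_iff_add_eq_0)
  ultimately show thesis using that[of c p "- w" i] * kx_bar.uminus_mem by blast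
qed

text \<open>From c + u p(u) in P and an inverse c' of c modulo P, the element -c' p(u) inverts u
  modulo P. That the inverse is a polynomial in u over k[x] matters later: it stays in every subring
  that contains k[x] and u.\<close>

lemma inverse_mod_P:
  assumes u: "u \<in> kx_bar - P"
  obtains p where "\<And>i. coeff p i \<in> kx" "u * poly p u - 1 \<in> P"
proof -
  have uk: "u \<in> kx_bar" using u by simp
  obtain i c p w where *: "xpoly c \<notin> P" "\<And>i. coeff p i \<in> kx" "poly p u \<in> kx_bar" "w \<in> kx_bar"
    "u ^ i * (xpoly c + u * poly p u) = xpoly \<pi> * w"
    by (rule integral_normal_form[OF uk]) blast
  have "xpoly \<pi> * w \<in> P" using P_mult[OF *(4) pi_in_P] by (simp add: mult.commute)
  moreover have m: "xpoly c + u * poly p u \<in> kx_bar"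
    using * uk xpoly_mem by (intro kx_bar.add_mem kx_bar.mult_mem)
  ultimately have cu: "xpoly c + u * poly p u \<in> P"
    using P_prime[of "u ^ i" "xpoly c + u * poly p u"] not_P_power[OF u, of i] *(5) by auto
  obtain c' where c': "xpoly c' * xpoly c - 1 \<in> P" using xpoly_inverse_mod_P[OF *(1)] by blast
  define r where "r = smult (- xpoly c') p"
  have "u * poly r u - 1 = (xpoly c' * xpoly c - 1) - xpoly c' * (xpoly c + u * poly p u)"
    by (simp add: r_def algebra_simps)
  also have "\<dots> \<in> P" by (intro P_diff c' P_mult cu xpoly_mem)
  finally have "u * poly r u - 1 \<in> P" .
  moreover have "coeff r i \<in> kx" for i
    unfolding r_def coeff_smult by (intro kx.mult_mem kx.uminus_mem *(2)) simp
  ultimately show thesis by (rule that[rotated])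
qed

lemma inverse_mod_P':
  assumes "u \<in> kx_bar - P"
  obtains v where "v \<in> kx_bar" "v * u - 1 \<in> P"
proof -
  obtain p where p: "\<And>i. coeff p i \<in> kx" "u * poly p u - 1 \<in> P" using inverse_mod_P[OF assms] by blast
  have "poly p u \<in> kx_bar" using p(1) kx_subset_kx_bar assms by (intro kx_bar.poly_mem) blast+
  then show thesis using that p(2) by (simp add: mult.commute)
qed

text \<open>Here the factor c + u p(u) of the normal form is outside P, because c is and u is in
  P.\<close>

lemma power_in_pi_multiples:
  assumes "u \<in> P"
  obtains e m w where "e \<in> kx_bar - P" "w \<in> kx_bar" "e * u ^ m = xpoly \<pi> * w"
proof -
  obtain i c p w where *: "xpoly c \<notin> P" "\<And>i. coeff p i \<in> kx" "poly p u \<in> kx_bar" "w \<in> kx_bar"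
    "u ^ i * (xpoly c + u * poly p u) = xpoly \<pi> * w"
    by (rule integral_normal_form[OF P_mem[OF assms]]) blast
  have "poly p u * u \<in> P" using P_mult[OF *(3) assms] .
  then have "xpoly c + u * poly p u \<in> kx_bar - P"
    using not_P_add[of "xpoly c" "u * poly p u"] *(1) xpoly_mem by (simp add: mult.commute)
  then show thesis using that[of "xpoly c + u * poly p u" w i] *(4,5) by (simp add: mult.commute)
qed

section \<open>The local ring at P and its uniformizer\<close>

definition R :: "'K set" where
  "R = localization kx_bar P"

lemma R_I: "a \<in> kx_bar \<Longrightarrow> s \<in> kx_bar - P \<Longrightarrow> a / s \<in> R"
  by (auto simp: R_def localization_def)

lemma R_E:
  assumes "z \<in> R"
  obtains a s where "a \<in> kx_bar" "s \<in> kx_bar - P" "s \<noteq> 0" "z = a / s"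
  using assms not_P_nonzero by (auto simp: R_def localization_def)

lemma kx_bar_subset_R: "a \<in> kx_bar \<Longrightarrow> a \<in> R"
  using R_I[of a 1] kx_bar.one_mem P_one by simp

sublocale R: field_subring R
proof
  show "1 \<in> R" using kx_bar_subset_R kx_bar.one_mem by simp
  fix z w assume zw: "z \<in> R" "w \<in> R"
  obtain a s where z: "a \<in> kx_bar" "s \<in> kx_bar - P" "s \<noteq> 0" "z = a / s" using zw(1) by (rule R_E)
  obtain b r where w: "b \<in> kx_bar" "r \<in> kx_bar - P" "r \<noteq> 0" "w = b / r" using zw(2) by (rule R_E)
  have "(a * r - b * s) / (s * r) \<in> R"
    using z w by (intro R_I kx_bar.diff_mem kx_bar.mult_mem not_P_mult) auto
  then show "z - w \<in> R" using z w by (simp add: diff_frac_eq mult.commute)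
  have "(a * b) / (s * r) \<in> R"
    using z w by (intro R_I kx_bar.mult_mem not_P_mult) auto
  then show "z * w \<in> R" using z w by simp
qed

lemma inverse_in_R: "s \<in> kx_bar - P \<Longrightarrow> inverse s \<in> R"
  using R_I[of 1 s] kx_bar.one_mem by (simp add: inverse_eq_divide)

lemma clear_denominators:
  fixes f :: "nat \<Rightarrow> 'K"
  assumes "\<And>i. i < n \<Longrightarrow> f i \<in> R"
  shows "\<exists>s\<in>kx_bar - P. \<forall>i<n. s * f i \<in> kx_bar"
  using assms
proof (induction n)
  case 0
  show ?case using kx_bar.one_mem P_one by auto
next
  case (Suc n)
  then obtain s where s: "s \<in> kx_bar - P" "\<forall>i<n. s * f i \<in> kx_bar" by auto
  obtain a r where r: "a \<in> kx_bar" "r \<in> kx_bar - P" "r \<noteq> 0" "f n = a / r" using Suc.prems[of n] R_E by blast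
  have "s * r * f i \<in> kx_bar" if "i < Suc n" for i
  proof (cases "i = n")
    case True
    then have eq: "s * r * f i = s * a" using r by simp
    show ?thesis unfolding eq by (rule kx_bar.mult_mem) (use s(1) r(1) in auto)
  next
    case False
    then have "s * f i \<in> kx_bar" using that s by (metis less_SucE)
    moreover have eq: "s * r * f i = r * (s * f i)" by (simp only: mult_ac)
    ultimately show ?thesis unfolding eq using kx_bar.mult_mem[of r "s * f i"] r by blast
  qed
  then show ?case using not_P_mult[OF s(1) r(2)] by blast
qed

text \<open>The maximal ideal of the local ring is principal: some \<open>z\<close> outside the local ring carries \<open>P\<close>
  into the integral closure, but not into \<open>P\<close> because \<open>z\<close> is not integral.\<close>

lemma uniformizer:
  obtains t s where "t \<in> P" "s \<in> kx_bar - P" "\<And>u. u \<in> P \<Longrightarrow> \<exists>w\<in>kx_bar. s * u = t * w"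
proof -
  obtain g where g: "\<And>i. i < N \<Longrightarrow> g i \<in> P" "\<And>u. u \<in> P \<Longrightarrow> \<exists>a. u = (\<Sum>i<N. xpoly (a i) * g i)"
    "inj_on g {..<N}" "independent (g ` {..<N})"
  proof (rule integral_lattice_basis[of P \<pi>])
    show "xpoly \<pi> * a \<in> P" if "a \<in> A" for a
      using P_mult[OF subsetD[OF A_subset_kx_bar that] pi_in_P] by (simp add: mult.commute)
  qed (use P_add P_mult[OF xpoly_mem] P_subset pi_nonzero in auto)
  let ?p = "xpoly \<pi>"
  have p0: "?p \<noteq> 0" using pi_nonzero by (simp add: xpoly_eq_0_iff)
  \<comment> \<open>The search starts from 1/\<pi>, which is not in the local ring, and treats the
    generators of P one after the other.\<close>
  have "\<exists>a\<in>kx_bar. a / ?p \<notin> R \<and> (\<forall>i<n. a / ?p * g i \<in> R)" if "n \<le> N" for n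
    using that
  proof (induction n)
    case 0
    have "1 / ?p \<notin> R"
    proof
      assume "1 / ?p \<in> R"
      then obtain b s where "b \<in> kx_bar" "s \<in> kx_bar - P" "s \<noteq> 0" "1 / ?p = b / s" by (rule R_E)
      then have "s = b * ?p" using p0 by (simp add: field_simps)
      then show False using P_mult[OF \<open>b \<in> kx_bar\<close> pi_in_P] \<open>s \<in> kx_bar - P\<close> by simp
    qed
    then show ?case using kx_bar.one_mem by auto
  next
    case (Suc n)
    then obtain a where a: "a \<in> kx_bar" "a / ?p \<notin> R" "\<forall>i<n. a / ?p * g i \<in> R" by auto
    have gn: "g n \<in> P" using g(1) Suc.prems by simp
    obtain e m w where e: "e \<in> kx_bar - P" "w \<in> kx_bar" "e * g n ^ m = ?p * w"
      using power_in_pi_multiples[OF gn] by blast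
    have "a / ?p * g n ^ m = a * w / e"
      using e p0 not_P_nonzero[OF e(1)] by (simp add: field_simps)
    then have "a / ?p * g n ^ m \<in> R" using R_I[OF kx_bar.mult_mem[OF a(1) e(2)] e(1)] by simp
    then have ex: "\<exists>k. a / ?p * g n ^ k \<in> R" by blast
    \<comment> \<open>Some power of \<open>g n\<close> carries a/\<pi> into R, since it is divisible
      by \<pi> up to a unit at P. The last power before that happens gives a new fraction still
      outside R which \<open>g n\<close> carries into R; the products with earlier generators stay
      in R.\<close>
    define k where "k = (LEAST k. a / ?p * g n ^ k \<in> R)"
    have k: "a / ?p * g n ^ k \<in> R" unfolding k_def by (rule LeastI_ex[OF ex])
    have "k \<noteq> 0" using k a(2) by (intro notI) simp
    then obtain l where l: "k = Suc l" by (cases k) auto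
    have nl: "a / ?p * g n ^ l \<notin> R" using not_less_Least[of l "\<lambda>k. a / ?p * g n ^ k \<in> R"] l by (simp add: k_def)
    have gR: "g n ^ l \<in> kx_bar" using P_mem[OF gn] by (rule kx_bar.power_mem)
    show ?case
    proof (intro bexI[of _ "a * g n ^ l"] conjI allI impI)
      show "a * g n ^ l / ?p \<notin> R" using nl by simp
      show "a * g n ^ l \<in> kx_bar" using a(1) gR by (rule kx_bar.mult_mem)
      fix i assume i: "i < Suc n"
      show "a * g n ^ l / ?p * g i \<in> R"
      proof (cases "i = n")
        case True
        then show ?thesis using k l by (simp add: mult_ac)
      next
        case False
        then have "a / ?p * g i \<in> R" using a(3) i by (metis less_SucE)
        then have "(a / ?p * g i) * g n ^ l \<in> R" using kx_bar_subset_R[OF gR] by (rule R.mult_mem)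
        then show ?thesis by (simp add: mult_ac)
      qed
    qed
  qed
  from this[OF order.refl] obtain a where a: "a \<in> kx_bar" "a / ?p \<notin> R" "\<forall>i<N. a / ?p * g i \<in> R" by blast
  obtain r where r: "r \<in> kx_bar - P" "\<forall>i<N. r * (a / ?p * g i) \<in> kx_bar"
    using clear_denominators[of N "\<lambda>i. a / ?p * g i"] a(3) by blast
  define z where "z = r * (a / ?p)"
  have zR: "z \<notin> R"
  proof
    assume "z \<in> R"
    with inverse_in_R[OF r(1)] have "inverse r * z \<in> R" by (rule R.mult_mem)
    moreover have "inverse r * z = a / ?p" using not_P_nonzero[OF r(1)] by (simp add: z_def flip: mult.assoc)
    ultimately show False using a(2) by simp
  qed
  have zP: "z * u \<in> kx_bar" if u: "u \<in> P" for u
  proof -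
    obtain c where c: "u = (\<Sum>i<N. xpoly (c i) * g i)" using g(2)[OF u] by (elim exE)
    have "z * u = (\<Sum>i<N. xpoly (c i) * (r * (a / ?p * g i)))"
      unfolding c z_def by (simp add: sum_distrib_left mult_ac)
    also have "\<dots> \<in> kx_bar"
      by (rule kx_bar.sum_mem, rule kx_bar.mult_mem[OF xpoly_mem]) (use r(2) in blast)
    finally show ?thesis .
  qed
  have "\<exists>t\<in>P. z * t \<notin> P"
  proof (rule ccontr)
    assume neg: "\<not> (\<exists>t\<in>P. z * t \<notin> P)"
    have "\<forall>i\<in>{..<N}. \<exists>c. z * g i = (\<Sum>j<N. xpoly (c j) * g j)"
    proof
      fix i assume "i \<in> {..<N}"
      then have "z * g i \<in> P" using neg g(1) by simp
      then show "\<exists>c. z * g i = (\<Sum>j<N. xpoly (c j) * g j)" by (rule g(2))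
    qed
    from bchoice[OF this] obtain m where m: "\<forall>i\<in>{..<N}. z * g i = (\<Sum>j<N. xpoly (m i j) * g j)"
      by (elim exE)
    have g0: "g 0 \<noteq> 0" using g(4) N_pos dependent_zero by (metis image_eqI lessThan_iff)
    have "z \<in> kx_bar"
      by (rule kx.integral_if_stable_family[where I = "{..<N}" and v = g and k = 0 and m = "\<lambda>i j. xpoly (m i j)"])
        (use m g0 N_pos in simp_all)
    then show False using zR kx_bar_subset_R by simp
  qed
  then obtain t where t: "t \<in> P" "z * t \<notin> P" by blast
  show thesis
  proof (rule that[of t "z * t"])
    show "z * t \<in> kx_bar - P" using t zP by simp
    show "\<exists>w\<in>kx_bar. z * t * u = t * w" if u: "u \<in> P" for u
      using zP[OF u] by (intro bexI[of _ "z * u"]) (simp_all add: mult_ac)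
  qed (rule t)
qed

end

section \<open>Primitive elements over perfect fields\<close>

interpretation to_ac: field_hom "to_ac :: 'k::field \<Rightarrow> 'k alg_closure"
  by unfold_locales simp_all

text \<open>Division of the derivative for reasons of degree means that it vanishes, so \<mu> is a
  polynomial in X^p. Over a perfect field the coefficients have p-th roots, and by the additivity of
  the p-th power \<mu> itself is a p-th power, against irreducibility.\<close>

lemma perfect_irreducible_separable:
  fixes \<mu> :: "'k::field poly"
  assumes perf: "perfect_of_pos_char TYPE('k)" and irr: "irreducible \<mu>"
  shows "\<not> \<mu> dvd pderiv \<mu>"
proof
  assume dvd: "\<mu> dvd pderiv \<mu>"
  define p where "p = CHAR('k)"
  have p: "prime p" using perf prime_CHAR_semidom by (auto simp: perfect_of_pos_char_def p_def)
  have p1: "p > 1" using p prime_gt_1_nat by simp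
  have deg: "degree \<mu> > 0"
  proof (rule ccontr)
    assume "\<not> degree \<mu> > 0"
    then obtain a where "\<mu> = [:a:]" by (auto elim: degree_eq_zeroE)
    moreover have "\<mu> \<noteq> 0" using irr by auto
    ultimately have "is_unit \<mu>" by (simp add: is_unit_const_poly_iff dvd_field_iff)
    then show False using irr by (simp add: irreducible_def)
  qed
  have "degree (pderiv \<mu>) < degree \<mu>"
    by (rule degree_lessI) (simp_all add: deg coeff_pderiv coeff_eq_0)
  then have "pderiv \<mu> = 0"
    using dvd dvd_imp_degree_le[OF dvd] by (cases "pderiv \<mu> = 0") auto
  have zero: "coeff \<mu> i = 0" if "\<not> p dvd i" for i
  proof -
    have "i \<noteq> 0" using that by (metis dvd_0_right)
    then obtain j where j: "i = Suc j" using not0_implies_Suc by blast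
    have "of_nat i * coeff \<mu> i = coeff (pderiv \<mu>) j" by (simp add: coeff_pderiv j)
    also have "\<dots> = 0" using \<open>pderiv \<mu> = 0\<close> by simp
    finally have "(of_nat i :: 'k) = 0 \<or> coeff \<mu> i = 0" by simp
    then show ?thesis using that by (simp add: of_nat_eq_0_iff_char_dvd p_def)
  qed
  have "\<forall>a::'k. \<exists>b. b ^ p = a" using perf by (simp add: perfect_of_pos_char_def p_def)
  from choice[OF this] obtain r where r: "\<forall>a::'k. r a ^ p = a" by (elim exE)
  \<comment> \<open>The range up to deg \<mu> is generous: coefficients at p j beyond the degree are
    0.\<close>
  define h where "h = (\<Sum>j\<le>degree \<mu>. monom (r (coeff \<mu> (p * j))) j)"
  have "h ^ p = (\<Sum>j\<le>degree \<mu>. monom (r (coeff \<mu> (p * j))) j ^ p)"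
    unfolding h_def using p by (intro freshmans_dream_sum) (simp_all add: p_def)
  also have "\<dots> = (\<Sum>j\<le>degree \<mu>. monom (coeff \<mu> (p * j)) (p * j))"
    using r by (simp add: monom_power mult.commute)
  also have "\<dots> = \<mu>"
  proof (rule poly_eqI)
    fix i
    have "coeff (\<Sum>j\<le>degree \<mu>. monom (coeff \<mu> (p * j)) (p * j)) i
        = (\<Sum>j\<le>degree \<mu>. if p * j = i then coeff \<mu> (p * j) else 0)"
      by (simp add: coeff_sum coeff_monom)
    also have "\<dots> = coeff \<mu> i"
    proof (cases "p dvd i \<and> i \<le> degree \<mu>")
      case True
      then obtain k where k: "i = p * k" by (auto elim: dvdE)
      have "k \<le> degree \<mu>" using True k p1 by (metis One_nat_def le_trans less_imp_le_nat mult_le_mono1 nat_mult_1)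
      then show ?thesis
        using k p1 by (subst sum.remove[of _ k]) (auto intro!: sum.neutral)
    next
      case False
      then have "coeff \<mu> i = 0" using zero coeff_eq_0 by (metis not_le)
      moreover have "(\<Sum>j\<le>degree \<mu>. if p * j = i then coeff \<mu> (p * j) else 0) = 0"
        using \<open>coeff \<mu> i = 0\<close> by (intro sum.neutral) auto
      ultimately show ?thesis by simp
    qed
    finally show "coeff (\<Sum>j\<le>degree \<mu>. monom (coeff \<mu> (p * j)) (p * j)) i = coeff \<mu> i" .
  qed
  finally have hpow: "h ^ p = \<mu>" .
  have "h ^ p = h * h ^ (p - 1)" using p1 by (cases p) simp_all
  then have hp: "\<mu> = h * h ^ (p - 1)" unfolding hpow .
  have "is_unit h \<or> is_unit (h ^ (p - 1))" by (rule irreducibleD[OF irr hp])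
  moreover have "is_unit h" if "is_unit (h ^ (p - 1))"
  proof -
    have "is_unit h \<or> p - 1 = 0" by (rule iffD1[OF is_unit_power_iff that])
    then show ?thesis using p1 by simp
  qed
  ultimately have "is_unit h" by blast
  then have "is_unit (h ^ p)" by (rule iffD2[OF is_unit_power_iff disjI1])
  then have "is_unit \<mu>" by (simp only: hpow)
  then show False using irr by (simp add: irreducible_def)
qed

section \<open>The fields k[\<alpha>] inside the algebraic closure\<close>

definition ac_eval :: "'k::field alg_closure \<Rightarrow> 'k poly \<Rightarrow> 'k alg_closure" where
  "ac_eval \<alpha> q = poly (map_poly to_ac q) \<alpha>"

lemma ac_eval_hom: "idom_hom (ac_eval \<alpha>)"
proof -
  interpret map_poly_idom_hom "to_ac :: 'a \<Rightarrow> 'a alg_closure" ..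
  show ?thesis by unfold_locales (simp_all add: ac_eval_def hom_distribs)
qed

interpretation ac_eval: idom_hom "ac_eval \<alpha>"
  by (rule ac_eval_hom)

lemma ac_eval_const [simp]: "ac_eval \<alpha> [:c:] = to_ac c"
  by (simp add: ac_eval_def Polynomial.map_poly_pCons)

lemma ac_eval_X [simp]: "ac_eval \<alpha> [:0, 1:] = \<alpha>"
  by (simp add: ac_eval_def Polynomial.map_poly_pCons)

lemma unital_subring_range_ac_eval: "unital_subring (range (ac_eval \<alpha>))"
proof
  show "1 \<in> range (ac_eval \<alpha>)" using ac_eval.hom_one by (metis rangeI)
  show "a - b \<in> range (ac_eval \<alpha>)" "a * b \<in> range (ac_eval \<alpha>)"
    if "a \<in> range (ac_eval \<alpha>)" "b \<in> range (ac_eval \<alpha>)" for a b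
    using that by (auto simp flip: ac_eval.hom_minus ac_eval.hom_mult)
qed

lemma range_ac_eval_subset:
  assumes "unital_subring S" "range to_ac \<subseteq> S" "\<alpha> \<in> S"
  shows "range (ac_eval \<alpha>) \<subseteq> S"
proof -
  interpret unital_subring S by fact
  show ?thesis
  proof
    fix z assume "z \<in> range (ac_eval \<alpha>)"
    then obtain q where "z = ac_eval \<alpha> q" by auto
    then show "z \<in> S" unfolding ac_eval_def using assms(2,3) by (auto intro!: poly_mem)
  qed
qed

lemma to_ac_in_range_ac_eval: "to_ac c \<in> range (ac_eval \<alpha>)"
  using ac_eval_const by (metis rangeI)

lemma self_in_range_ac_eval: "\<alpha> \<in> range (ac_eval \<alpha>)"
  using ac_eval_X by (metis rangeI)

lemma minimal_polynomial:
  fixes \<alpha> :: "'k::field alg_closure"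
  obtains \<mu> where "irreducible \<mu>" "\<And>q. ac_eval \<alpha> q = 0 \<longleftrightarrow> \<mu> dvd q"
proof -
  obtain p where p: "p \<noteq> 0" "ac_eval \<alpha> p = 0" unfolding ac_eval_def by (rule alg_closure_algebraic)
  obtain \<mu> where \<mu>: "\<mu> \<noteq> 0" "\<And>q. q \<in> {q. ac_eval \<alpha> q = 0} \<longleftrightarrow> \<mu> dvd q"
    by (rule poly_ideal_generator[of "{q. ac_eval \<alpha> q = 0}" p])
      (simp_all add: ac_eval.hom_add ac_eval.hom_mult p)
  then have iff: "ac_eval \<alpha> q = 0 \<longleftrightarrow> \<mu> dvd q" for q by simp
  have "irreducible \<mu>"
  proof (rule prime_elem_imp_irreducible)
    show "prime_elem \<mu>"
    proof (rule prime_elemI)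
      show "\<not> is_unit \<mu>" using iff[of 1] by simp
      show "\<mu> dvd a \<or> \<mu> dvd b" if "\<mu> dvd a * b" for a b
        using that iff[of "a * b"] iff[of a] iff[of b] by (simp add: ac_eval.hom_mult)
    qed (rule \<mu>(1))
  qed
  then show thesis using iff by (rule that)
qed

text \<open>k[\<alpha>] is a field: q does not vanish at \<alpha>, so it is coprime to the
  irreducible minimal polynomial, and Bezout gives the inverse.\<close>

lemma range_ac_eval_inverse:
  assumes "z \<in> range (ac_eval \<alpha>)" "z \<noteq> 0"
  shows "inverse z \<in> range (ac_eval \<alpha>)"
proof -
  obtain q where q: "z = ac_eval \<alpha> q" using assms(1) by auto
  obtain \<mu> where \<mu>: "irreducible \<mu>" "\<And>q. ac_eval \<alpha> q = 0 \<longleftrightarrow> \<mu> dvd q" using minimal_polynomial by blast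
  let ?I = "{a * q + b * \<mu> |a b. True}"
  have \<mu>0: "\<mu> \<noteq> 0" using \<mu>(1) by auto
  obtain d where d: "d \<noteq> 0" "\<And>a. a \<in> ?I \<longleftrightarrow> d dvd a"
  proof (rule poly_ideal_generator[of ?I \<mu>])
    show "u + v \<in> ?I" if uv: "u \<in> ?I" "v \<in> ?I" for u v
    proof -
      obtain a b a' b' where "u = a * q + b * \<mu>" "v = a' * q + b' * \<mu>" using uv by blast
      then have "u + v = (a + a') * q + (b + b') * \<mu>" by (simp add: algebra_simps)
      then show ?thesis by blast
    qed
    show "w * u \<in> ?I" if u: "u \<in> ?I" for u w
    proof -
      obtain a b where "u = a * q + b * \<mu>" using u by blast
      then have "w * u = (w * a) * q + (w * b) * \<mu>" by (simp add: algebra_simps)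
      then show ?thesis by blast
    qed
    have "\<mu> = 0 * q + 1 * \<mu>" by simp
    then show "\<mu> \<in> ?I" by blast
  qed (use \<mu>0 in auto)
  have "q = 1 * q + 0 * \<mu>" "\<mu> = 0 * q + 1 * \<mu>" by simp_all
  then have "q \<in> ?I" "\<mu> \<in> ?I" by blast+
  then have dd: "d dvd q" "d dvd \<mu>" using d(2) by simp_all
  have "\<not> \<mu> dvd d"
  proof
    assume "\<mu> dvd d"
    then have "\<mu> dvd q" using dd(1) by (rule dvd_trans)
    then show False using \<mu>(2) q assms(2) by simp
  qed
  then have "is_unit d" using irreducibleD'[OF \<mu>(1) dd(2)] by blast
  then have "1 \<in> ?I" using d(2) by simp
  then obtain a b where "1 = a * q + b * \<mu>" by blast
  from arg_cong[OF this, of "ac_eval \<alpha>"] have "1 = ac_eval \<alpha> a * z"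
    using \<mu>(2)[of \<mu>] q by (simp add: ac_eval.hom_add ac_eval.hom_mult)
  then have "inverse z = ac_eval \<alpha> a" using assms(2) by (simp add: field_simps)
  then show ?thesis by simp
qed

text \<open>The minimal polynomial of \<beta> over k[\<gamma>]. As that field is a set, divisibility
  is taken in the polynomials over the whole closure, and division by the monic h keeps the
  coefficients in the field.\<close>

lemma monic_minimal_polynomial_over:
  fixes \<beta> \<gamma> :: "'k::field alg_closure"
  defines "S \<equiv> range (ac_eval \<gamma>)"
  obtains h where "lead_coeff h = 1" "\<forall>i. coeff h i \<in> S" "poly h \<beta> = 0"
    "\<And>g. \<forall>i. coeff g i \<in> S \<Longrightarrow> poly g \<beta> = 0 \<Longrightarrow> h dvd g"
proof -
  interpret S: unital_subring S unfolding S_def by (rule unital_subring_range_ac_eval)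
  let ?I = "\<lambda>g. (\<forall>i. coeff g i \<in> S) \<and> poly g \<beta> = 0 \<and> g \<noteq> 0"
  obtain p where p: "p \<noteq> 0" "poly (map_poly to_ac p) \<beta> = 0" by (rule alg_closure_algebraic)
  have "?I (map_poly to_ac p)"
    using p to_ac_in_range_ac_eval by (auto simp: S_def coeff_map_poly)
  from ex_has_least_nat[where P = ?I and m = degree, OF this]
  obtain h where h: "?I h" and least: "\<forall>g. ?I g \<longrightarrow> degree h \<le> degree g" by blast
  define h' where "h' = smult (inverse (lead_coeff h)) h"
  have lc: "inverse (lead_coeff h) \<in> S" "lead_coeff h \<noteq> 0"
    using h range_ac_eval_inverse[of "lead_coeff h" \<gamma>] by (auto simp: S_def)
  have h': "lead_coeff h' = 1" "\<forall>i. coeff h' i \<in> S" "poly h' \<beta> = 0" "degree h' = degree h"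
    using h lc S.mult_mem by (auto simp: h'_def)
  have "h' dvd g" if g: "\<forall>i. coeff g i \<in> S" "poly g \<beta> = 0" for g
  proof -
    from S.monic_division[OF h'(1,2) g(1)] obtain q r where qr: "\<forall>i. coeff r i \<in> S" "g = h' * q + r"
      "r = 0 \<or> degree r < degree h'" by blast
    have "poly r \<beta> = 0" using qr(2) g(2) h'(3) by simp
    have "r = 0"
    proof (rule ccontr)
      assume "r \<noteq> 0"
      then have "degree h \<le> degree r" using least qr(1) \<open>poly r \<beta> = 0\<close> by blast
      then show False using qr(3) \<open>r \<noteq> 0\<close> h'(4) by simp
    qed
    then show ?thesis using qr(2) by simp
  qed
  then show thesis using that h' by blast
qed

text \<open>With \<gamma> = \<alpha> + c \<beta>, the minimal polynomial h of \<beta> over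
  k[\<gamma>] divides both the separable g and f(\<gamma> - c X). If c avoids finitely many values
  these have only the simple root \<beta> in common, so h = X - \<beta> and its constant coefficient
  puts \<beta> into k[\<gamma>].\<close>

lemma primitive_element_pair:
  fixes \<alpha> \<beta> :: "'k::field alg_closure"
  assumes perf: "perfect_of_pos_char TYPE('k)" and inf: "infinite (UNIV :: 'k set)"
  obtains c where "\<beta> \<in> range (ac_eval (\<alpha> + to_ac c * \<beta>))"
proof -
  obtain f where f: "f \<noteq> 0" "poly (map_poly to_ac f) \<alpha> = 0" by (rule alg_closure_algebraic)
  obtain g where g: "irreducible g" "\<And>q. ac_eval \<beta> q = 0 \<longleftrightarrow> g dvd q" using minimal_polynomial by blast
  define f' where "f' = (map_poly to_ac f :: 'k alg_closure poly)"
  define g' where "g' = (map_poly to_ac g :: 'k alg_closure poly)"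
  have f0: "f' \<noteq> 0" and g0: "g' \<noteq> 0" using f(1) g(1) by (auto simp: f'_def g'_def)
  have g'\<beta>: "poly g' \<beta> = 0" using g(2)[of g] by (simp add: g'_def ac_eval_def)
  have "ac_eval \<beta> (pderiv g) \<noteq> 0" using g(2) perfect_irreducible_separable[OF perf g(1)] by simp
  then have sep: "poly (pderiv g') \<beta> \<noteq> 0" by (simp add: g'_def ac_eval_def to_ac.map_poly_pderiv)
  \<comment> \<open>The pairs with b = \<beta> contribute only the value 0 by the convention for
    division by 0, so the set stays finite.\<close>
  define bad where "bad = (\<lambda>(a, b). (a - \<alpha>) / (\<beta> - b)) ` ({a. poly f' a = 0} \<times> {b. poly g' b = 0})"
  have "finite bad" unfolding bad_def using poly_roots_finite f0 g0 by blast
  moreover have "infinite (range (to_ac :: 'k \<Rightarrow> 'k alg_closure))"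
    using inf finite_imageD inj_to_ac by blast
  ultimately have "\<not> range to_ac \<subseteq> bad" using finite_subset by blast
  then obtain c :: 'k where c: "to_ac c \<notin> bad" by blast
  define \<gamma> where "\<gamma> = \<alpha> + to_ac c * \<beta>"
  let ?S = "range (ac_eval \<gamma>)"
  interpret S: unital_subring ?S by (rule unital_subring_range_ac_eval)
  interpret SP: unital_subring "{q. \<forall>i. coeff q i \<in> ?S}" by (rule S.unital_subring_poly)
  obtain h where h: "lead_coeff h = 1" "\<forall>i. coeff h i \<in> ?S" "poly h \<beta> = 0"
    "\<And>g. \<forall>i. coeff g i \<in> ?S \<Longrightarrow> poly g \<beta> = 0 \<Longrightarrow> h dvd g"
    using monic_minimal_polynomial_over[of \<gamma> \<beta>] by blast
  have "\<forall>i. coeff g' i \<in> ?S" by (simp add: g'_def coeff_map_poly to_ac_in_range_ac_eval)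
  then have hg: "h dvd g'" using h(4) g'\<beta> by simp
  define F where "F = pcompose f' [:\<gamma>, - to_ac c:]"
  have "F \<in> {q. \<forall>i. coeff q i \<in> ?S}"
    unfolding F_def pcompose_altdef
  proof (rule SP.poly_mem)
    show "coeff (map_poly (\<lambda>x. [:x:]) f') i \<in> {q. \<forall>i. coeff q i \<in> ?S}" for i
      using S.zero_mem to_ac_in_range_ac_eval
      by (auto simp: coeff_map_poly f'_def coeff_pCons split: nat.splits)
    show "[:\<gamma>, - to_ac c:] \<in> {q. \<forall>i. coeff q i \<in> ?S}"
      using S.zero_mem S.uminus_mem[OF to_ac_in_range_ac_eval] self_in_range_ac_eval
      by (auto simp: coeff_pCons split: nat.splits)
  qed
  moreover have "poly F \<beta> = 0"
    using f(2) by (simp add: F_def poly_pcompose \<gamma>_def f'_def algebra_simps)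
  ultimately have hF: "h dvd F" using h(4) by simp
  obtain h1 where h1: "h = [:- \<beta>, 1:] * h1" using h(3) poly_eq_0_iff_dvd by (metis dvdE)
  \<comment> \<open>A further root b of h would be different from \<beta> by separability of g. Then
    a = \<gamma> - c b is a root of f with c = (a - \<alpha>) / (\<beta> - b), a bad value.\<close>
  have "degree h1 = 0"
  proof (rule ccontr)
    assume "degree h1 \<noteq> 0"
    then obtain b where b: "poly h1 b = 0" using alg_closed_imp_poly_has_root[of h1] by auto
    have gb: "poly g' b = 0" using hg b h1 by (auto simp: dvd_def)
    have Fb: "poly F b = 0" using hF b h1 by (auto simp: dvd_def)
    have "b \<noteq> \<beta>"
    proof
      assume "b = \<beta>"
      then obtain h2 where h2: "h1 = [:- \<beta>, 1:] * h2" using b poly_eq_0_iff_dvd by (metis dvdE)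
      obtain q where q: "g' = h * q" using hg by (elim dvdE)
      have "g' = [:- \<beta>, 1:] * ([:- \<beta>, 1:] * (h2 * q))" unfolding q h1 h2 by (simp only: mult.assoc)
      then have "poly (pderiv g') \<beta> = 0" by (simp only: pderiv_mult poly_add poly_mult) simp
      then show False using sep by simp
    qed
    define a where "a = \<alpha> + to_ac c * \<beta> - to_ac c * b"
    have "poly f' a = 0" using Fb by (simp add: F_def poly_pcompose \<gamma>_def a_def algebra_simps)
    moreover have "to_ac c = (a - \<alpha>) / (\<beta> - b)"
      using \<open>b \<noteq> \<beta>\<close> by (simp add: a_def field_simps)
    ultimately have "to_ac c \<in> bad" using gb by (force simp: bad_def)
    then show False using c by simp
  qed
  then obtain e where e: "h1 = [:e:]" by (rule degree_eq_zeroE)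
  have "e = 1" using h(1) unfolding h1 e by (auto split: if_splits)
  then have "coeff h 0 = - \<beta>" by (simp add: h1 e)
  then have "- \<beta> \<in> ?S" using h(2) by metis
  then have "\<beta> \<in> ?S" using S.uminus_mem[of "- \<beta>"] by simp
  then show thesis using that unfolding \<gamma>_def by blast
qed

lemma cring_unital_subring:
  assumes "unital_subring S"
  shows "cring (ring_of_type_algebra\<lparr>carrier := S\<rparr>)"
proof -
  interpret unital_subring S by fact
  show ?thesis
  proof (rule cringI)
    show "abelian_group (ring_of_type_algebra\<lparr>carrier := S\<rparr>)"
      by (rule abelian_groupI)
        (auto simp: ring_of_type_algebra_def add_mem zero_mem algebra_simps intro!: bexI[of _ "- _"] uminus_mem)
    show "comm_monoid (ring_of_type_algebra\<lparr>carrier := S\<rparr>)"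
      by (rule comm_monoidI)
        (auto simp: ring_of_type_algebra_def mult_mem one_mem algebra_simps)
  qed (auto simp: ring_of_type_algebra_def algebra_simps)
qed

text \<open>A finite subring of a field is a field, as multiplication by a nonzero element is
  injective, and its multiplicative group is cyclic. This replaces the choice of c above when k is
  finite.\<close>

lemma finite_subring_cyclic:
  fixes S :: "'a::field set"
  assumes S: "unital_subring S" and fin: "finite S"
  obtains \<theta> where "\<theta> \<in> S" "\<theta> \<noteq> 0" "\<And>z. z \<in> S \<Longrightarrow> z = 0 \<or> (\<exists>n. z = \<theta> ^ n)"
proof -
  interpret S: unital_subring S by fact
  let ?R = "ring_of_type_algebra\<lparr>carrier := S\<rparr>"
  interpret R: cring ?R by (rule cring_unital_subring[OF S])
  have R_simps: "carrier ?R = S" "monoid.mult ?R = (*)" "one ?R = 1" "zero ?R = 0"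
    by (simp_all add: ring_of_type_algebra_def fun_eq_iff)
  have inv: "\<exists>w\<in>S. z * w = 1" if z: "z \<in> S" "z \<noteq> 0" for z
  proof -
    have "inj_on ((*) z) S" using z by (auto simp: inj_on_def)
    then have "(*) z ` S = S" using endo_inj_surj[OF fin] S.mult_mem z by blast
    then show ?thesis using S.one_mem by (metis imageE)
  qed
  have "field ?R"
  proof (rule R.cring_fieldI)
    show "Units ?R = carrier ?R - {zero ?R}"
      unfolding Units_def R_simps using inv by (auto simp: mult.commute)
  qed
  then interpret F: field ?R .
  obtain \<theta> where \<theta>: "\<theta> \<in> carrier (mult_of ?R)" "carrier (mult_of ?R) = {\<theta> [^]\<^bsub>?R\<^esub> i |i::nat. i \<in> UNIV}"
    using F.finite_field_mult_group_has_gen fin by (auto simp: R_simps)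
  have pow: "\<theta> [^]\<^bsub>?R\<^esub> (n::nat) = \<theta> ^ n" for n
    by (induction n) (simp_all add: R_simps mult.commute)
  show thesis
  proof (rule that[of \<theta>])
    show "\<theta> \<in> S" "\<theta> \<noteq> 0" using \<theta>(1) by (simp_all add: R_simps)
    show "z = 0 \<or> (\<exists>n. z = \<theta> ^ n)" if "z \<in> S" for z
    proof (cases "z = 0")
      case False
      then have "z \<in> carrier (mult_of ?R)" using that by (simp add: R_simps)
      then show ?thesis unfolding \<theta>(2) pow by blast
    qed simp
  qed
qed

lemma finite_polys_degree_less:
  assumes "finite (UNIV :: 'k::zero set)"
  shows "finite {q :: 'k poly. degree q < n}"
proof -
  have "coeffs ` {q :: 'k poly. degree q < n} \<subseteq> {xs. set xs \<subseteq> UNIV \<and> length xs \<le> n}"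
    by (auto simp: length_coeffs_degree coeffs_def)
  then have "finite (coeffs ` {q :: 'k poly. degree q < n})"
    using finite_lists_length_le[OF assms] finite_subset by blast
  moreover have "inj_on coeffs {q :: 'k poly. degree q < n}"
    by (auto simp: inj_on_def coeffs_eq_iff)
  ultimately show ?thesis using finite_imageD by blast
qed

lemma finite_range_ac_eval:
  fixes \<alpha> :: "'k::field alg_closure"
  assumes "finite (UNIV :: 'k set)"
  shows "finite (range (ac_eval \<alpha>))"
proof -
  obtain p where p: "p \<noteq> 0" "ac_eval \<alpha> p = 0" unfolding ac_eval_def by (rule alg_closure_algebraic)
  have "degree p > 0"
  proof (rule ccontr)
    assume "\<not> degree p > 0"
    then obtain a where "p = [:a:]" by (auto elim: degree_eq_zeroE)
    then show False using p by simp
  qed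
  have "range (ac_eval \<alpha>) \<subseteq> ac_eval \<alpha> ` {q. degree q < degree p}"
  proof
    fix z assume "z \<in> range (ac_eval \<alpha>)"
    then obtain q where "z = ac_eval \<alpha> q" by auto
    then have "z = ac_eval \<alpha> (q div p * p + q mod p)" by simp
    then have "z = ac_eval \<alpha> (q mod p)" unfolding ac_eval.hom_add ac_eval.hom_mult p(2) by simp
    moreover have "degree (q mod p) < degree p"
      using p(1) \<open>degree p > 0\<close> degree_mod_less[of p q] by (metis degree_0)
    ultimately show "z \<in> ac_eval \<alpha> ` {q. degree q < degree p}" by blast
  qed
  then show ?thesis using finite_polys_degree_less[OF assms] finite_subset by blast
qed

section \<open>The residue field\<close>

context curve_prime
begin

text \<open>An embedding over k of S/(P \<inter> S) into the algebraic closure, written as a map on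
  S with kernel P \<inter> S. Allowing subrings S makes it possible to reach the whole integral
  closure by adjoining one generator at a time.\<close>

definition residue_map :: "'K set \<Rightarrow> ('K \<Rightarrow> 'k alg_closure) \<Rightarrow> bool" where
  "residue_map S \<rho> \<longleftrightarrow> unital_subring S \<and> S \<subseteq> kx_bar \<and> (\<forall>c. \<iota> c \<in> S \<and> \<rho> (\<iota> c) = to_ac c) \<and>
     (\<forall>a\<in>S. \<forall>b\<in>S. \<rho> (a + b) = \<rho> a + \<rho> b) \<and> (\<forall>a\<in>S. \<forall>b\<in>S. \<rho> (a * b) = \<rho> a * \<rho> b) \<and>
     (\<forall>a\<in>S. \<rho> a = 0 \<longleftrightarrow> a \<in> P)"

lemma residue_mapD:
  assumes "residue_map S \<rho>"
  shows "unital_subring S" "S \<subseteq> kx_bar" "\<iota> c \<in> S" "\<rho> (\<iota> c) = to_ac c"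
    "a \<in> S \<Longrightarrow> b \<in> S \<Longrightarrow> \<rho> (a + b) = \<rho> a + \<rho> b"
    "a \<in> S \<Longrightarrow> b \<in> S \<Longrightarrow> \<rho> (a * b) = \<rho> a * \<rho> b"
    "a \<in> S \<Longrightarrow> \<rho> a = 0 \<longleftrightarrow> a \<in> P"
  using assms unfolding residue_map_def by blast+

lemma residue_map_rules:
  assumes r: "residue_map S \<rho>"
  shows "\<rho> 0 = 0" "\<rho> 1 = 1" "a \<in> S \<Longrightarrow> \<rho> (- a) = - \<rho> a" "a \<in> S \<Longrightarrow> b \<in> S \<Longrightarrow> \<rho> (a - b) = \<rho> a - \<rho> b"
    "(\<And>i. i \<in> I \<Longrightarrow> f i \<in> S) \<Longrightarrow> \<rho> (sum f I) = (\<Sum>i\<in>I. \<rho> (f i))"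
proof -
  note d = residue_mapD[OF r]
  interpret S: unital_subring S by (rule d(1))
  show 0: "\<rho> 0 = 0" using d(4)[of 0] by simp
  show 1: "\<rho> 1 = 1" using d(4)[of 1] by simp
  show u: "\<rho> (- a) = - \<rho> a" if "a \<in> S" for a
  proof -
    have "\<rho> (- a) + \<rho> a = \<rho> (- a + a)" by (rule d(5)[symmetric, OF S.uminus_mem[OF that] that])
    then show ?thesis using 0 by (simp add: eq_neg_iff_add_eq_0)
  qed
  show "\<rho> (a - b) = \<rho> a - \<rho> b" if "a \<in> S" "b \<in> S"
    using d(5)[OF that(1) S.uminus_mem[OF that(2)]] u[OF that(2)] by simp
  show "\<rho> (sum f I) = (\<Sum>i\<in>I. \<rho> (f i))" if "\<And>i. i \<in> I \<Longrightarrow> f i \<in> S"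
    using that by (induction I rule: infinite_finite_induct) (simp_all add: 0 d(5) S.sum_mem)
qed

lemma residue_map_poly:
  assumes r: "residue_map S \<rho>" and p: "\<forall>i. coeff p i \<in> S" and q: "\<forall>i. coeff q i \<in> S"
  shows "map_poly \<rho> (p + q) = map_poly \<rho> p + map_poly \<rho> q"
    "map_poly \<rho> (p - q) = map_poly \<rho> p - map_poly \<rho> q"
    "map_poly \<rho> (p * q) = map_poly \<rho> p * map_poly \<rho> q"
proof -
  note d = residue_mapD[OF r] and rr = residue_map_rules[OF r]
  interpret S: unital_subring S by (rule d(1))
  show "map_poly \<rho> (p + q) = map_poly \<rho> p + map_poly \<rho> q"
    "map_poly \<rho> (p - q) = map_poly \<rho> p - map_poly \<rho> q"
    using p q by (auto intro!: poly_eqI simp: coeff_map_poly rr d)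
  show "map_poly \<rho> (p * q) = map_poly \<rho> p * map_poly \<rho> q"
  proof (rule poly_eqI)
    fix n
    have "coeff (map_poly \<rho> (p * q)) n = \<rho> (\<Sum>i\<le>n. coeff p i * coeff q (n - i))"
      by (simp add: coeff_map_poly rr(1) coeff_mult)
    also have "\<dots> = (\<Sum>i\<le>n. \<rho> (coeff p i * coeff q (n - i)))"
      using p q by (intro rr(5) S.mult_mem) simp_all
    also have "\<dots> = (\<Sum>i\<le>n. \<rho> (coeff p i) * \<rho> (coeff q (n - i)))"
      using p q by (intro sum.cong refl d(6)) simp_all
    finally show "coeff (map_poly \<rho> (p * q)) n = coeff (map_poly \<rho> p * map_poly \<rho> q) n"
      by (simp add: coeff_map_poly rr(1) coeff_mult)
  qed
qed

text \<open>Extension of \<rho> to S[\<alpha>]. Among the q over S with q(\<alpha>) in P, one whose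
  reduction is nonzero of least degree plays the role of a minimal polynomial, and \<alpha> is sent
  to a root \<xi> of its reduction. Hypothesis \<open>inv\<close> makes S[\<alpha>] modulo P a
  field, which ensures that nothing outside P is sent to 0.\<close>

lemma residue_map_extend:
  assumes r: "residue_map S \<rho>" and \<alpha>: "\<alpha> \<in> kx_bar"
    and alg: "\<exists>q. (\<forall>i. coeff q i \<in> S) \<and> poly q \<alpha> \<in> P \<and> (\<exists>i. coeff q i \<notin> P)"
    and inv: "\<And>q. \<forall>i. coeff q i \<in> S \<Longrightarrow> poly q \<alpha> \<notin> P \<Longrightarrow> \<exists>h. (\<forall>i. coeff h i \<in> S) \<and> poly q \<alpha> * poly h \<alpha> - 1 \<in> P"
  shows "\<exists>\<rho>'. residue_map {poly q \<alpha> |q. \<forall>i. coeff q i \<in> S} \<rho>'"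
proof -
  note d = residue_mapD[OF r] and rr = residue_map_rules[OF r] and rp = residue_map_poly[OF r]
  interpret S: unital_subring S by (rule d(1))
  interpret SP: unital_subring "{q. \<forall>i. coeff q i \<in> S}" by (rule S.unital_subring_poly)
  have ev_kx: "poly q \<alpha> \<in> kx_bar" if "\<forall>i. coeff q i \<in> S" for q
    using that d(2) by (intro kx_bar.poly_mem \<alpha>) blast
  let ?m = "map_poly \<rho>"
  let ?I = "\<lambda>q. (\<forall>i. coeff q i \<in> S) \<and> poly q \<alpha> \<in> P"
  have cm: "coeff (?m q) i = \<rho> (coeff q i)" for q i by (simp add: coeff_map_poly rr(1))
  obtain q1 where q1: "?I q1" "\<exists>i. coeff q1 i \<notin> P" using alg by blast
  then have "?m q1 \<noteq> 0" using d(7) by (metis cm coeff_0)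
  then have "?I q1 \<and> ?m q1 \<noteq> 0" using q1 by simp
  from ex_has_least_nat[where P = "\<lambda>q. ?I q \<and> ?m q \<noteq> 0" and m = "\<lambda>q. degree (?m q)", OF this]
  obtain q0 where q0: "?I q0" "?m q0 \<noteq> 0"
    and least: "\<forall>q. ?I q \<and> ?m q \<noteq> 0 \<longrightarrow> degree (?m q0) \<le> degree (?m q)" by blast
  define n0 where "n0 = degree (?m q0)"
  \<comment> \<open>If the reduction were constant, all higher coefficients would lie in P, hence
    the constant one too because q0(\<alpha>) does, and the reduction would be 0.\<close>
  have "degree (?m q0) > 0"
  proof (rule ccontr)
    assume "\<not> degree (?m q0) > 0"
    then have c: "\<rho> (coeff q0 i) = 0" if "i > 0" for i
      using that coeff_eq_0[of "?m q0" i] by (simp add: cm)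
    then have cP: "coeff q0 i \<in> P" if "i > 0" for i using q0(1) d(7) that by blast
    have "poly q0 \<alpha> = coeff q0 0 + (\<Sum>i\<in>{0<..degree q0}. coeff q0 i * \<alpha> ^ i)"
      unfolding poly_altdef by (subst sum.remove[of _ 0]) (auto intro!: sum.cong)
    moreover have "(\<Sum>i\<in>{0<..degree q0}. coeff q0 i * \<alpha> ^ i) \<in> P"
      using cP P_mult[OF kx_bar.power_mem[OF \<alpha>]] by (intro P_sum) (simp add: mult.commute)
    ultimately have "coeff q0 0 \<in> P" using q0(1) P_diff by (metis add_diff_cancel_right')
    then have "coeff (?m q0) 0 = 0" using d(7) q0(1) by (simp add: cm)
    then have "?m q0 = 0" using \<open>\<not> degree (?m q0) > 0\<close> by (metis gr0I leading_coeff_0_iff)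
    then show False using q0(2) by simp
  qed
  then obtain \<xi> where \<xi>: "poly (?m q0) \<xi> = 0" using alg_closed_imp_poly_has_root by blast
  have vanish: "poly (?m q) \<xi> = 0" if "?I q" for q
    using that
  proof (induction "degree (?m q)" arbitrary: q rule: less_induct)
    case less
    show ?case
    proof (cases "?m q = 0")
      case True
      then show ?thesis by simp
    next
      case False
      define n where "n = degree (?m q)"
      have le: "n0 \<le> n" using least less.prems False by (auto simp: n_def n0_def)
      have npos: "n > 0" using le \<open>degree (?m q0) > 0\<close> by (simp add: n0_def)
      define a where "a = coeff q0 n0"
      define b where "b = coeff q n"
      \<comment> \<open>Pseudo-division: cross-multiplying by the leading coefficients of the two
        reductions cancels the top term without inverting anything in S, and \<rho> a is
        nonzero.\<close>
      define q' where "q' = [:a:] * q - monom b (n - n0) * q0"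
      have aS: "\<forall>i. coeff [:a:] i \<in> S" and bS: "\<forall>i. coeff (monom b (n - n0)) i \<in> S"
        using q0(1) less.prems S.zero_mem by (auto simp: a_def b_def coeff_pCons coeff_monom split: nat.splits)
      have qS: "\<forall>i. coeff q i \<in> S" and q0S: "\<forall>i. coeff q0 i \<in> S" using less.prems q0(1) by auto
      have p1: "\<forall>i. coeff ([:a:] * q) i \<in> S" and p2: "\<forall>i. coeff (monom b (n - n0) * q0) i \<in> S"
        using SP.mult_mem aS bS qS q0S by blast+
      have mq': "?m q' = [:\<rho> a:] * ?m q - monom (\<rho> b) (n - n0) * ?m q0"
        unfolding q'_def rp(2)[OF p1 p2] rp(3)[OF aS qS] rp(3)[OF bS q0S]
        by (simp add: map_poly_monom rr(1) Polynomial.map_poly_pCons)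
      have Iq': "?I q'"
      proof
        show "\<forall>i. coeff q' i \<in> S" using SP.diff_mem[of "[:a:] * q" "monom b (n - n0) * q0"] p1 p2 by (simp add: q'_def)
        have "a \<in> kx_bar" "poly (monom b (n - n0)) \<alpha> \<in> kx_bar"
          using d(2) q0(1) ev_kx[OF bS] by (auto simp: a_def)
        then show "poly q' \<alpha> \<in> P"
          using less.prems q0(1) by (simp add: q'_def P_diff P_mult del: poly_monom)
      qed
      have cn: "coeff (?m q') n = 0"
        unfolding mq' using le by (simp add: coeff_monom_mult cm a_def b_def)
      have dle: "degree (?m q') \<le> n"
        unfolding mq'
      proof (rule degree_diff_le)
        show "degree ([:\<rho> a:] * ?m q) \<le> n" by (simp add: n_def)
        have "degree (monom (\<rho> b) (n - n0) * ?m q0) \<le> (n - n0) + n0"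
          by (rule order.trans[OF degree_mult_le]) (simp add: n0_def degree_monom_le add_mono)
        then show "degree (monom (\<rho> b) (n - n0) * ?m q0) \<le> n" using le by simp
      qed
      have "degree (?m q') < n"
        by (rule degree_lessI) (use npos cn dle in \<open>auto simp: coeff_eq_0 le_less\<close>)
      then have "poly (?m q') \<xi> = 0" using less.hyps[of q'] Iq' by (simp add: n_def)
      then have "\<rho> a * poly (?m q) \<xi> = 0" unfolding mq' using \<xi> by simp
      moreover have "\<rho> a \<noteq> 0" using q0(2) by (simp add: a_def n0_def flip: cm)
      ultimately show ?thesis by simp
    qed
  qed
  let ?T = "{poly q \<alpha> |q. \<forall>i. coeff q i \<in> S}"
  \<comment> \<open>Any representing polynomial will do: two of them differ by one that vanishes at
    \<alpha>, and its reduction vanishes at \<xi>.\<close>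
  define rep where "rep z = (SOME q. (\<forall>i. coeff q i \<in> S) \<and> poly q \<alpha> = z)" for z
  define \<rho>' where "\<rho>' z = poly (?m (rep z)) \<xi>" for z
  have \<rho>': "\<rho>' (poly q \<alpha>) = poly (?m q) \<xi>" if q: "\<forall>i. coeff q i \<in> S" for q
  proof -
    have "\<exists>q'. (\<forall>i. coeff q' i \<in> S) \<and> poly q' \<alpha> = poly q \<alpha>" using q by blast
    then have rep: "\<forall>i. coeff (rep (poly q \<alpha>)) i \<in> S" "poly (rep (poly q \<alpha>)) \<alpha> = poly q \<alpha>"
      unfolding rep_def by (rule someI2_ex, simp)+
    have "?I (rep (poly q \<alpha>) - q)" using rep q S.diff_mem P_zero by simp
    from vanish[OF this] show ?thesis unfolding \<rho>'_def rp(2)[OF rep(1) q] by simp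
  qed
  have "residue_map ?T \<rho>'"
    unfolding residue_map_def
  proof (intro conjI allI ballI)
    show "unital_subring ?T"
    proof
      have "1 = poly 1 \<alpha>" "\<forall>i. coeff 1 i \<in> S" using SP.one_mem by auto
      then show "1 \<in> ?T" by blast
      fix u v assume "u \<in> ?T" "v \<in> ?T"
      then obtain p q where pq: "\<forall>i. coeff p i \<in> S" "\<forall>i. coeff q i \<in> S" "u = poly p \<alpha>" "v = poly q \<alpha>" by blast
      have "u - v = poly (p - q) \<alpha>" "u * v = poly (p * q) \<alpha>" using pq by simp_all
      then show "u - v \<in> ?T" "u * v \<in> ?T" using SP.diff_mem[of p q] SP.mult_mem[of p q] pq by blast+
    qed
    show "?T \<subseteq> kx_bar" using ev_kx by blast
    fix c
    have C: "\<forall>i. coeff [:\<iota> c:] i \<in> S" using d(3) S.zero_mem by (simp add: coeff_pCons split: nat.splits)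
    then show "\<iota> c \<in> ?T" by (auto intro!: exI[of _ "[:\<iota> c:]"])
    show "\<rho>' (\<iota> c) = to_ac c" using \<rho>'[OF C] by (simp add: Polynomial.map_poly_pCons rr(1) d(4))
  next
    fix u v assume "u \<in> ?T" "v \<in> ?T"
    then obtain p q where pq: "\<forall>i. coeff p i \<in> S" "\<forall>i. coeff q i \<in> S" "u = poly p \<alpha>" "v = poly q \<alpha>" by blast
    have S: "\<forall>i. coeff (p + q) i \<in> S" "\<forall>i. coeff (p * q) i \<in> S" using SP.add_mem[of p q] SP.mult_mem[of p q] pq by blast+
    show "\<rho>' (u + v) = \<rho>' u + \<rho>' v" "\<rho>' (u * v) = \<rho>' u * \<rho>' v"
      using \<rho>'[OF S(1)] \<rho>'[OF S(2)] by (simp_all add: pq \<rho>' rp)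
  next
    fix u assume "u \<in> ?T"
    then obtain q where q: "\<forall>i. coeff q i \<in> S" "u = poly q \<alpha>" by blast
    show "\<rho>' u = 0 \<longleftrightarrow> u \<in> P"
    proof
      assume "u \<in> P"
      then show "\<rho>' u = 0" using vanish[of q] q by (simp add: \<rho>')
    next
      assume 0: "\<rho>' u = 0"
      show "u \<in> P"
      proof (rule ccontr)
        assume "u \<notin> P"
        then obtain h where h: "\<forall>i. coeff h i \<in> S" "u * poly h \<alpha> - 1 \<in> P" using inv[OF q(1)] q(2) by blast
        have qh: "\<forall>i. coeff (q * h) i \<in> S" using SP.mult_mem[of q h] q(1) h(1) by blast
        have one: "\<forall>i. coeff 1 i \<in> S" using SP.one_mem by blast
        have "?I (q * h - 1)" using SP.diff_mem[of "q * h" 1] qh one h(2) q(2) by simp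
        from vanish[OF this] have "poly (?m q) \<xi> * poly (?m h) \<xi> = 1"
          unfolding rp(2)[OF qh one] rp(3)[OF q(1) h(1)] by (simp add: rr(2))
        moreover have "poly (?m q) \<xi> = 0" using 0 q(2) \<rho>'[OF q(1)] by simp
        ultimately show False by simp
      qed
    qed
  qed
  then show ?thesis by blast
qed

end

section \<open>Polynomials over k evaluated in K\<close>

context rational_subfield
begin

definition cpoly :: "'K \<Rightarrow> 'k poly \<Rightarrow> 'K" where
  "cpoly z q = poly (map_poly \<iota> q) z"

lemma cpoly_hom: "idom_hom (cpoly z)"
proof -
  interpret map_poly_idom_hom \<iota> ..
  show ?thesis by unfold_locales (simp_all add: cpoly_def hom_distribs)
qed

sublocale cpoly: idom_hom "cpoly z"
  by (rule cpoly_hom)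

lemma cpoly_x: "cpoly x = xpoly"
  by (simp add: cpoly_def xpoly_def fun_eq_iff)

lemma cpoly_pCons: "cpoly z (pCons c q) = \<iota> c + z * cpoly z q"
  by (simp add: cpoly_def Polynomial.map_poly_pCons)

lemma iota_in_kx: "\<iota> c \<in> kx"
  using xpoly_const[of c] by (metis rangeI)

lemma cpoly_mem:
  assumes "unital_subring S" "kx \<subseteq> S" "z \<in> S"
  shows "cpoly z q \<in> S"
proof -
  interpret unital_subring S by fact
  show ?thesis using assms(2,3) iota_in_kx by (induction q) (auto simp: cpoly_pCons zero_mem intro!: add_mem mult_mem)
qed

text \<open>The remainder is kept as an unspecified multiple of \<tau>^2, so no division by 2 occurs
  and the expansion holds in every characteristic.\<close>

lemma cpoly_taylor:
  assumes S: "unital_subring S" "kx \<subseteq> S" "z \<in> S" "\<tau> \<in> S"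
  shows "\<exists>w\<in>S. cpoly (z + \<tau>) q = cpoly z q + \<tau> * cpoly z (pderiv q) + \<tau> ^ 2 * w"
proof -
  interpret unital_subring S by fact
  show ?thesis
  proof (induction q)
    case 0
    then show ?case by (intro bexI[of _ 0]) (simp_all add: zero_mem)
  next
    case (pCons c q)
    then obtain w where w: "w \<in> S" "cpoly (z + \<tau>) q = cpoly z q + \<tau> * cpoly z (pderiv q) + \<tau> ^ 2 * w" by blast
    have "cpoly (z + \<tau>) (pCons c q) = cpoly z (pCons c q) + \<tau> * cpoly z (pderiv (pCons c q))
        + \<tau> ^ 2 * (cpoly z (pderiv q) + (z + \<tau>) * w)"
      unfolding cpoly_pCons pderiv_pCons cpoly.hom_add w(2)
      by (simp add: cpoly_pCons algebra_simps power2_eq_square)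
    moreover have "cpoly z (pderiv q) + (z + \<tau>) * w \<in> S"
      using cpoly_mem[OF S(1-3)] w(1) S(3,4) by (intro add_mem mult_mem)
    ultimately show ?case by blast
  qed
qed

end

section \<open>The residue map on the integral closure and a generator of the residue field\<close>

locale perfect_curve_prime = curve_prime \<iota> x y F P
  for \<iota> :: "'k::field \<Rightarrow> 'K::field" and x y F P +
  assumes perfect: "perfect_of_pos_char TYPE('k)"
begin

lemma iota_in_P_iff: "\<iota> c \<in> P \<longleftrightarrow> c = 0"
proof
  assume c: "\<iota> c \<in> P"
  show "c = 0"
  proof (rule ccontr)
    assume "c \<noteq> 0"
    then have "\<iota> (inverse c) * \<iota> c = 1" by (simp flip: base.hom_mult)
    moreover have "\<iota> (inverse c) * \<iota> c \<in> P"
      using P_mult[OF _ c] iota_in_kx kx_subset_kx_bar by blast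
    ultimately show False using P_one by simp
  qed
qed (simp add: P_zero)

lemma inj_iota: "inj \<iota>"
proof (rule injI)
  fix a b assume "\<iota> a = \<iota> b"
  then have "\<iota> (a - b) = 0" by (simp add: base.hom_minus)
  then show "a = b" using iota_in_P_iff[of "a - b"] P_zero by simp
qed

lemma residue_map_constants: "residue_map (range \<iota>) (\<lambda>z. to_ac (inv_into UNIV \<iota> z))"
  unfolding residue_map_def
proof (intro conjI allI ballI)
  show "unital_subring (range \<iota>)"
  proof
    show "1 \<in> range \<iota>" using base.hom_one by (metis rangeI)
    show "a - b \<in> range \<iota>" "a * b \<in> range \<iota>" if "a \<in> range \<iota>" "b \<in> range \<iota>" for a b
      using that by (auto simp flip: base.hom_minus base.hom_mult)
  qed
  show "range \<iota> \<subseteq> kx_bar" using iota_in_kx kx_subset_kx_bar by blast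
  have inv0: "inv_into UNIV \<iota> 0 = 0" using inv_f_f[OF inj_iota, of 0] by simp
  fix a assume "a \<in> range \<iota>"
  then obtain c where c: "a = \<iota> c" by auto
  show "to_ac (inv_into UNIV \<iota> a) = 0 \<longleftrightarrow> a \<in> P"
    unfolding c by (simp add: inv_f_f[OF inj_iota] iota_in_P_iff)
qed (auto simp: inv_f_f[OF inj_iota] simp flip: base.hom_add base.hom_mult)

lemma residue_map_kx: "\<exists>\<rho>. residue_map kx \<rho>"
proof -
  have "\<exists>q0. q = map_poly \<iota> q0" if "\<forall>i. coeff q i \<in> range \<iota>" for q
  proof -
    have "inv_into UNIV \<iota> 0 = 0" using inv_f_f[OF inj_iota, of 0] by simp
    then have "q = map_poly \<iota> (map_poly (inv_into UNIV \<iota>) q)"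
      using that by (intro poly_eqI) (simp add: coeff_map_poly f_inv_into_f)
    then show ?thesis by blast
  qed
  then have *: "{poly q x |q. \<forall>i. coeff q i \<in> range \<iota>} = kx"
    by (fastforce simp: xpoly_def coeff_map_poly)
  have "\<exists>\<rho>'. residue_map {poly q x |q. \<forall>i. coeff q i \<in> range \<iota>} \<rho>'"
  proof (rule residue_map_extend[OF residue_map_constants])
    show "x \<in> kx_bar" using x_in_kx kx_subset_kx_bar by blast
    have "\<exists>i. coeff (map_poly \<iota> \<pi>) i \<notin> P"
      using pi_nonzero by (simp add: coeff_map_poly iota_in_P_iff poly_eq_iff)
    then show "\<exists>q. (\<forall>i. coeff q i \<in> range \<iota>) \<and> poly q x \<in> P \<and> (\<exists>i. coeff q i \<notin> P)"
      using pi_in_P by (intro exI[of _ "map_poly \<iota> \<pi>"]) (auto simp: xpoly_def coeff_map_poly)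
    fix q assume q: "\<forall>i. coeff q i \<in> range \<iota>" "poly q x \<notin> P"
    then have "poly q x \<in> kx" using * by blast
    then obtain c where c: "poly q x = xpoly c" by auto
    then obtain c' where c': "xpoly c' * xpoly c - 1 \<in> P" using xpoly_inverse_mod_P q(2) by metis
    show "\<exists>h. (\<forall>i. coeff h i \<in> range \<iota>) \<and> poly q x * poly h x - 1 \<in> P"
    proof (intro exI[of _ "map_poly \<iota> c'"] conjI allI)
      show "poly q x * poly (map_poly \<iota> c') x - 1 \<in> P"
        using c' unfolding c xpoly_def[of c'] by (simp only: mult.commute)
    qed (simp add: coeff_map_poly)
  qed
  then show ?thesis unfolding * .
qed

lemma kx_bar_basis:
  obtains g where "\<And>i. i < N \<Longrightarrow> g i \<in> kx_bar" "\<And>u. u \<in> kx_bar \<Longrightarrow> \<exists>a. u = (\<Sum>i<N. xpoly (a i) * g i)"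
proof -
  obtain g where g: "\<And>i. i < N \<Longrightarrow> g i \<in> kx_bar" "\<And>u. u \<in> kx_bar \<Longrightarrow> \<exists>a. u = (\<Sum>i<N. xpoly (a i) * g i)"
  proof (rule integral_lattice_basis[of kx_bar 1])
    show "xpoly a * u \<in> kx_bar" if "u \<in> kx_bar" for a u
      using xpoly_mem that by (rule kx_bar.mult_mem)
  qed (use kx_bar.add_mem A_subset_kx_bar in auto)
  then show thesis by (rule that)
qed

text \<open>Starting from k[x], the basis elements of the integral closure are adjoined one by one.
  Their monic equations over k[x] provide the algebraic relation modulo P.\<close>

lemma residue_map_exists: "\<exists>\<rho>. residue_map kx_bar \<rho>"
proof -
  obtain g where g: "\<And>i. i < N \<Longrightarrow> g i \<in> kx_bar" "\<And>u. u \<in> kx_bar \<Longrightarrow> \<exists>a. u = (\<Sum>i<N. xpoly (a i) * g i)"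
    by (rule kx_bar_basis) (rule that)
  have "\<exists>S \<rho>. residue_map S \<rho> \<and> kx \<subseteq> S \<and> (\<forall>i<n. g i \<in> S)" if "n \<le> N" for n
    using that
  proof (induction n)
    case 0
    then show ?case using residue_map_kx by blast
  next
    case (Suc n)
    then obtain S \<rho> where S: "residue_map S \<rho>" "kx \<subseteq> S" "\<forall>i<n. g i \<in> S" by auto
    interpret S: unital_subring S by (rule residue_mapD(1)[OF S(1)])
    have gn: "g n \<in> kx_bar" using g(1) Suc.prems by simp
    let ?T = "{poly q (g n) |q. \<forall>i. coeff q i \<in> S}"
    have "\<exists>\<rho>'. residue_map ?T \<rho>'"
    proof (rule residue_map_extend[OF S(1) gn])
      obtain q where q: "lead_coeff q = 1" "\<And>i. coeff q i \<in> kx" "poly q (g n) = 0"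
        using gn by (rule integral_closureE) blast
      have "\<exists>i. coeff q i \<notin> P" using q(1) P_one by metis
      then show "\<exists>q. (\<forall>i. coeff q i \<in> S) \<and> poly q (g n) \<in> P \<and> (\<exists>i. coeff q i \<notin> P)"
        using q S(2) P_zero by (intro exI[of _ q]) auto
      fix q assume q: "\<forall>i. coeff q i \<in> S" "poly q (g n) \<notin> P"
      have "poly q (g n) \<in> kx_bar"
        using q(1) residue_mapD(2)[OF S(1)] by (intro kx_bar.poly_mem gn) blast
      then obtain p where p: "\<And>i. coeff p i \<in> kx" "poly q (g n) * poly p (poly q (g n)) - 1 \<in> P"
        using inverse_mod_P[of "poly q (g n)"] q(2) by blast
      \<comment> \<open>The inverse of q(g_n) modulo P is p(q(g_n)) with p over k[x]; hence it is
        the value at g_n of the composition, whose coefficients stay in S.\<close>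
      have "pcompose p q \<in> {q. \<forall>i. coeff q i \<in> S}"
      proof -
        interpret SP: unital_subring "{q. \<forall>i. coeff q i \<in> S}" by (rule S.unital_subring_poly)
        show ?thesis
          unfolding pcompose_altdef
        proof (rule SP.poly_mem)
          show "coeff (map_poly (\<lambda>x. [:x:]) p) i \<in> {q. \<forall>i. coeff q i \<in> S}" for i
            using p(1)[of i] S(2) S.zero_mem by (auto simp: coeff_map_poly coeff_pCons split: nat.splits)
        qed (use q(1) in simp)
      qed
      then show "\<exists>h. (\<forall>i. coeff h i \<in> S) \<and> poly q (g n) * poly h (g n) - 1 \<in> P"
        using p(2) by (intro exI[of _ "pcompose p q"]) (simp add: poly_pcompose)
    qed
    then obtain \<rho>' where r': "residue_map ?T \<rho>'" by blast
    have ST: "S \<subseteq> ?T"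
    proof
      fix s assume "s \<in> S"
      then show "s \<in> ?T" using S.zero_mem by (auto intro!: exI[of _ "[:s:]"] simp: coeff_pCons split: nat.splits)
    qed
    moreover have "g n \<in> ?T"
      using S.zero_mem S.one_mem by (auto intro!: exI[of _ "[:0, 1:]"] simp: coeff_pCons split: nat.splits)
    ultimately have "\<forall>i<Suc n. g i \<in> ?T" using S(3) by (auto simp: less_Suc_eq)
    then show ?case using r' ST S(2) by blast
  qed
  from this[OF order.refl] obtain S \<rho> where S: "residue_map S \<rho>" "kx \<subseteq> S" "\<forall>i<N. g i \<in> S" by blast
  interpret S: unital_subring S by (rule residue_mapD(1)[OF S(1)])
  have "kx_bar \<subseteq> S"
  proof
    fix u assume "u \<in> kx_bar"
    from g(2)[OF this] obtain a where a: "u = (\<Sum>i<N. xpoly (a i) * g i)" by (elim exE)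
    show "u \<in> S" unfolding a using S(2,3) by (auto intro!: S.sum_mem S.mult_mem)
  qed
  then have "S = kx_bar" using residue_mapD(2)[OF S(1)] by blast
  then show ?thesis using S(1) by blast
qed

lemma residue_map_cpoly:
  assumes r: "residue_map kx_bar \<rho>" and z: "z \<in> kx_bar"
  shows "\<rho> (cpoly z q) = ac_eval (\<rho> z) q"
proof (induction q)
  case 0
  then show ?case using residue_map_rules(1)[OF r] by simp
next
  case (pCons c q)
  have "cpoly z q \<in> kx_bar" by (rule cpoly_mem[OF kx_bar.unital_subring_axioms kx_subset_kx_bar z])
  then have "\<rho> (cpoly z (pCons c q)) = to_ac c + \<rho> z * \<rho> (cpoly z q)"
    using residue_mapD[OF r] z kx_bar.mult_mem by (simp add: cpoly_pCons)
  then show ?case using pCons.IH by (simp add: ac_eval_def Polynomial.map_poly_pCons)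
qed

lemma residue_image_subset:
  assumes r: "residue_map kx_bar \<rho>" and L: "unital_subring L" "range to_ac \<subseteq> L" "\<rho> x \<in> L"
    and g: "\<And>i. i < N \<Longrightarrow> g i \<in> kx_bar" "\<And>u. u \<in> kx_bar \<Longrightarrow> \<exists>a. u = (\<Sum>i<N. xpoly (a i) * g i)"
    and gL: "\<And>i. i < N \<Longrightarrow> \<rho> (g i) \<in> L"
  shows "\<rho> ` kx_bar \<subseteq> L"
proof
  interpret L: unital_subring L by fact
  have xk: "x \<in> kx_bar" using x_in_kx kx_subset_kx_bar by blast
  fix w assume "w \<in> \<rho> ` kx_bar"
  then obtain u where u: "u \<in> kx_bar" "w = \<rho> u" by blast
  from g(2)[OF u(1)] obtain a where a: "u = (\<Sum>i<N. xpoly (a i) * g i)" by (elim exE)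
  have "\<rho> u = (\<Sum>i<N. \<rho> (xpoly (a i) * g i))"
    unfolding a by (rule residue_map_rules(5)[OF r], rule kx_bar.mult_mem[OF xpoly_mem g(1)]) simp
  also have "\<dots> = (\<Sum>i<N. \<rho> (xpoly (a i)) * \<rho> (g i))"
    by (rule sum.cong) (simp_all add: residue_mapD(6)[OF r xpoly_mem g(1)])
  also have "\<dots> \<in> L"
  proof (rule L.sum_mem, rule L.mult_mem)
    fix i assume "i \<in> {..<N}"
    then show "\<rho> (g i) \<in> L" using gL by simp
    have "\<rho> (xpoly (a i)) = ac_eval (\<rho> x) (a i)"
      using residue_map_cpoly[OF r xk, of "a i"] by (simp add: cpoly_x)
    then show "\<rho> (xpoly (a i)) \<in> L" using range_ac_eval_subset[OF L] by auto
  qed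
  finally show "w \<in> L" using u(2) by simp
qed

text \<open>The residue field is generated over k by the images of x and of a k[x]-basis. For
  infinite k they are absorbed one at a time by \<open>primitive_element_pair\<close>; for finite k
  the residue field is finite and a generator of its multiplicative group is taken.\<close>

lemma residue_generator_exists:
  assumes r: "residue_map kx_bar \<rho>"
  shows "\<exists>\<theta>\<in>kx_bar - P. \<rho> ` kx_bar \<subseteq> range (ac_eval (\<rho> \<theta>))"
proof -
  note d = residue_mapD[OF r]
  obtain g where g: "\<And>i. i < N \<Longrightarrow> g i \<in> kx_bar" "\<And>u. u \<in> kx_bar \<Longrightarrow> \<exists>a. u = (\<Sum>i<N. xpoly (a i) * g i)"
    by (rule kx_bar_basis) (rule that)
  have xk: "x \<in> kx_bar" using x_in_kx kx_subset_kx_bar by blast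
  have ac: "range to_ac \<subseteq> range (ac_eval \<alpha>)" for \<alpha> :: "'k alg_closure"
    using to_ac_in_range_ac_eval by blast
  have "\<exists>\<theta>\<in>kx_bar. \<rho> ` kx_bar \<subseteq> range (ac_eval (\<rho> \<theta>))"
  proof (cases "finite (UNIV :: 'k set)")
    case False
    have "\<exists>\<theta>\<in>kx_bar. \<rho> x \<in> range (ac_eval (\<rho> \<theta>)) \<and> (\<forall>i<n. \<rho> (g i) \<in> range (ac_eval (\<rho> \<theta>)))"
      if "n \<le> N" for n
      using that
    proof (induction n)
      case 0
      show ?case using xk self_in_range_ac_eval by (intro bexI[of _ x] conjI) simp_all
    next
      case (Suc n)
      have "n \<le> N" using Suc.prems by simp
      from Suc.IH[OF this] obtain \<theta> where \<theta>: "\<theta> \<in> kx_bar" "\<rho> x \<in> range (ac_eval (\<rho> \<theta>))"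
        "\<forall>i<n. \<rho> (g i) \<in> range (ac_eval (\<rho> \<theta>))" by (elim bexE conjE)
      obtain c where c: "\<rho> (g n) \<in> range (ac_eval (\<rho> \<theta> + to_ac c * \<rho> (g n)))"
        by (rule primitive_element_pair[OF perfect False]) (rule that)
      define \<theta>' where "\<theta>' = \<theta> + \<iota> c * g n"
      have gn: "g n \<in> kx_bar" using g(1) Suc.prems by simp
      have \<theta>': "\<theta>' \<in> kx_bar" unfolding \<theta>'_def by (intro kx_bar.add_mem kx_bar.mult_mem \<theta>(1) d(3) gn)
      have \<rho>\<theta>': "\<rho> \<theta>' = \<rho> \<theta> + to_ac c * \<rho> (g n)"
        unfolding \<theta>'_def using d(5)[OF \<theta>(1) kx_bar.mult_mem[OF d(3) gn]] d(6)[OF d(3) gn] d(4) by simp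
      interpret L: unital_subring "range (ac_eval (\<rho> \<theta>'))" by (rule unital_subring_range_ac_eval)
      have gL: "\<rho> (g n) \<in> range (ac_eval (\<rho> \<theta>'))" using c unfolding \<rho>\<theta>' .
      have "\<rho> \<theta>' - to_ac c * \<rho> (g n) \<in> range (ac_eval (\<rho> \<theta>'))"
        by (intro L.diff_mem L.mult_mem gL self_in_range_ac_eval to_ac_in_range_ac_eval)
      then have "\<rho> \<theta> \<in> range (ac_eval (\<rho> \<theta>'))" unfolding \<rho>\<theta>' by simp
      then have sub: "range (ac_eval (\<rho> \<theta>)) \<subseteq> range (ac_eval (\<rho> \<theta>'))"
        by (rule range_ac_eval_subset[OF L.unital_subring_axioms ac])
      have "\<rho> (g i) \<in> range (ac_eval (\<rho> \<theta>'))" if "i < Suc n" for i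
      proof (cases "i = n")
        case False
        then have "\<rho> (g i) \<in> range (ac_eval (\<rho> \<theta>))" using \<theta>(3) that by (metis less_SucE)
        then show ?thesis by (rule subsetD[OF sub])
      qed (simp only: gL)
      then show ?case using subsetD[OF sub \<theta>(2)] \<theta>' by (intro bexI[of _ \<theta>'] conjI allI impI)
    qed
    from this[OF order.refl] obtain \<theta> where \<theta>: "\<theta> \<in> kx_bar" "\<rho> x \<in> range (ac_eval (\<rho> \<theta>))"
        "\<forall>i<N. \<rho> (g i) \<in> range (ac_eval (\<rho> \<theta>))" by (elim bexE conjE)
    have \<theta>3: "\<rho> (g i) \<in> range (ac_eval (\<rho> \<theta>))" if "i < N" for i using \<theta>(3) that by simp
    show ?thesis
      by (rule bexI[OF _ \<theta>(1)]) (rule residue_image_subset[OF r unital_subring_range_ac_eval ac \<theta>(2) g \<theta>3])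
  next
    case True
    let ?L = "\<rho> ` kx_bar"
    have "?L \<subseteq> (\<lambda>c. \<Sum>i<N. c i * \<rho> (g i)) ` (PiE {..<N} (\<lambda>_. range (ac_eval (\<rho> x))))"
    proof
      fix w assume "w \<in> ?L"
      then obtain u where u: "u \<in> kx_bar" "w = \<rho> u" by blast
      from g(2)[OF u(1)] obtain a where a: "u = (\<Sum>i<N. xpoly (a i) * g i)" by (elim exE)
      have "\<rho> u = (\<Sum>i<N. \<rho> (xpoly (a i) * g i))"
        unfolding a by (rule residue_map_rules(5)[OF r], rule kx_bar.mult_mem[OF xpoly_mem g(1)]) simp
      also have "\<dots> = (\<Sum>i<N. restrict (\<lambda>i. ac_eval (\<rho> x) (a i)) {..<N} i * \<rho> (g i))"
        using residue_map_cpoly[OF r xk]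
        by (intro sum.cong) (simp_all add: d(6)[OF xpoly_mem g(1)] cpoly_x)
      finally show "w \<in> (\<lambda>c. \<Sum>i<N. c i * \<rho> (g i)) ` (PiE {..<N} (\<lambda>_. range (ac_eval (\<rho> x))))"
        unfolding u(2) by (rule image_eqI[where x = "restrict (\<lambda>i. ac_eval (\<rho> x) (a i)) {..<N}"]) auto
    qed
    moreover have "finite ((\<lambda>c. \<Sum>i<N. c i * \<rho> (g i)) ` (PiE {..<N} (\<lambda>_. range (ac_eval (\<rho> x)))))"
      by (rule finite_imageI, rule finite_PiE[OF finite_lessThan finite_range_ac_eval[OF True]])
    ultimately have finL: "finite ?L" by (rule finite_subset)
    have "unital_subring ?L"
    proof
      show "1 \<in> ?L" using residue_map_rules(2)[OF r] kx_bar.one_mem by (metis imageI)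
      fix u v assume "u \<in> ?L" "v \<in> ?L"
      then obtain a b where ab: "a \<in> kx_bar" "b \<in> kx_bar" "u = \<rho> a" "v = \<rho> b" by blast
      show "u - v \<in> ?L"
        using residue_map_rules(4)[OF r ab(1,2)] ab(3,4) kx_bar.diff_mem[OF ab(1,2)] by (intro image_eqI) simp_all
      show "u * v \<in> ?L"
        using d(6)[OF ab(1,2)] ab(3,4) kx_bar.mult_mem[OF ab(1,2)] by (intro image_eqI) simp_all
    qed
    then obtain \<theta>' where \<theta>': "\<theta>' \<in> ?L" "\<And>z. z \<in> ?L \<Longrightarrow> z = 0 \<or> (\<exists>n. z = \<theta>' ^ n)"
      by (rule finite_subring_cyclic[OF _ finL]) (rule that)
    then obtain \<theta> where \<theta>: "\<theta> \<in> kx_bar" "\<theta>' = \<rho> \<theta>" by blast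
    interpret L: unital_subring "range (ac_eval (\<rho> \<theta>))" by (rule unital_subring_range_ac_eval)
    have "?L \<subseteq> range (ac_eval (\<rho> \<theta>))"
    proof
      fix z assume "z \<in> ?L"
      then have "z = 0 \<or> (\<exists>n. z = \<theta>' ^ n)" by (rule \<theta>'(2))
      then show "z \<in> range (ac_eval (\<rho> \<theta>))"
      proof (elim disjE exE)
        fix n assume "z = \<theta>' ^ n"
        then show ?thesis unfolding \<theta>(2) by (simp only: L.power_mem[OF self_in_range_ac_eval])
      qed (simp only: L.zero_mem)
    qed
    then show ?thesis by (rule bexI[OF _ \<theta>(1)])
  qed
  then obtain \<theta> where \<theta>: "\<theta> \<in> kx_bar" "\<rho> ` kx_bar \<subseteq> range (ac_eval (\<rho> \<theta>))" by (elim bexE)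
  show ?thesis
  \<comment> \<open>The generator also has to be a unit at P, since it later multiplies the
    relations fed to Nakayama's lemma. If it reduces to 0, the residue field is k and 1 generates it
    as well.\<close>
  proof (cases "\<theta> \<in> P")
    case False
    then have "\<theta> \<in> kx_bar - P" using \<theta>(1) by blast
    with \<theta>(2) show ?thesis by (intro bexI[of _ \<theta>])
  next
    case True
    then have 0: "\<rho> \<theta> = 0" using d(7)[OF \<theta>(1)] by simp
    have "\<rho> \<theta> \<in> range (ac_eval (\<rho> 1))"
      unfolding 0 by (rule unital_subring.zero_mem[OF unital_subring_range_ac_eval])
    then have "range (ac_eval (\<rho> \<theta>)) \<subseteq> range (ac_eval (\<rho> 1))"
      by (rule range_ac_eval_subset[OF unital_subring_range_ac_eval ac])
    with \<theta>(2) have "\<rho> ` kx_bar \<subseteq> range (ac_eval (\<rho> 1))" by (rule subset_trans)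
    moreover have "1 \<in> kx_bar - P" using kx_bar.one_mem P_one by simp
    ultimately show ?thesis by (intro bexI[of _ 1])
  qed
qed

lemma residue_generator:
  obtains \<theta> \<mu> where "\<theta> \<in> kx_bar - P" "\<And>z. z \<in> kx_bar \<Longrightarrow> \<exists>q. z - cpoly \<theta> q \<in> P"
    "irreducible \<mu>" "\<And>q. cpoly \<theta> q \<in> P \<longleftrightarrow> \<mu> dvd q"
proof -
  obtain \<rho> where r: "residue_map kx_bar \<rho>" using residue_map_exists by blast
  obtain \<theta> where \<theta>: "\<theta> \<in> kx_bar - P" "\<rho> ` kx_bar \<subseteq> range (ac_eval (\<rho> \<theta>))"
    using residue_generator_exists[OF r] by blast
  have \<theta>k: "\<theta> \<in> kx_bar" using \<theta>(1) by simp
  have ck: "cpoly \<theta> q \<in> kx_bar" for q by (rule cpoly_mem[OF kx_bar.unital_subring_axioms kx_subset_kx_bar \<theta>k])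
  obtain \<mu> where \<mu>: "irreducible \<mu>" "\<And>q. ac_eval (\<rho> \<theta>) q = 0 \<longleftrightarrow> \<mu> dvd q" using minimal_polynomial by blast
  have 1: "\<exists>q. z - cpoly \<theta> q \<in> P" if z: "z \<in> kx_bar" for z
  proof -
    obtain q where q: "\<rho> z = ac_eval (\<rho> \<theta>) q" using \<theta>(2) z by blast
    have "\<rho> (z - cpoly \<theta> q) = 0"
      using residue_map_rules(4)[OF r z ck] q residue_map_cpoly[OF r \<theta>k] by simp
    then have "z - cpoly \<theta> q \<in> P" using residue_mapD(7)[OF r kx_bar.diff_mem[OF z ck]] by simp
    then show ?thesis by blast
  qed
  have 2: "cpoly \<theta> q \<in> P \<longleftrightarrow> \<mu> dvd q" for q
    using residue_mapD(7)[OF r ck] residue_map_cpoly[OF r \<theta>k] \<mu>(2) by simp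
  show thesis by (rule that[OF \<theta>(1) 1 \<mu>(1) 2])
qed

end

section \<open>A generator of the integral closure near P\<close>

context perfect_curve_prime
begin

lemma mu_derivative_not_in_P:
  assumes "irreducible \<mu>" "\<And>q. cpoly \<theta> q \<in> P \<longleftrightarrow> \<mu> dvd q"
  shows "cpoly \<theta> (pderiv \<mu>) \<notin> P"
  using perfect_irreducible_separable[OF perfect assms(1)] assms(2) by simp

lemma cpoly_kx_bar: "z \<in> kx_bar \<Longrightarrow> cpoly z q \<in> kx_bar"
  by (rule cpoly_mem[OF kx_bar.unital_subring_axioms kx_subset_kx_bar])

lemma cpoly_cong_P:
  assumes "z \<in> kx_bar" "\<tau> \<in> P"
  shows "cpoly (z + \<tau>) q - cpoly z q \<in> P"
proof -
  obtain w where w: "w \<in> kx_bar" "cpoly (z + \<tau>) q = cpoly z q + \<tau> * cpoly z (pderiv q) + \<tau> ^ 2 * w"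
    using cpoly_taylor[OF kx_bar.unital_subring_axioms kx_subset_kx_bar assms(1) P_mem[OF assms(2)]] by blast
  have "cpoly (z + \<tau>) q - cpoly z q = (cpoly z (pderiv q) + \<tau> * w) * \<tau>"
    unfolding w(2) by (simp add: algebra_simps power2_eq_square)
  also have "\<dots> \<in> P"
    by (rule P_mult[OF kx_bar.add_mem[OF cpoly_kx_bar[OF assms(1)] kx_bar.mult_mem[OF P_mem[OF assms(2)] w(1)]] assms(2)])
  finally show ?thesis .
qed

text \<open>The generator \<theta> is changed twice modulo P. The change from \<theta> to z makes
  the value of \<mu> a uniformizer, the change from z to b makes b u^m divisible by \<pi> for all u
  in P. The latter property says that b lies in every prime above \<pi> other than P.\<close>

lemma generator_with_uniformizer:
  obtains b \<mu> where "b \<in> kx_bar - P" "\<And>z. z \<in> kx_bar \<Longrightarrow> \<exists>q. z - cpoly b q \<in> P"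
    "irreducible \<mu>" "\<And>q. cpoly b q \<in> P \<longleftrightarrow> \<mu> dvd q"
    "\<exists>s\<in>kx_bar - P. \<forall>u\<in>P. \<exists>w\<in>kx_bar. s * u = cpoly b \<mu> * w"
    "\<exists>m. \<forall>u\<in>P. \<exists>w\<in>kx_bar. b * u ^ m = xpoly \<pi> * w"
proof -
  note K = kx_bar.unital_subring_axioms kx_subset_kx_bar
  obtain \<theta> \<mu> where \<theta>: "\<theta> \<in> kx_bar - P" "\<And>z. z \<in> kx_bar \<Longrightarrow> \<exists>q. z - cpoly \<theta> q \<in> P"
    and \<mu>: "irreducible \<mu>" "\<And>q. cpoly \<theta> q \<in> P \<longleftrightarrow> \<mu> dvd q"
    by (rule residue_generator) (rule that)
  have \<theta>k: "\<theta> \<in> kx_bar" using \<theta>(1) by simp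
  obtain t s where t: "t \<in> P" and s: "s \<in> kx_bar - P" and st: "\<And>u. u \<in> P \<Longrightarrow> \<exists>w\<in>kx_bar. s * u = t * w"
    by (rule uniformizer) (rule that)
  have sk: "s \<in> kx_bar" and tk: "t \<in> kx_bar" using s P_mem[OF t] by simp_all
  obtain e m w0 where e: "e \<in> kx_bar - P" "w0 \<in> kx_bar" "e * t ^ m = xpoly \<pi> * w0"
    by (rule power_in_pi_multiples[OF t]) (rule that)
  \<comment> \<open>If \<mu>(\<theta>) vanishes to higher order, \<theta> + t works: the Taylor term
    t \<mu>'(\<theta>) is a uniformizer, because \<mu>'(\<theta>) is not in P.\<close>
  have "\<exists>z\<in>kx_bar. \<exists>r\<in>kx_bar - P. z - \<theta> \<in> P \<and> s * cpoly z \<mu> = t * r"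
  proof -
    obtain r where r: "r \<in> kx_bar" "s * cpoly \<theta> \<mu> = t * r" using st \<mu>(2)[of \<mu>] by auto
    show ?thesis
    proof (cases "r \<in> P")
      case False
      then show ?thesis using r \<theta>k P_zero by (intro bexI[of _ \<theta>] bexI[of _ r]) auto
    next
      case True
      obtain w where w: "w \<in> kx_bar" "cpoly (\<theta> + t) \<mu> = cpoly \<theta> \<mu> + t * cpoly \<theta> (pderiv \<mu>) + t ^ 2 * w"
        using cpoly_taylor[OF K \<theta>k tk] by blast
      have d: "s * cpoly \<theta> (pderiv \<mu>) \<in> kx_bar - P"
        using mu_derivative_not_in_P[OF \<mu>] cpoly_kx_bar[OF \<theta>k] s by (intro not_P_mult) simp_all
      have "s * (w * t) \<in> P" by (rule P_mult[OF sk P_mult[OF w(1) t]])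
      then have n: "s * cpoly \<theta> (pderiv \<mu>) + (r + s * (w * t)) \<in> kx_bar - P"
        by (intro not_P_add d P_add True)
      have "s * cpoly (\<theta> + t) \<mu> = s * cpoly \<theta> \<mu> + t * (s * cpoly \<theta> (pderiv \<mu>)) + t * (s * (w * t))"
        unfolding w(2) by (simp add: algebra_simps power2_eq_square)
      also have "\<dots> = t * (s * cpoly \<theta> (pderiv \<mu>) + (r + s * (w * t)))"
        unfolding r(2) by (simp add: algebra_simps)
      finally show ?thesis
        using n t \<theta>k tk by (intro bexI[of _ "\<theta> + t"] bexI[OF _ n]) (simp_all add: kx_bar.add_mem)
    qed
  qed
  then obtain z r where z: "z \<in> kx_bar" "z - \<theta> \<in> P" "r \<in> kx_bar - P" "s * cpoly z \<mu> = t * r" by blast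
  \<comment> \<open>s^m u^m is t^m times an integral factor, and e t^m is a multiple of \<pi>; so e'
    handles all u in P with one exponent m.\<close>
  define e' where "e' = s ^ m * e"
  have e': "e' \<in> kx_bar - P" unfolding e'_def by (intro not_P_mult not_P_power s e(1))
  have e'm: "\<exists>w\<in>kx_bar. e' * u ^ m = xpoly \<pi> * w" if u: "u \<in> P" for u
  proof -
    obtain w where w: "w \<in> kx_bar" "s * u = t * w" using st[OF u] by blast
    have "e' * u ^ m = e * (s * u) ^ m" by (simp add: e'_def power_mult_distrib mult_ac)
    also have "\<dots> = (e * t ^ m) * w ^ m" unfolding w(2) by (simp add: power_mult_distrib mult_ac)
    also have "\<dots> = xpoly \<pi> * (w0 * w ^ m)" unfolding e(3) by (simp add: mult_ac)
    finally show ?thesis using kx_bar.mult_mem[OF e(2) kx_bar.power_mem[OF w(1)]] by blast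
  qed
  obtain v where v: "v \<in> kx_bar" "v * e' - 1 \<in> P" by (rule inverse_mod_P'[OF e']) (rule that)
  define p where "p = 1 - v * e'"
  have p: "p \<in> P" using P_uminus[OF v(2)] by (simp add: p_def)
  have pk: "p \<in> kx_bar" by (rule P_mem[OF p])
  \<comment> \<open>Then b = z (1 - p^2) = z (1 - p) (1 + p), which is divisible by e' because 1 - p
    = v e'. The square keeps the change of second order at P, so the value of \<mu> remains a
    uniformizer.\<close>
  define \<delta> where "\<delta> = - (z * p) * p"
  have zp: "- (z * p) \<in> kx_bar" by (rule kx_bar.uminus_mem[OF kx_bar.mult_mem[OF z(1) pk]])
  have \<delta>: "\<delta> \<in> P" unfolding \<delta>_def by (rule P_mult[OF zp p])
  define b where "b = z + \<delta>"
  have be: "b = e' * (v * (1 + p) * z)"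
  proof -
    have "b = z * (1 - p) * (1 + p)" by (simp add: b_def \<delta>_def algebra_simps)
    then show ?thesis by (simp add: p_def mult_ac)
  qed
  have b\<theta>: "b - \<theta> \<in> P" using P_add[OF z(2) \<delta>] by (simp add: b_def algebra_simps)
  have bP: "b \<in> kx_bar - P" using not_P_add[OF \<theta>(1) b\<theta>] by simp
  then have bk: "b \<in> kx_bar" by simp
  have cb: "cpoly b q - cpoly \<theta> q \<in> P" for q using cpoly_cong_P[OF \<theta>k b\<theta>] by simp
  have 2: "\<exists>q. u - cpoly b q \<in> P" if "u \<in> kx_bar" for u
  proof -
    obtain q where "u - cpoly \<theta> q \<in> P" using \<theta>(2) \<open>u \<in> kx_bar\<close> by blast
    from P_diff[OF this cb[of q]] show ?thesis by (intro exI[of _ q]) simp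
  qed
  have 3: "cpoly b q \<in> P \<longleftrightarrow> \<mu> dvd q" for q
    using P_diff[OF _ cb, of "cpoly b q" q] P_add[OF _ cb, of "cpoly \<theta> q" q] \<mu>(2)[of q] by auto
  have 4: "\<exists>s\<in>kx_bar - P. \<forall>u\<in>P. \<exists>w\<in>kx_bar. s * u = cpoly b \<mu> * w"
  proof -
    obtain w where w: "w \<in> kx_bar" "cpoly b \<mu> = cpoly z \<mu> + \<delta> * cpoly z (pderiv \<mu>) + \<delta> ^ 2 * w"
      using cpoly_taylor[OF K z(1) P_mem[OF \<delta>]] unfolding b_def by blast
    obtain w1 where w1: "w1 \<in> kx_bar" "s * p = t * w1" using st[OF p] by blast
    define h where "h = - z * w1 * w1 * (cpoly z (pderiv \<mu>) + \<delta> * w)"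
    have hk: "h \<in> kx_bar" unfolding h_def
      by (intro kx_bar.mult_mem kx_bar.add_mem kx_bar.uminus_mem z(1) w1(1) cpoly_kx_bar P_mem[OF \<delta>] w(1))
    \<comment> \<open>Up to s^2 the correction \<delta> is a multiple of t^2; hence s^2 \<mu>(b) is
      t times s r plus an element of P, a unit at P.\<close>
    have s\<delta>: "s ^ 2 * \<delta> = - z * (t * w1) * (t * w1)"
      unfolding w1(2)[symmetric] by (simp add: \<delta>_def power2_eq_square mult_ac)
    have "s ^ 2 * cpoly b \<mu> = s * (s * cpoly z \<mu>) + (s ^ 2 * \<delta>) * (cpoly z (pderiv \<mu>) + \<delta> * w)"
      unfolding w(2) by (simp add: algebra_simps power2_eq_square)
    also have "\<dots> = t * (s * r + h * t)"
      unfolding s\<delta> z(4) h_def by (simp add: algebra_simps)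
    finally have eq: "s ^ 2 * cpoly b \<mu> = t * (s * r + h * t)" .
    have r': "s * r + h * t \<in> kx_bar - P" by (rule not_P_add[OF not_P_mult[OF s z(3)] P_mult[OF hk t]])
    show ?thesis
    proof (rule bexI[of _ "(s * r + h * t) * s"], rule ballI)
      show "(s * r + h * t) * s \<in> kx_bar - P" by (rule not_P_mult[OF r' s])
      fix u assume "u \<in> P"
      from st[OF this] obtain w2 where w2: "w2 \<in> kx_bar" "s * u = t * w2" by blast
      have "(s * r + h * t) * s * u = (t * (s * r + h * t)) * w2"
        unfolding mult.assoc w2(2) by (simp only: mult_ac)
      also have "\<dots> = cpoly b \<mu> * (s ^ 2 * w2)" unfolding eq[symmetric] by (simp only: mult_ac)
      finally show "\<exists>w\<in>kx_bar. (s * r + h * t) * s * u = cpoly b \<mu> * w"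
        using kx_bar.mult_mem[OF kx_bar.power_mem[OF sk] w2(1)] by blast
    qed
  qed
  have 5: "\<exists>m. \<forall>u\<in>P. \<exists>w\<in>kx_bar. b * u ^ m = xpoly \<pi> * w"
  proof (intro exI[of _ m] ballI)
    fix u assume "u \<in> P"
    from e'm[OF this] obtain w where w: "w \<in> kx_bar" "e' * u ^ m = xpoly \<pi> * w" by blast
    have "b * u ^ m = (e' * u ^ m) * (v * (1 + p) * z)" unfolding be by (simp only: mult_ac)
    also have "\<dots> = xpoly \<pi> * (w * (v * (1 + p) * z))" unfolding w(2) by (simp only: mult_ac)
    finally show "\<exists>w\<in>kx_bar. b * u ^ m = xpoly \<pi> * w"
      using w(1) v(1) z(1) pk by (metis kx_bar.mult_mem kx_bar.add_mem kx_bar.one_mem)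
  qed
  show thesis by (rule that[OF bP 2 \<mu>(1) 3 4 5])
qed

text \<open>Nakayama's lemma over k[x,b] and the prime P \<inter> k[x,b]: modulo \<mu>(b) and \<pi>,
  the product of b with any integral element is congruent to an element of k[x,b]. The multiplier
  \<sigma> then witnesses that k[x,b] and the integral closure agree near P.\<close>

lemma local_generator:
  obtains b \<mu> \<sigma> where "b \<in> kx_bar" "irreducible \<mu>" "\<And>q. cpoly b q \<in> P \<longleftrightarrow> \<mu> dvd q"
    "\<And>z. z \<in> kx_bar \<Longrightarrow> \<exists>q. z - cpoly b q \<in> P"
    "\<exists>s\<in>kx_bar - P. \<forall>u\<in>P. \<exists>w\<in>kx_bar. s * u = cpoly b \<mu> * w"
    "\<sigma> \<in> coord_ring \<iota> x b" "\<sigma> \<notin> P" "\<And>z. z \<in> kx_bar \<Longrightarrow> \<sigma> * z \<in> coord_ring \<iota> x b"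
proof -
  obtain b \<mu> where b: "b \<in> kx_bar - P" "\<And>z. z \<in> kx_bar \<Longrightarrow> \<exists>q. z - cpoly b q \<in> P"
    and \<mu>: "irreducible \<mu>" "\<And>q. cpoly b q \<in> P \<longleftrightarrow> \<mu> dvd q"
    and u: "\<exists>s\<in>kx_bar - P. \<forall>u\<in>P. \<exists>w\<in>kx_bar. s * u = cpoly b \<mu> * w"
    and m: "\<exists>m. \<forall>u\<in>P. \<exists>w\<in>kx_bar. b * u ^ m = xpoly \<pi> * w"
    by (rule generator_with_uniformizer) (rule that)
  let ?B = "coord_ring \<iota> x b"
  let ?\<tau> = "cpoly b \<mu>" and ?p = "xpoly \<pi>"
  have bk: "b \<in> kx_bar" using b(1) by simp
  interpret B: field_subring ?B by (rule field_subring_coord_ring)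
  have bB: "b \<in> ?B" by (rule gen_in_coord_ring)
  have kxB: "kx \<subseteq> ?B" by (rule kx_subset_coord_ring)
  have Bk: "?B \<subseteq> kx_bar" by (rule coord_ring_subset[OF kx_bar.unital_subring_axioms kx_subset_kx_bar bk])
  have cB: "cpoly b q \<in> ?B" for q by (rule cpoly_mem[OF B.unital_subring_axioms kxB bB])
  have \<tau>P: "?\<tau> \<in> P" using \<mu>(2) by simp
  obtain s where s: "s \<in> kx_bar - P" "\<And>u. u \<in> P \<Longrightarrow> \<exists>w\<in>kx_bar. s * u = ?\<tau> * w" using u by blast
  obtain m where m: "\<And>u. u \<in> P \<Longrightarrow> \<exists>w\<in>kx_bar. b * u ^ m = ?p * w" using m by blast
  \<comment> \<open>z is a polynomial in b up to an element p of P. Near P the latter is a multiple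
    of \<mu>(b); the factor b turns what remains into a multiple of \<pi>.\<close>
  have split: "\<exists>\<beta>\<in>?B. \<exists>w1\<in>kx_bar. \<exists>w2\<in>kx_bar. b * z = \<beta> + ?\<tau> * w1 + ?p * w2" if z: "z \<in> kx_bar" for z
  proof -
    obtain q where q: "z - cpoly b q \<in> P" using b(2)[OF z] by (elim exE)
    define p where "p = z - cpoly b q"
    have pP: "p \<in> P" using q by (simp add: p_def)
    obtain w where w: "w \<in> kx_bar" "s * p = ?\<tau> * w" using s(2)[OF pP] by blast
    obtain v where v: "v \<in> kx_bar" "v * s - 1 \<in> P" by (rule inverse_mod_P'[OF s(1)]) (rule that)
    define p' where "p' = 1 - v * s"
    have p'P: "p' \<in> P" using P_uminus[OF v(2)] by (simp add: p'_def)
    \<comment> \<open>Iterating 1 = v s + p' with s p = \<mu>(b) w pushes the error into ever higher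
      powers of p', until b p'^m is a multiple of \<pi>.\<close>
    have it: "\<exists>c\<in>kx_bar. p = ?\<tau> * c + p' ^ n * p" for n
    proof (induction n)
      case 0
      show ?case using kx_bar.zero_mem by (intro bexI[of _ 0]) simp_all
    next
      case (Suc n)
      then obtain c where c: "c \<in> kx_bar" "p = ?\<tau> * c + p' ^ n * p" by blast
      have "p' ^ n * p = p' ^ n * (v * (s * p) + p' * p)" by (simp add: p'_def algebra_simps)
      also have "\<dots> = ?\<tau> * (p' ^ n * v * w) + p' ^ Suc n * p" unfolding w(2) by (simp add: algebra_simps)
      finally have "?\<tau> * c + p' ^ n * p = ?\<tau> * (c + p' ^ n * v * w) + p' ^ Suc n * p"
        by (simp add: algebra_simps)
      with c(2) have "p = ?\<tau> * (c + p' ^ n * v * w) + p' ^ Suc n * p" by (rule trans)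
      moreover have "c + p' ^ n * v * w \<in> kx_bar"
        by (intro kx_bar.add_mem kx_bar.mult_mem kx_bar.power_mem c(1) v(1) w(1) P_mem[OF p'P])
      ultimately show ?case by blast
    qed
    obtain c where c: "c \<in> kx_bar" "p = ?\<tau> * c + p' ^ m * p" using it by blast
    obtain d where d: "d \<in> kx_bar" "b * p' ^ m = ?p * d" using m[OF p'P] by blast
    have "b * z = b * cpoly b q + b * p" by (simp add: p_def algebra_simps)
    also have "b * p = b * (?\<tau> * c + p' ^ m * p)" by (rule arg_cong[OF c(2)])
    also have "\<dots> = ?\<tau> * (b * c) + (b * p' ^ m) * p" by (simp add: algebra_simps)
    also have "\<dots> = ?\<tau> * (b * c) + ?p * (d * p)" unfolding d(2) by (simp only: mult.assoc)
    finally have "b * z = b * cpoly b q + ?\<tau> * (b * c) + ?p * (d * p)" by (simp only: add.assoc)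
    then show ?thesis
      using B.mult_mem[OF bB cB] kx_bar.mult_mem[OF bk c(1)] kx_bar.mult_mem[OF d(1) P_mem[OF pP]] by blast
  qed
  obtain g where g: "\<And>i. i < N \<Longrightarrow> g i \<in> kx_bar" "\<And>u. u \<in> kx_bar \<Longrightarrow> \<exists>a. u = (\<Sum>i<N. xpoly (a i) * g i)"
    by (rule kx_bar_basis) (rule that)
  \<comment> \<open>The cofactors of \<mu>(b) and \<pi> are only integral, so they are expanded in
    the k[x]-basis g; this puts the coefficients of the system into P \<inter> k[x,b]. The triple
    holds the element of k[x,b] and both coordinate vectors.\<close>
  define good :: "nat \<Rightarrow> 'K \<times> (nat \<Rightarrow> 'k poly) \<times> (nat \<Rightarrow> 'k poly) \<Rightarrow> bool"
    where "good i T \<longleftrightarrow> fst T \<in> ?B \<and> b * g i = fst T +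
      (\<Sum>j<N. (?\<tau> * xpoly (fst (snd T) j) + ?p * xpoly (snd (snd T) j)) * g j)" for i T
  have "\<forall>i\<in>{..<N}. \<exists>T. good i T"
  proof
    fix i assume "i \<in> {..<N}"
    then have "g i \<in> kx_bar" using g(1) by simp
    from split[OF this] obtain \<beta> w1 w2 where w: "\<beta> \<in> ?B" "w1 \<in> kx_bar" "w2 \<in> kx_bar"
      "b * g i = \<beta> + ?\<tau> * w1 + ?p * w2" by blast
    from g(2)[OF w(2)] obtain a where a: "w1 = (\<Sum>j<N. xpoly (a j) * g j)" by (elim exE)
    from g(2)[OF w(3)] obtain c where c: "w2 = (\<Sum>j<N. xpoly (c j) * g j)" by (elim exE)
    have "?\<tau> * w1 + ?p * w2 = (\<Sum>j<N. (?\<tau> * xpoly (a j) + ?p * xpoly (c j)) * g j)"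
      unfolding a c sum_distrib_left by (simp only: sum.distrib[symmetric] distrib_right mult.assoc)
    then have "good i (\<beta>, a, c)" using w(1,4) by (simp add: good_def add.assoc)
    then show "\<exists>T. good i T" by (rule exI)
  qed
  from bchoice[OF this] obtain T where T: "\<forall>i\<in>{..<N}. good i (T i)" by (elim exE)
  define \<beta> where "\<beta> i = fst (T i)" for i
  define q where "q i j = ?\<tau> * xpoly (fst (snd (T i)) j) + ?p * xpoly (snd (snd (T i)) j)" for i j
  have rel: "\<beta> i \<in> ?B" "b * g i = \<beta> i + (\<Sum>j<N. q i j * g j)" if "i < N" for i
  proof -
    have "good i (T i)" using T that by blast
    then show "\<beta> i \<in> ?B" "b * g i = \<beta> i + (\<Sum>j<N. q i j * g j)"
      unfolding good_def \<beta>_def q_def by blast+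
  qed
  have xB: "xpoly a \<in> ?B" for a using kxB by blast
  have "\<exists>\<sigma>\<in>?B - P \<inter> ?B. \<forall>i<N. \<sigma> * g i \<in> ?B"
  proof (rule nakayama_elimination[where s = "\<lambda>_. b" and \<beta> = \<beta> and q = q and n = N])
    show "unital_subring ?B" by (rule B.unital_subring_axioms)
    show "u - v \<in> P \<inter> ?B" if "u \<in> P \<inter> ?B" "v \<in> P \<inter> ?B" for u v
      using that P_diff[of u v] B.diff_mem[of u v] by blast
    show "u * v \<in> P \<inter> ?B" if "u \<in> ?B" "v \<in> P \<inter> ?B" for u v
    proof -
      have "u \<in> kx_bar" using Bk that(1) by blast
      then show ?thesis using that P_mult[of u v] B.mult_mem[of u v] by blast
    qed
    show "u * v \<notin> P \<inter> ?B" if "u \<in> ?B" "v \<in> ?B" "u \<notin> P \<inter> ?B" "v \<notin> P \<inter> ?B" for u v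
    proof -
      have "u \<in> kx_bar" "v \<in> kx_bar" using Bk that(1,2) by blast+
      then show ?thesis using that P_prime[of u v] by blast
    qed
    show "q i j \<in> P \<inter> ?B" for i j
    proof
      show "q i j \<in> ?B" unfolding q_def by (rule B.add_mem[OF B.mult_mem[OF cB xB] B.mult_mem[OF xB xB]])
      have "q i j = xpoly (fst (snd (T i)) j) * ?\<tau> + xpoly (snd (snd (T i)) j) * ?p"
        by (simp add: q_def)
      also have "\<dots> \<in> P"
        by (rule P_add[OF P_mult[OF xpoly_mem \<tau>P] P_mult[OF xpoly_mem pi_in_P]])
      finally show "q i j \<in> P" .
    qed
    show "b \<in> ?B - P \<inter> ?B" using b(1) bB by blast
    show "1 \<notin> P \<inter> ?B" using P_one by blast
  qed (use rel in blast)+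
  then obtain \<sigma> where \<sigma>': "\<sigma> \<in> ?B - P \<inter> ?B" "\<forall>i<N. \<sigma> * g i \<in> ?B" by (elim bexE)
  then have \<sigma>: "\<sigma> \<in> ?B" "\<sigma> \<notin> P" "\<forall>i<N. \<sigma> * g i \<in> ?B" by blast+
  have 8: "\<sigma> * z \<in> ?B" if z: "z \<in> kx_bar" for z
  proof -
    from g(2)[OF z] obtain a where a: "z = (\<Sum>j<N. xpoly (a j) * g j)" by (elim exE)
    have "\<sigma> * z = (\<Sum>j<N. xpoly (a j) * (\<sigma> * g j))"
      unfolding a sum_distrib_left by (simp only: mult_ac)
    also have "\<dots> \<in> ?B" by (rule B.sum_mem, rule B.mult_mem[OF xB]) (use \<sigma>(3) in simp)
    finally show ?thesis .
  qed
  show thesis by (rule that[OF bk \<mu> b(2) u \<sigma>(1,2) 8])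
qed

end

section \<open>Derivations\<close>

abbreviation dX :: "'k::field poly poly \<Rightarrow> 'k poly poly" where
  "dX \<equiv> map_poly pderiv"

lemma dX_add: "dX (P + Q) = dX P + dX Q"
  by (rule poly_eqI) (simp add: coeff_map_poly pderiv_add)

lemma dX_mult: "dX (P * Q) = dX P * Q + P * dX Q"
proof (rule poly_eqI)
  fix n
  have "coeff (dX (P * Q)) n = (\<Sum>i\<le>n. pderiv (coeff P i * coeff Q (n - i)))"
    by (simp add: coeff_map_poly coeff_mult pderiv_sum)
  also have "\<dots> = (\<Sum>i\<le>n. pderiv (coeff P i) * coeff Q (n - i)) + (\<Sum>i\<le>n. coeff P i * pderiv (coeff Q (n - i)))"
    by (simp add: pderiv_mult sum.distrib mult.commute add.commute)
  also have "\<dots> = coeff (dX P * Q + P * dX Q) n"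
    by (simp add: coeff_mult coeff_map_poly)
  finally show "coeff (dX (P * Q)) n = coeff (dX P * Q + P * dX Q) n" .
qed

text \<open>Such a D sends dg to the coefficient of dx in it, so that forms can be handled as
  elements of K. Below it is constructed for x and transported to 1/x.\<close>

locale derivation_d_dx = rational_subfield \<iota> x
  for \<iota> :: "'k::field \<Rightarrow> 'K::field" and x +
  fixes D :: "'K \<Rightarrow> 'K"
  assumes D_add: "D (u + v) = D u + D v"
    and D_mult: "D (u * v) = D u * v + u * D v"
    and D_const: "D (\<iota> c) = 0"
    and D_x: "D x = 1"
begin

lemma D_zero: "D 0 = 0"
  using D_const[of 0] by simp

lemma D_one: "D 1 = 0"
  using D_const[of 1] by simp

lemma D_xpoly: "D (xpoly q) = xpoly (pderiv q)"
proof (induction q)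
  case (pCons c q)
  have e: "xpoly (pCons c r) = \<iota> c + x * xpoly r" for c r
    by (simp add: xpoly_def Polynomial.map_poly_pCons)
  show ?case
    unfolding e pderiv_pCons xpoly.hom_add D_add D_mult D_const D_x pCons.IH by simp
qed (simp add: D_zero)

lemma eval2_pCons: "eval2 \<iota> (pCons a P) x z = xpoly a + z * eval2 \<iota> P x z"
  by (simp add: eval2_xpoly Polynomial.map_poly_pCons)

lemma D_eval2: "D (eval2 \<iota> P x z) = eval2 \<iota> (dX P) x z + eval2 \<iota> (pderiv P) x z * D z"
proof (induction P)
  case 0
  show ?case by (simp add: eval2_def D_zero)
next
  case (pCons a P)
  interpret ev: idom_hom "\<lambda>P. eval2 \<iota> P x z" by (rule eval2_hom)
  show ?case
    unfolding eval2_pCons D_add D_mult D_xpoly pCons.IH pderiv_pCons ev.hom_add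
    by (simp add: Polynomial.map_poly_pCons eval2_pCons algebra_simps)
qed

lemma D_divide:
  assumes "v \<noteq> 0"
  shows "D (u / v) = (D u * v - u * D v) / v ^ 2"
proof -
  have "D u = D (u / v * v)" using assms by simp
  also have "\<dots> = D (u / v) * v + u / v * D v" by (rule D_mult)
  finally show ?thesis using assms by (simp add: field_simps power2_eq_square)
qed

text \<open>The coefficient of dx in the form represented by v.\<close>

definition D_comb :: "('K \<Rightarrow>\<^sub>0 'K) \<Rightarrow> 'K" where
  "D_comb v = (\<Sum>g\<in>Poly_Mapping.keys v. Poly_Mapping.lookup v g * D g)"

text \<open>The functions f for which f dx is regular at a point with local ring R, see
  \<open>regular_at_form_iff\<close>.\<close>

definition D_module :: "'K set \<Rightarrow> 'K set" where
  "D_module R = {D_comb v |v. Poly_Mapping.keys v \<subseteq> R \<and> (\<forall>g. Poly_Mapping.lookup v g \<in> R)}"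

lemma D_comb_single: "D_comb (Poly_Mapping.single g f) = f * D g"
  by (cases "f = 0") (simp_all add: D_comb_def)

lemma D_module_I:
  assumes "0 \<in> R" "f \<in> R" "g \<in> R"
  shows "f * D g \<in> D_module R"
proof -
  have "Poly_Mapping.keys (Poly_Mapping.single g f) \<subseteq> R" using assms by simp
  moreover have "\<forall>h. Poly_Mapping.lookup (Poly_Mapping.single g f) h \<in> R"
    using assms by (simp add: lookup_single when_def)
  ultimately show ?thesis
    unfolding D_module_def D_comb_single[symmetric] by (intro CollectI exI[of _ "Poly_Mapping.single g f"] conjI refl)
qed

lemma D_module_E:
  assumes "f \<in> D_module R" "unital_subring S" "R \<subseteq> S" "\<And>g. g \<in> R \<Longrightarrow> c * D g \<in> S"
  shows "c * f \<in> S"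
proof -
  interpret S: unital_subring S by fact
  obtain v where v: "f = D_comb v" "Poly_Mapping.keys v \<subseteq> R" "\<And>g. Poly_Mapping.lookup v g \<in> R"
    using assms(1) by (auto simp: D_module_def)
  have "c * f = (\<Sum>g\<in>Poly_Mapping.keys v. Poly_Mapping.lookup v g * (c * D g))"
    unfolding v(1) D_comb_def sum_distrib_left by (simp only: mult_ac)
  also have "\<dots> \<in> S"
    by (rule S.sum_mem, rule S.mult_mem) (use v assms(3,4) in auto)
  finally show ?thesis .
qed

lemma D_module_mono: "R \<subseteq> S \<Longrightarrow> D_module R \<subseteq> D_module S"
  unfolding D_module_def by blast

end

section \<open>Elimination of the first variable\<close>

definition T_poly :: "'k::field poly \<Rightarrow> 'k poly poly" where
  "T_poly q = map_poly (\<lambda>c. [:c:]) q"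

text \<open>With T for the outer variable and X for the inner one, this is H(h(T), T): reduction
  modulo X - h(T), which identifies the quotient of k[X,T] with k[T]. \<open>T_poly\<close> is the
  inclusion of k[T] back into k[X,T].\<close>

definition subst_X :: "'k::field poly \<Rightarrow> 'k poly poly \<Rightarrow> 'k poly" where
  "subst_X h H = poly (map_poly (\<lambda>a. pcompose a h) H) [:0, 1:]"

definition X_minus :: "'k::field poly \<Rightarrow> 'k poly poly" where
  "X_minus h = [:[:0, 1:]:] - T_poly h"

interpretation T_poly: idom_hom T_poly
proof -
  interpret c: idom_hom "\<lambda>c::'a. [:c:]" by unfold_locales (simp_all add: one_pCons)
  interpret map_poly_idom_hom "\<lambda>c::'a. [:c:]" ..
  show "idom_hom (T_poly :: 'a poly \<Rightarrow> _)"
    by unfold_locales (simp_all add: T_poly_def hom_distribs)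
qed

interpretation subst_X: idom_hom "subst_X h"
proof -
  interpret map_poly_idom_hom "\<lambda>a. pcompose a h" ..
  show "idom_hom (subst_X h)"
    by unfold_locales (simp_all add: subst_X_def hom_distribs)
qed

lemma T_poly_pCons: "T_poly (pCons c q) = [:[:c:]:] + [:0, 1:] * T_poly q"
  by (simp add: T_poly_def Polynomial.map_poly_pCons)

lemma subst_X_pCons: "subst_X h (pCons a H) = pcompose a h + [:0, 1:] * subst_X h H"
  by (simp add: subst_X_def Polynomial.map_poly_pCons)

lemma subst_X_T_poly: "subst_X h (T_poly q) = q"
proof (induction q)
  case (pCons c q)
  have "subst_X h [:[:c:]:] = [:c:]" "subst_X h [:0, 1:] = [:0, 1:]"
    by (simp_all add: subst_X_pCons one_pCons pcompose_pCons)
  then show ?case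
    unfolding T_poly_pCons subst_X.hom_add subst_X.hom_mult pCons.IH by simp
qed simp

lemma subst_X_X_minus: "subst_X h (X_minus h) = 0"
  by (simp add: X_minus_def subst_X.hom_minus subst_X_T_poly subst_X_pCons pcompose_pCons)

lemma X_minus_nonzero: "X_minus h \<noteq> 0"
proof
  assume "X_minus h = 0"
  then have "coeff (coeff (X_minus h) 0) 1 = 0" by simp
  then show False by (simp add: X_minus_def T_poly_def coeff_map_poly)
qed

lemma X_minus_dvd: "X_minus h dvd H - T_poly (subst_X h H)"
proof (induction H)
  case 0
  then show ?case by simp
next
  case (pCons a H)
  have "X_minus h dvd [:a:] - T_poly (pcompose a h)"
  proof (induction a)
    case 0
    then show ?case by simp
  next
    case (pCons c a)
    have "[:pCons c a:] - T_poly (pcompose (pCons c a) h)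
        = [:[:0, 1:]:] * ([:a:] - T_poly (pcompose a h)) + X_minus h * T_poly (pcompose a h)"
    proof -
      have "[:pCons c a:] = [:[:c:]:] + [:[:0, 1:]:] * [:a:]" by simp
      moreover have "T_poly (pcompose (pCons c a) h) = [:[:c:]:] + T_poly h * T_poly (pcompose a h)"
        by (simp add: pcompose_pCons T_poly.hom_add T_poly.hom_mult T_poly_pCons[of c 0])
      ultimately show ?thesis unfolding X_minus_def by (simp only: algebra_simps)
    qed
    then show ?case using pCons.IH by (simp only: dvd_add dvd_mult dvd_triv_left)
  qed
  moreover have "pCons a H - T_poly (subst_X h (pCons a H))
      = ([:a:] - T_poly (pcompose a h)) + [:0, 1:] * (H - T_poly (subst_X h H))"
  proof -
    have p: "pCons a H = [:a:] + [:0, 1:] * H" by simp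
    have t: "T_poly [:0, 1:] = [:0, 1:]" by (simp add: T_poly_pCons one_pCons)
    show ?thesis
      unfolding subst_X_pCons T_poly.hom_add T_poly.hom_mult t by (subst p) (simp only: algebra_simps)
  qed
  ultimately show ?case using pCons.IH by (simp only: dvd_add dvd_mult)
qed

lemma X_minus_dvd_if: "subst_X h H = 0 \<Longrightarrow> X_minus h dvd H"
  using X_minus_dvd[of h H] by simp

section \<open>Regular forms on an affine curve\<close>

locale perfect_curve_prime_D = perfect_curve_prime \<iota> x y F P + derivation_d_dx \<iota> x D
  for \<iota> :: "'k::field \<Rightarrow> 'K::field" and x y F P D
begin

lemma eval2_T_poly: "eval2 \<iota> (T_poly q) x b = cpoly b q"
  by (induction q) (simp_all add: T_poly_def Polynomial.map_poly_pCons eval2_pCons cpoly_pCons, simp add: eval2_def)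

text \<open>Near \<open>P\<close> the integral closure is \<open>k[x,b]\<close>, whose maximal ideal is generated by \<open>\<mu>(b)\<close>.  Writing
  the equation of \<open>b\<close> as \<open>G = \<alpha> \<mu>(T) + \<beta> (X - h(T))\<close>, the coefficient \<open>\<beta>\<close> does not vanish at \<open>P\<close>,
  because \<open>x - h(b)\<close> is a multiple of \<open>\<mu>(b)\<close>; and \<open>\<beta>\<close> is congruent to the \<open>X\<close>-derivative of \<open>G\<close>.\<close>

lemma dX_not_in_P:
  assumes b: "b \<in> kx_bar" and irr: "irreducible \<mu>" and \<mu>: "\<And>q. cpoly b q \<in> P \<longleftrightarrow> \<mu> dvd q"
    and res: "\<And>z. z \<in> kx_bar \<Longrightarrow> \<exists>q. z - cpoly b q \<in> P"
    and unif: "\<exists>s\<in>kx_bar - P. \<forall>u\<in>P. \<exists>w\<in>kx_bar. s * u = cpoly b \<mu> * w"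
    and \<sigma>: "\<sigma> \<in> kx_bar - P" "\<And>z. z \<in> kx_bar \<Longrightarrow> \<sigma> * z \<in> coord_ring \<iota> x b"
    and G: "plane_curve \<iota> x b G"
  shows "eval2 \<iota> (dX G) x b \<notin> P"
proof -
  interpret G: plane_curve \<iota> x b G by (rule G)
  let ?E = "\<lambda>H. eval2 \<iota> H x b"
  have xk: "x \<in> kx_bar" using x_in_kx kx_subset_kx_bar by blast
  have Ek: "?E H \<in> kx_bar" for H using G.A_subset_kx_bar G.eval2_in_A by blast
  obtain h where h: "x - cpoly b h \<in> P" using res[OF xk] by blast
  have EX: "?E (X_minus h) = x - cpoly b h"
    by (simp add: X_minus_def G.ev.hom_minus eval2_T_poly)
  \<comment> \<open>Modulo P one has x = h(b), so the value of H is that of the polynomial H(h(T),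
    T) at b, and \<mu> generates the relations of b modulo P.\<close>
  have in_P: "?E H \<in> P \<longleftrightarrow> \<mu> dvd subst_X h H" for H
  proof -
    obtain V where V: "H - T_poly (subst_X h H) = X_minus h * V" using X_minus_dvd[of h H] by (elim dvdE)
    have "?E H - cpoly b (subst_X h H) = ?E (H - T_poly (subst_X h H))"
      by (simp only: G.ev.hom_minus eval2_T_poly)
    also have "\<dots> = ?E V * (x - cpoly b h)" unfolding V G.ev.hom_mult EX by (simp only: mult.commute)
    also have "\<dots> \<in> P" by (rule P_mult[OF Ek h])
    finally have d: "?E H - cpoly b (subst_X h H) \<in> P" .
    show ?thesis
      unfolding \<mu>[symmetric] using P_add[OF d, of "cpoly b (subst_X h H)"] P_diff[OF _ d, of "?E H"] by auto
  qed
  obtain s w where s: "s \<in> kx_bar - P" "w \<in> kx_bar" "s * (x - cpoly b h) = cpoly b \<mu> * w"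
    using unif h by blast
  \<comment> \<open>\<sigma> moves s and w into k[x,b]. The relation s (x - h(b)) = \<mu>(b) w thus
    lifts to polynomials up to a multiple of G.\<close>
  obtain S U where S: "\<sigma> * s = ?E S" and U: "\<sigma> * w = ?E U"
    using \<sigma>(2)[of s] \<sigma>(2)[OF s(2)] s(1) by (auto simp: coord_ring_def)
  have SP: "?E S \<notin> P" using not_P_mult[OF \<sigma>(1) s(1)] unfolding S by simp
  have "?E (S * X_minus h - U * T_poly \<mu>) = \<sigma> * (s * (x - cpoly b h) - cpoly b \<mu> * w)"
    unfolding G.ev.hom_minus G.ev.hom_mult EX eval2_T_poly S[symmetric] U[symmetric] by (simp add: algebra_simps)
  then have "?E (S * X_minus h - U * T_poly \<mu>) = 0" unfolding s(3) by simp
  then obtain H where H: "S * X_minus h - U * T_poly \<mu> = G * H"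
    unfolding G.eval2_eq_0_iff by (elim dvdE)
  have "\<mu> dvd subst_X h G" using in_P[of G] G.root P_zero by simp
  then obtain a where a: "subst_X h G = \<mu> * a" by (elim dvdE)
  obtain \<beta> where \<beta>: "G - T_poly (subst_X h G) = X_minus h * \<beta>" using X_minus_dvd[of h G] by (elim dvdE)
  have Geq: "G = T_poly \<mu> * T_poly a + X_minus h * \<beta>"
    using \<beta> unfolding a T_poly.hom_mult by (simp add: algebra_simps)
  have "subst_X h (S * X_minus h - U * T_poly \<mu>) = subst_X h (G * H)" by (simp only: H)
  then have "- (subst_X h U * \<mu>) = \<mu> * a * subst_X h H"
    unfolding subst_X.hom_minus subst_X.hom_mult subst_X_X_minus subst_X_T_poly a by simp
  then have "subst_X h U * \<mu> + \<mu> * a * subst_X h H = 0" by (metis add.right_inverse)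
  then have "\<mu> * (subst_X h U + a * subst_X h H) = 0" by (simp add: algebra_simps)
  moreover have "\<mu> \<noteq> 0" using irr by auto
  ultimately have "subst_X h U + a * subst_X h H = 0" by simp
  then have "subst_X h (U + H * T_poly a) = 0"
    by (simp add: subst_X.hom_add subst_X.hom_mult subst_X_T_poly mult.commute)
  from X_minus_dvd_if[OF this] obtain V where V: "U + H * T_poly a = X_minus h * V" by (elim dvdE)
  have "X_minus h * S = G * H + U * T_poly \<mu>" using H by (simp add: algebra_simps)
  also have "\<dots> = (U + H * T_poly a) * T_poly \<mu> + X_minus h * (\<beta> * H)"
    unfolding Geq by (simp add: algebra_simps)
  also have "\<dots> = X_minus h * (V * T_poly \<mu> + \<beta> * H)" unfolding V by (simp add: algebra_simps)
  \<comment> \<open>Substituting h(T) for X showed U + H a to be divisible by X - h(T); cancelling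
    this factor isolates S. If \<beta> vanished at P, so would S, whose value \<sigma> s is outside
    P.\<close>
  finally have Seq: "S = V * T_poly \<mu> + \<beta> * H" using X_minus_nonzero mult_left_cancel by blast
  have \<beta>P: "?E \<beta> \<notin> P"
  proof
    assume "?E \<beta> \<in> P"
    then have "\<mu> dvd subst_X h \<beta>" by (simp only: in_P)
    then have "\<mu> dvd subst_X h S"
      unfolding Seq subst_X.hom_add subst_X.hom_mult subst_X_T_poly by (intro dvd_add dvd_mult2 dvd_mult dvd_refl)
    then have "?E S \<in> P" by (simp only: in_P)
    with SP show False by blast
  qed
  have dT: "dX (T_poly q) = 0" for q
    by (rule poly_eqI) (simp add: T_poly_def coeff_map_poly)
  have dXm: "dX (X_minus h) = 1"
  proof -
    have "dX (X_minus h + T_poly h) = dX [:[:0, 1:]:]" by (simp add: X_minus_def)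
    then show ?thesis unfolding dX_add dT by (simp add: Polynomial.map_poly_pCons pderiv_pCons one_pCons)
  qed
  have "dX G = T_poly \<mu> * dX (T_poly a) + dX (T_poly \<mu>) * T_poly a + (\<beta> + X_minus h * dX \<beta>)"
    unfolding arg_cong[OF Geq, of dX] dX_add dX_mult dXm by simp
  then have "?E (dX G) = ?E \<beta> + ?E (dX \<beta>) * (x - cpoly b h)"
    unfolding dT by (simp add: G.ev.hom_add G.ev.hom_mult EX mult.commute)
  moreover have "?E \<beta> + ?E (dX \<beta>) * (x - cpoly b h) \<in> kx_bar - P"
    using not_P_add[of "?E \<beta>"] \<beta>P Ek P_mult[OF Ek h] by blast
  ultimately show ?thesis by simp
qed

lemma local_model:
  obtains b G \<sigma> where "separable_plane_curve \<iota> x b G" "eval2 \<iota> (dX G) x b \<notin> P" "b \<in> kx_bar"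
    "\<And>f. eval2 \<iota> (pderiv G) x b * f \<in> conductor (coord_ring \<iota> x b) \<longleftrightarrow> Fy * f \<in> conductor A"
    "\<sigma> \<in> kx_bar - P" "\<And>z. z \<in> kx_bar \<Longrightarrow> \<sigma> * z \<in> coord_ring \<iota> x b"
proof -
  obtain b \<mu> \<sigma> where b: "b \<in> kx_bar" and \<mu>: "irreducible \<mu>" "\<And>q. cpoly b q \<in> P \<longleftrightarrow> \<mu> dvd q"
    and res: "\<And>z. z \<in> kx_bar \<Longrightarrow> \<exists>q. z - cpoly b q \<in> P"
    and unif: "\<exists>s\<in>kx_bar - P. \<forall>u\<in>P. \<exists>w\<in>kx_bar. s * u = cpoly b \<mu> * w"
    and \<sigma>: "\<sigma> \<in> coord_ring \<iota> x b" "\<sigma> \<notin> P" "\<And>z. z \<in> kx_bar \<Longrightarrow> \<sigma> * z \<in> coord_ring \<iota> x b"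
    by (rule local_generator) (rule that)
  have Bk: "coord_ring \<iota> x b \<subseteq> kx_bar"
    by (rule coord_ring_subset[OF kx_bar.unital_subring_axioms kx_subset_kx_bar b])
  have \<sigma>': "\<sigma> \<in> kx_bar - P" using \<sigma>(1,2) Bk by blast
  have frac: "\<exists>U V. eval2 \<iota> V x b \<noteq> 0 \<and> z = eval2 \<iota> U x b / eval2 \<iota> V x b" for z
  proof -
    obtain a c where ac: "a \<in> A" "c \<noteq> 0" "xpoly c * z = a" by (rule quotient_xpoly)
    have "\<sigma> * a \<in> coord_ring \<iota> x b" "\<sigma> * xpoly c \<in> coord_ring \<iota> x b"
      using \<sigma>(3) subsetD[OF A_subset_kx_bar ac(1)] xpoly_mem by blast+
    then obtain U V where UV: "\<sigma> * a = eval2 \<iota> U x b" "\<sigma> * xpoly c = eval2 \<iota> V x b"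
      by (auto simp: coord_ring_def)
    have nz: "\<sigma> * xpoly c \<noteq> 0" using not_P_nonzero[OF \<sigma>'] ac(2) by (simp add: xpoly_eq_0_iff)
    have "z = (\<sigma> * a) / (\<sigma> * xpoly c)" using nz unfolding ac(3)[symmetric] by simp
    then show ?thesis using nz unfolding UV by blast
  qed
  obtain G where G: "separable_plane_curve \<iota> x b G"
    "\<And>f. eval2 \<iota> (pderiv G) x b * f \<in> conductor (coord_ring \<iota> x b) \<longleftrightarrow> Fy * f \<in> conductor A"
    by (rule change_generator[OF b frac]) (rule that)
  have "plane_curve \<iota> x b G" using G(1) by (simp add: separable_plane_curve_def)
  from dX_not_in_P[OF b \<mu> res unif \<sigma>' \<sigma>(3) this] have "eval2 \<iota> (dX G) x b \<notin> P" .
  then show thesis by (rule that[OF G(1) _ b G(2) \<sigma>' \<sigma>(3)])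
qed

text \<open>The relation G_x dx + G_b db = 0 gives f dx = -(G_b f / G_x) db. Here G_b f is integral
  by the conductor condition for b, and G_x is a unit at P.\<close>

lemma regular_if_conductor:
  assumes f: "Fy * f \<in> conductor A"
  shows "f \<in> D_module R"
proof -
  obtain b G \<sigma> where G: "separable_plane_curve \<iota> x b G" "eval2 \<iota> (dX G) x b \<notin> P" "b \<in> kx_bar"
    "\<And>f. eval2 \<iota> (pderiv G) x b * f \<in> conductor (coord_ring \<iota> x b) \<longleftrightarrow> Fy * f \<in> conductor A"
    "\<sigma> \<in> kx_bar - P" "\<And>z. z \<in> kx_bar \<Longrightarrow> \<sigma> * z \<in> coord_ring \<iota> x b"
    by (rule local_model) (rule that)
  interpret G: separable_plane_curve \<iota> x b G by (rule G(1))
  have r: "G.Fy * f \<in> kx_bar"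
  proof -
    have "G.Fy * f \<in> conductor G.A" using f by (simp only: G(4))
    then show ?thesis using G.A_subset_kx_bar unfolding conductor_def by blast
  qed
  let ?Gx = "eval2 \<iota> (dX G) x b"
  have gx: "?Gx \<in> kx_bar - P" using G(2) G.A_subset_kx_bar G.eval2_in_A by blast
  have gx0: "?Gx \<noteq> 0" by (rule not_P_nonzero[OF gx])
  have "?Gx + G.Fy * D b = 0" using D_eval2[of G b] G.root D_zero by simp
  then have gy: "?Gx = - (G.Fy * D b)" by (simp add: eq_neg_iff_add_eq_0)
  have "- (G.Fy * f) / ?Gx * D b = f"
    using gx0 G.Fy_nonzero unfolding gy by (simp add: field_simps)
  moreover have "- (G.Fy * f) / ?Gx * D b \<in> D_module R"
    by (rule D_module_I[OF R.zero_mem R_I[OF kx_bar.uminus_mem[OF r] gx] kx_bar_subset_R[OF G(3)]])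
  ultimately show ?thesis by simp
qed

text \<open>The same relation shows that G_b D u lies in k[x,b] for u in k[x,b], hence G_b D g lies
  in R for g in R by the quotient rule. So G_b f = a/s lies in R, and the denominator is cleared by
  \<sigma> s.\<close>

lemma conductor_if_regular:
  assumes f: "f \<in> D_module R"
  shows "\<exists>s\<in>kx_bar - P. Fy * (s * f) \<in> conductor A"
proof -
  obtain b G \<sigma> where G: "separable_plane_curve \<iota> x b G" "eval2 \<iota> (dX G) x b \<notin> P" "b \<in> kx_bar"
    "\<And>f. eval2 \<iota> (pderiv G) x b * f \<in> conductor (coord_ring \<iota> x b) \<longleftrightarrow> Fy * f \<in> conductor A"
    "\<sigma> \<in> kx_bar - P" "\<And>z. z \<in> kx_bar \<Longrightarrow> \<sigma> * z \<in> coord_ring \<iota> x b"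
    by (rule local_model) (rule that)
  interpret G: separable_plane_curve \<iota> x b G by (rule G(1))
  have BR: "u \<in> R" if "u \<in> G.A" for u
    using kx_bar_subset_R[OF subsetD[OF G.A_subset_kx_bar that]] .
  have eq: "eval2 \<iota> (dX G) x b + G.Fy * D b = 0" using D_eval2[of G b] G.root D_zero by simp
  have DB: "G.Fy * D u \<in> R" if u: "u \<in> G.A" for u
  proof -
    obtain H where H: "u = eval2 \<iota> H x b" using u by (auto simp: coord_ring_def)
    have Db: "G.Fy * D b = - eval2 \<iota> (dX G) x b" using eq by (simp add: eq_neg_iff_add_eq_0 add.commute)
    have "G.Fy * D u = G.Fy * eval2 \<iota> (dX H) x b + eval2 \<iota> (pderiv H) x b * (G.Fy * D b)"
      unfolding H D_eval2 by (simp add: algebra_simps)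
    also have "\<dots> = G.Fy * eval2 \<iota> (dX H) x b + eval2 \<iota> (pderiv H) x b * - eval2 \<iota> (dX G) x b"
      unfolding Db ..
    also have "\<dots> \<in> G.A"
      by (rule G.A.add_mem[OF G.A.mult_mem[OF G.eval2_in_A G.eval2_in_A] G.A.mult_mem[OF G.eval2_in_A G.A.uminus_mem[OF G.eval2_in_A]]])
    finally show ?thesis by (rule BR)
  qed
  have "G.Fy * f \<in> R"
  proof (rule D_module_E[OF f R.unital_subring_axioms order.refl])
    fix g assume "g \<in> R"
    then obtain a s where as: "a \<in> kx_bar" "s \<in> kx_bar - P" "s \<noteq> 0" "g = a / s" by (rule R_E)
    have \<sigma>0: "\<sigma> \<noteq> 0" by (rule not_P_nonzero[OF G(5)])
    \<comment> \<open>Multiplying numerator and denominator by \<sigma> turns g into a quotient of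
      elements of k[x,b] without moving the denominator into P.\<close>
    define u v where "u = \<sigma> * a" and "v = \<sigma> * s"
    have v: "v \<in> kx_bar - P" unfolding v_def by (rule not_P_mult[OF G(5) as(2)])
    have uB: "u \<in> G.A" unfolding u_def by (rule G(6)[OF as(1)])
    have vB: "v \<in> G.A" unfolding v_def by (rule G(6)) (use as(2) in simp)
    have v0: "v \<noteq> 0" by (rule not_P_nonzero[OF v])
    have guv: "g = u / v" using \<sigma>0 as(3,4) by (simp add: u_def v_def)
    have "G.Fy * D g = (G.Fy * D u * v - u * (G.Fy * D v)) * inverse v * inverse v"
      unfolding guv D_divide[OF v0] using v0 by (simp add: field_simps power2_eq_square)
    also have "\<dots> \<in> R"
      by (rule R.mult_mem[OF R.mult_mem[OF R.diff_mem[OF R.mult_mem[OF DB[OF uB] BR[OF vB]]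
        R.mult_mem[OF BR[OF uB] DB[OF vB]]] inverse_in_R[OF v]] inverse_in_R[OF v]])
    finally show "G.Fy * D g \<in> R" .
  qed
  then obtain a s where as: "a \<in> kx_bar" "s \<in> kx_bar - P" "s \<noteq> 0" "G.Fy * f = a / s" by (rule R_E)
  have eq2: "G.Fy * (\<sigma> * s * f) = \<sigma> * a" using as(3,4) by (simp add: field_simps)
  \<comment> \<open>\<sigma> carries all integral elements into k[x,b], in particular a w for every
    integral w.\<close>
  have "\<sigma> * a \<in> conductor G.A"
    unfolding conductor_def G.integral_closure_A
  proof (intro CollectI conjI ballI)
    show "\<sigma> * a \<in> G.A" by (rule G(6)[OF as(1)])
    show "\<sigma> * a * w \<in> G.A" if "w \<in> kx_bar" for w
      using G(6)[OF kx_bar.mult_mem[OF as(1) that]] by (simp add: mult.assoc)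
  qed
  then have "Fy * (\<sigma> * s * f) \<in> conductor A" unfolding eq2[symmetric] G(4) .
  then show ?thesis using not_P_mult[OF G(5) as(2)] by (intro bexI[of _ "\<sigma> * s"])
qed

end

section \<open>From the points to the affine curve\<close>

lemma primeideal_subring_iff:
  assumes S: "unital_subring S"
  shows "primeideal P (ring_of_type_algebra\<lparr>carrier := S\<rparr>) \<longleftrightarrow>
    P \<subseteq> S \<and> 0 \<in> P \<and> (\<forall>u\<in>P. \<forall>v\<in>P. u + v \<in> P) \<and> (\<forall>a\<in>S. \<forall>u\<in>P. a * u \<in> P) \<and> 1 \<notin> P \<and>
    (\<forall>a\<in>S. \<forall>b\<in>S. a * b \<in> P \<longrightarrow> a \<in> P \<or> b \<in> P)" (is "primeideal P ?R \<longleftrightarrow> ?rhs")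
proof
  interpret S: unital_subring S by fact
  have sR: "carrier ?R = S" "monoid.mult ?R = (*)" "one ?R = 1" "zero ?R = 0" "add ?R = (+)"
    by (simp_all add: ring_of_type_algebra_def fun_eq_iff)
  {
    assume "primeideal P ?R"
    then interpret P: primeideal P ?R .
    have "1 \<notin> P"
      using P.one_imp_carrier P.I_notcarr by (auto simp: sR)
    moreover have "P \<subseteq> S" using P.a_subset by (simp add: sR)
    moreover have "0 \<in> P" using additive_subgroup.zero_closed[OF P.additive_subgroup_axioms] by (simp add: sR)
    moreover have "u + v \<in> P" if "u \<in> P" "v \<in> P" for u v
      using additive_subgroup.a_closed[OF P.additive_subgroup_axioms that] by (simp add: sR)
    moreover have "a * u \<in> P" if "a \<in> S" "u \<in> P" for a u using P.I_l_closed[of u a] that by (simp add: sR)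
    moreover have "a \<in> P \<or> b \<in> P" if "a \<in> S" "b \<in> S" "a * b \<in> P" for a b
      using P.I_prime[of a b] that by (simp add: sR)
    ultimately show ?rhs by (intro conjI ballI impI)
  next
    assume rhs: ?rhs
    interpret R: cring ?R by (rule cring_unital_subring[OF S])
    have minus: "\<ominus>\<^bsub>?R\<^esub> u = - u" if "u \<in> S" for u
      using R.minus_equality[of "- u" u] that S.uminus_mem by (simp add: sR)
    have neg: "- u \<in> P" if "u \<in> P" for u
    proof -
      have "(- 1) * u \<in> P" using rhs that S.uminus_mem[OF S.one_mem] by blast
      then show ?thesis by simp
    qed
    have sub: "subgroup P (add_monoid ?R)"
    proof (rule R.add.subgroupI)
      show "P \<subseteq> carrier ?R" using rhs by (simp add: sR)
      show "P \<noteq> {}" using rhs by blast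
      show "\<ominus>\<^bsub>?R\<^esub> u \<in> P" if u: "u \<in> P" for u
      proof -
        have "u \<in> S" using rhs u by blast
        then show ?thesis using minus[of u] neg[OF u] by simp
      qed
      show "u \<oplus>\<^bsub>?R\<^esub> v \<in> P" if "u \<in> P" "v \<in> P" for u v
        using rhs that by (simp add: sR)
    qed
    have "u * a \<in> P" if "a \<in> S" "u \<in> P" for a u
      using rhs that unfolding mult.commute[of u a] by blast
    then have "ideal P ?R"
      using rhs by (intro idealI R.ring_axioms sub) (simp_all add: sR)
    then show "primeideal P ?R"
      using rhs S.one_mem by (intro primeidealI R.cring_axioms) (auto simp: sR)
  }
qed

text \<open>Zorn's lemma yields a maximal proper ideal above I. For a outside it, the ideal it
  generates with a contains 1, which gives primality.\<close>

lemma prime_ideal_above: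
  fixes S I :: "'a::comm_ring_1 set"
  assumes S: "unital_subring S"
    and I: "I \<subseteq> S" "0 \<in> I" "\<forall>u\<in>I. \<forall>v\<in>I. u + v \<in> I" "\<forall>a\<in>S. \<forall>u\<in>I. a * u \<in> I" "1 \<notin> I"
  shows "\<exists>M. I \<subseteq> M \<and> primeideal M (ring_of_type_algebra\<lparr>carrier := S\<rparr>)"
proof -
  interpret S: unital_subring S by fact
  define \<A> where "\<A> = {J. I \<subseteq> J \<and> J \<subseteq> S \<and> (\<forall>u\<in>J. \<forall>v\<in>J. u + v \<in> J) \<and> (\<forall>a\<in>S. \<forall>u\<in>J. a * u \<in> J) \<and> 1 \<notin> J}"
  have AI: "J \<in> \<A> \<longleftrightarrow> I \<subseteq> J \<and> J \<subseteq> S \<and> (\<forall>u\<in>J. \<forall>v\<in>J. u + v \<in> J) \<and> (\<forall>a\<in>S. \<forall>u\<in>J. a * u \<in> J) \<and> 1 \<notin> J" for J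
    by (simp add: \<A>_def)
  have "I \<in> \<A>" unfolding AI using I by blast
  then have "\<A> \<noteq> {}" by blast
  moreover have "\<Union>\<C> \<in> \<A>" if C: "\<C> \<noteq> {}" "subset.chain \<A> \<C>" for \<C>
  proof -
    have sub: "\<C> \<subseteq> \<A>" and tot': "\<forall>J\<in>\<C>. \<forall>K\<in>\<C>. J \<subseteq> K \<or> K \<subseteq> J"
      using C(2) unfolding subset_chain_def by blast+
    note tot = bspec[OF bspec[OF tot']]
    have mem: "I \<subseteq> J \<and> J \<subseteq> S \<and> (\<forall>u\<in>J. \<forall>v\<in>J. u + v \<in> J) \<and> (\<forall>a\<in>S. \<forall>u\<in>J. a * u \<in> J) \<and> 1 \<notin> J" if "J \<in> \<C>" for J
      by (rule iffD1[OF AI subsetD[OF sub that]])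
    show ?thesis
      unfolding AI
    proof (intro conjI ballI)
      obtain J where "J \<in> \<C>" using C(1) by blast
      then show "I \<subseteq> \<Union>\<C>" using mem[of J] by blast
      show "\<Union>\<C> \<subseteq> S" by (rule Union_least) (simp add: mem)
      show "1 \<notin> \<Union>\<C>"
      proof
        assume "1 \<in> \<Union>\<C>"
        then obtain J where "1 \<in> J" "J \<in> \<C>" by (rule UnionE)
        then show False using mem[of J] by blast
      qed
      show "a * u \<in> \<Union>\<C>" if a: "a \<in> S" and u: "u \<in> \<Union>\<C>" for a u
      proof -
        obtain J where J: "u \<in> J" "J \<in> \<C>" using u by (rule UnionE)
        then have "a * u \<in> J" using mem[OF J(2)] a by blast
        then show ?thesis using J(2) by (rule UnionI[rotated])
      qed
      fix u v assume "u \<in> \<Union>\<C>" "v \<in> \<Union>\<C>"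
      then obtain J K where JK: "J \<in> \<C>" "K \<in> \<C>" "u \<in> J" "v \<in> K" by blast
      from tot[OF JK(1,2)] show "u + v \<in> \<Union>\<C>"
      proof
        assume "J \<subseteq> K"
        then have "u \<in> K" using JK(3) by (rule subsetD)
        then have "u + v \<in> K" using mem[OF JK(2)] JK(4) by simp
        with JK(2) show ?thesis by (rule UnionI)
      next
        assume "K \<subseteq> J"
        then have "v \<in> J" using JK(4) by (rule subsetD)
        then have "u + v \<in> J" using mem[OF JK(1)] JK(3) by simp
        with JK(1) show ?thesis by (rule UnionI)
      qed
    qed
  qed
  ultimately have "\<exists>M\<in>\<A>. \<forall>J\<in>\<A>. M \<subseteq> J \<longrightarrow> J = M" by (rule subset_Zorn_nonempty)
  then obtain M where M': "M \<in> \<A>" "\<forall>J\<in>\<A>. M \<subseteq> J \<longrightarrow> J = M" by (elim bexE)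
  have maxM: "J = M" if "J \<in> \<A>" "M \<subseteq> J" for J using M'(2) that by blast
  from iffD1[OF AI M'(1)]
  have m': "I \<subseteq> M" "M \<subseteq> S" "\<forall>u\<in>M. \<forall>v\<in>M. u + v \<in> M" "\<forall>a\<in>S. \<forall>u\<in>M. a * u \<in> M" "1 \<notin> M"
    by blast+
  note m = m'(1,2) bspec[OF bspec[OF m'(3)]] bspec[OF bspec[OF m'(4)]] m'(5)
  have unit: "\<exists>c\<in>S. \<exists>w\<in>M. c * a + w = 1" if a: "a \<in> S" "a \<notin> M" for a
  proof (rule ccontr)
    assume no: "\<not> (\<exists>c\<in>S. \<exists>w\<in>M. c * a + w = 1)"
    define J where "J = {z. \<exists>c\<in>S. \<exists>w\<in>M. z = c * a + w}"
    have JI: "c * a + w \<in> J" if "c \<in> S" "w \<in> M" for c w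
      unfolding J_def by (rule CollectI, rule bexI[OF _ that(1)], rule bexI[OF refl that(2)])
    have JE: "\<exists>c\<in>S. \<exists>w\<in>M. z = c * a + w" if "z \<in> J" for z
      using that unfolding J_def by (rule CollectD)
    have MJ: "M \<subseteq> J"
    proof
      fix w assume "w \<in> M"
      from JI[OF S.zero_mem this] show "w \<in> J" by (simp only: mult_zero_left add_0_left)
    qed
    have "J \<in> \<A>"
      unfolding AI
    proof (intro conjI ballI)
      show "I \<subseteq> J" using m(1) MJ by (rule subset_trans)
      show "J \<subseteq> S"
      proof
        fix z assume "z \<in> J"
        from JE[OF this] obtain c w where z: "c \<in> S" "w \<in> M" "z = c * a + w" by (elim bexE)
        show "z \<in> S" unfolding z(3) by (rule S.add_mem[OF S.mult_mem[OF z(1) a(1)] subsetD[OF m(2) z(2)]])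
      qed
      show "1 \<notin> J"
      proof
        assume "1 \<in> J"
        from JE[OF this] obtain c w where "c \<in> S" "w \<in> M" "1 = c * a + w" by (elim bexE)
        then have "\<exists>c\<in>S. \<exists>w\<in>M. c * a + w = 1" by (intro bexI[where x = c] bexI[where x = w]) (erule sym)
        then show False by (rule notE[OF no])
      qed
      fix z assume "z \<in> J"
      from JE[OF this] obtain c w where z: "c \<in> S" "w \<in> M" "z = c * a + w" by (elim bexE)
      show "z + z' \<in> J" if "z' \<in> J" for z'
      proof -
        from JE[OF \<open>z' \<in> J\<close>] obtain c' w' where z': "c' \<in> S" "w' \<in> M" "z' = c' * a + w'" by (elim bexE)
        have eq: "z + z' = (c + c') * a + (w + w')" unfolding z(3) z'(3) distrib_right by (simp only: add_ac)
        show ?thesis unfolding eq by (rule JI[OF S.add_mem[OF z(1) z'(1)] m(3)[OF z(2) z'(2)]])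
      qed
      show "e * z \<in> J" if "e \<in> S" for e
      proof -
        have eq: "e * z = (e * c) * a + e * w" unfolding z(3) by (simp only: distrib_left mult.assoc)
        show ?thesis unfolding eq by (rule JI[OF S.mult_mem[OF that z(1)] m(4)[OF that z(2)]])
      qed
    qed
    from maxM[OF this MJ] have "J = M" .
    have "0 \<in> M" using m(1) I(2) by (rule subsetD)
    from JI[OF S.one_mem this] have "a \<in> J" by (simp only: mult_1_left add_0_right)
    then show False using a(2) unfolding \<open>J = M\<close> by (rule notE[rotated])
  qed
  have "a \<in> M \<or> b \<in> M" if ab: "a \<in> S" "b \<in> S" "a * b \<in> M" for a b
  proof (rule ccontr)
    assume n: "\<not> (a \<in> M \<or> b \<in> M)"
    then have "a \<notin> M" by simp
    from unit[OF ab(1) this] obtain c w where c: "c \<in> S" "w \<in> M" "c * a + w = 1" by (elim bexE)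
    have "b = b * (c * a + w)" unfolding c(3) by simp
    also have "\<dots> = c * (a * b) + b * w" by (simp only: distrib_left mult_ac)
    also have "\<dots> \<in> M" by (rule m(3)[OF m(4)[OF c(1) ab(3)] m(4)[OF ab(2) c(2)]])
    finally show False using n by blast
  qed
  note prime = this
  have "0 \<in> M" by (rule subsetD[OF m(1) I(2)])
  then have "primeideal M (ring_of_type_algebra\<lparr>carrier := S\<rparr>)"
    unfolding primeideal_subring_iff[OF S] using m'(2-5) prime by blast
  with m(1) show ?thesis by blast
qed

locale perfect_plane_curve_D = separable_plane_curve \<iota> x y F + derivation_d_dx \<iota> x D
  for \<iota> :: "'k::field \<Rightarrow> 'K::field" and x y F D +
  assumes perfect_field: "perfect_of_pos_char TYPE('k)"
begin

lemma conductor_module: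
  assumes "z \<in> conductor A" "a \<in> kx_bar"
  shows "a * z \<in> conductor A"
proof -
  have z: "z * w \<in> A" if "w \<in> kx_bar" for w
    using assms(1) that unfolding conductor_def integral_closure_A by blast
  show ?thesis
    unfolding conductor_def integral_closure_A
  proof (intro CollectI conjI ballI)
    show "a * z \<in> A" using z[OF assms(2)] by (simp add: mult.commute)
    show "a * z * w \<in> A" if "w \<in> kx_bar" for w
      using z[OF kx_bar.mult_mem[OF assms(2) that]] by (simp add: mult_ac)
  qed
qed

lemma conductor_add:
  assumes "z \<in> conductor A" "w \<in> conductor A"
  shows "z + w \<in> conductor A"
  unfolding conductor_def
proof (intro CollectI conjI ballI)
  show "z + w \<in> A" using assms unfolding conductor_def by (intro A.add_mem) blast+
  show "(z + w) * u \<in> A" if "u \<in> integral_closure A" for u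
    using assms that unfolding conductor_def distrib_right by (intro A.add_mem) blast+
qed

lemma zero_in_conductor: "0 \<in> conductor A"
  by (simp add: conductor_def A.zero_mem)

lemma Fy_in_conductor: "Fy \<in> conductor A"
  unfolding conductor_def integral_closure_A using Fy_mult_integral by simp

abbreviation kx_bar_ring :: "'K ring" where
  "kx_bar_ring \<equiv> ring_of_type_algebra\<lparr>carrier := kx_bar\<rparr>"

lemma curve_prime_D:
  assumes "P \<subseteq> kx_bar" "\<And>u v. u \<in> P \<Longrightarrow> v \<in> P \<Longrightarrow> u + v \<in> P" "\<And>a u. a \<in> kx_bar \<Longrightarrow> u \<in> P \<Longrightarrow> a * u \<in> P" "1 \<notin> P"
    "\<And>a b. a \<in> kx_bar \<Longrightarrow> b \<in> kx_bar \<Longrightarrow> a * b \<in> P \<Longrightarrow> a \<in> P \<or> b \<in> P" "\<exists>u\<in>P. u \<noteq> 0"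
  shows "perfect_curve_prime_D \<iota> x y F P D"
  by unfold_locales (fact assms perfect_field)+

text \<open>From right to left the local statement applies at each point. Conversely, the s with s
  Fy f in the conductor form an ideal of the integral closure; if it were proper, it would lie in a
  prime M, but regularity at M provides such an s outside M.\<close>

theorem regular_everywhere_iff_conductor:
  "(\<forall>P. primeideal P kx_bar_ring \<longrightarrow> f \<in> D_module (localization kx_bar P)) \<longleftrightarrow> Fy * f \<in> conductor A"
proof
  assume f: "Fy * f \<in> conductor A"
  show "\<forall>P. primeideal P kx_bar_ring \<longrightarrow> f \<in> D_module (localization kx_bar P)"
  proof (intro allI impI)
    fix P assume "primeideal P kx_bar_ring"
    then have P: "P \<subseteq> kx_bar" "0 \<in> P" "\<And>u v. u \<in> P \<Longrightarrow> v \<in> P \<Longrightarrow> u + v \<in> P"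
      "\<And>a u. a \<in> kx_bar \<Longrightarrow> u \<in> P \<Longrightarrow> a * u \<in> P" "1 \<notin> P"
      "\<And>a b. a \<in> kx_bar \<Longrightarrow> b \<in> kx_bar \<Longrightarrow> a * b \<in> P \<Longrightarrow> a \<in> P \<or> b \<in> P"
      unfolding primeideal_subring_iff[OF kx_bar.unital_subring_axioms] by blast+
    show "f \<in> D_module (localization kx_bar P)"
    proof (cases "\<exists>u\<in>P. u \<noteq> 0")
      case True
      interpret L: perfect_curve_prime_D \<iota> x y F P D by (rule curve_prime_D[OF P(1,3-6) True])
      show ?thesis using L.regular_if_conductor[OF f] unfolding L.R_def .
    next
      case False
      \<comment> \<open>The generic point: the localization is all of K, and f = f D x.\<close>
      then have P0: "P = {0}" using P(2) by blast
      have all: "z \<in> localization kx_bar P" for z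
      proof -
        obtain a c where ac: "a \<in> A" "c \<noteq> 0" "xpoly c * z = a" by (rule quotient_xpoly)
        have "z = a / xpoly c" using ac(2) unfolding ac(3)[symmetric] by (simp add: xpoly_eq_0_iff)
        moreover have "a \<in> kx_bar" by (rule subsetD[OF A_subset_kx_bar ac(1)])
        moreover have "xpoly c \<in> kx_bar" "xpoly c \<notin> P" using kx_subset_kx_bar ac(2) P0 by (auto simp: xpoly_eq_0_iff)
        ultimately show ?thesis unfolding localization_def by blast
      qed
      then show ?thesis using D_module_I[OF all all[of f] all[of x]] D_x by simp
    qed
  qed
next
  assume reg: "\<forall>P. primeideal P kx_bar_ring \<longrightarrow> f \<in> D_module (localization kx_bar P)"
  define I where "I = {s \<in> kx_bar. Fy * (s * f) \<in> conductor A}"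
  have "1 \<in> I"
  proof (rule ccontr)
    assume "1 \<notin> I"
    have I: "I \<subseteq> kx_bar" "0 \<in> I" "\<forall>u\<in>I. \<forall>v\<in>I. u + v \<in> I" "\<forall>a\<in>kx_bar. \<forall>u\<in>I. a * u \<in> I"
    proof -
      show "I \<subseteq> kx_bar" "0 \<in> I" by (auto simp: I_def zero_in_conductor kx_bar.zero_mem)
      show "\<forall>u\<in>I. \<forall>v\<in>I. u + v \<in> I"
        using conductor_add kx_bar.add_mem by (simp add: I_def distrib_left distrib_right)
      show "\<forall>a\<in>kx_bar. \<forall>u\<in>I. a * u \<in> I"
      proof (intro ballI)
        fix a u assume a: "a \<in> kx_bar" and u: "u \<in> I"
        have "a * (Fy * (u * f)) \<in> conductor A" by (rule conductor_module[OF _ a]) (use u in \<open>simp add: I_def\<close>)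
        moreover have "a * (Fy * (u * f)) = Fy * (a * u * f)" by (simp only: mult_ac)
        ultimately show "a * u \<in> I" using kx_bar.mult_mem[OF a, of u] u by (simp add: I_def)
      qed
    qed
    obtain M where IM: "I \<subseteq> M" and pM: "primeideal M kx_bar_ring"
      using prime_ideal_above[OF kx_bar.unital_subring_axioms I \<open>1 \<notin> I\<close>] by blast
    have M: "M \<subseteq> kx_bar" "0 \<in> M" "\<And>u v. u \<in> M \<Longrightarrow> v \<in> M \<Longrightarrow> u + v \<in> M"
      "\<And>a u. a \<in> kx_bar \<Longrightarrow> u \<in> M \<Longrightarrow> a * u \<in> M" "1 \<notin> M"
      "\<And>a b. a \<in> kx_bar \<Longrightarrow> b \<in> kx_bar \<Longrightarrow> a * b \<in> M \<Longrightarrow> a \<in> M \<or> b \<in> M"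
      using pM unfolding primeideal_subring_iff[OF kx_bar.unital_subring_axioms] by blast+
    \<comment> \<open>M is not the zero ideal, since I contains Fy c(x): with c f in
      \<open>A\<close>, the product Fy c f is integral and Fy is itself in the conductor.\<close>
    obtain a c where ac: "a \<in> A" "c \<noteq> 0" "xpoly c * f = a" by (rule quotient_xpoly)
    have Fyk: "Fy \<in> kx_bar" by (rule subsetD[OF A_subset_kx_bar eval2_in_A])
    have ck: "xpoly c \<in> kx_bar" using kx_subset_kx_bar by blast
    have "(Fy * a) * Fy \<in> conductor A"
      by (rule conductor_module[OF Fy_in_conductor kx_bar.mult_mem[OF Fyk subsetD[OF A_subset_kx_bar ac(1)]]])
    moreover have "(Fy * a) * Fy = Fy * (Fy * xpoly c * f)" unfolding ac(3)[symmetric] by (simp only: mult_ac)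
    ultimately have "Fy * xpoly c \<in> I" using kx_bar.mult_mem[OF Fyk ck] by (simp add: I_def)
    moreover have "Fy * xpoly c \<noteq> 0" using Fy_nonzero ac(2) by (simp add: xpoly_eq_0_iff)
    ultimately have nz: "\<exists>u\<in>M. u \<noteq> 0" using IM by blast
    interpret L: perfect_curve_prime_D \<iota> x y F M D by (rule curve_prime_D[OF M(1,3-6) nz])
    have "f \<in> D_module L.R" using reg pM unfolding L.R_def by blast
    from L.conductor_if_regular[OF this] obtain s where "s \<in> kx_bar - M" "Fy * (s * f) \<in> conductor A" by blast
    then have "s \<in> I" by (simp add: I_def)
    then show False using IM \<open>s \<in> kx_bar - M\<close> by blast
  qed
  then show "Fy * f \<in> conductor A" by (simp add: I_def)
qed

end

section \<open>The derivation with respect to the first coordinate\<close>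

context separable_plane_curve
begin

text \<open>The derivative of P(x,y) with dy/dx = -F_x / F_y, the only value compatible with F(x,y)
  = 0. By \<open>pre_D_cong\<close> it depends only on the value of P.\<close>

definition pre_D :: "'k poly poly \<Rightarrow> 'K" where
  "pre_D P = eval2 \<iota> (dX P) x y - eval2 \<iota> (pderiv P) x y * (eval2 \<iota> (dX F) x y / Fy)"

lemma pre_D_add: "pre_D (P + Q) = pre_D P + pre_D Q"
  by (simp add: pre_D_def dX_add pderiv_add ev.hom_add distrib_right add_divide_distrib)

lemma pre_D_mult: "pre_D (P * Q) = pre_D P * eval2 \<iota> Q x y + eval2 \<iota> P x y * pre_D Q"
  by (simp add: pre_D_def dX_mult pderiv_mult ev.hom_add ev.hom_mult algebra_simps)

lemma pre_D_cong:
  assumes "eval2 \<iota> P x y = eval2 \<iota> Q x y"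
  shows "pre_D P = pre_D Q"
proof -
  have "eval2 \<iota> (P - Q) x y = 0" using assms by (simp add: ev.hom_minus)
  then obtain V where V: "P - Q = F * V" unfolding eval2_eq_0_iff by (elim dvdE)
  have "P = Q + F * V" using V by (simp add: algebra_simps)
  moreover have "pre_D F = 0" using Fy_nonzero by (simp add: pre_D_def)
  ultimately show ?thesis by (simp add: pre_D_add pre_D_mult root)
qed

text \<open>The quotient rule for z = P/Q, with z left unexpanded: (P' - z Q') / Q. Independence of
  P and Q follows in \<open>d_dx_eq\<close> from the product rule for P Q' = P' Q in K.\<close>

definition d_dx :: "'K \<Rightarrow> 'K" where
  "d_dx z = (THE w. \<exists>P Q. eval2 \<iota> Q x y \<noteq> 0 \<and> z * eval2 \<iota> Q x y = eval2 \<iota> P x y \<and>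
     w = (pre_D P - z * pre_D Q) / eval2 \<iota> Q x y)"

lemma d_dx_eq:
  assumes Q: "eval2 \<iota> Q x y \<noteq> 0" and z: "z * eval2 \<iota> Q x y = eval2 \<iota> P x y"
  shows "d_dx z = (pre_D P - z * pre_D Q) / eval2 \<iota> Q x y"
  unfolding d_dx_def
proof (rule the_equality)
  show "\<exists>P' Q'. eval2 \<iota> Q' x y \<noteq> 0 \<and> z * eval2 \<iota> Q' x y = eval2 \<iota> P' x y \<and>
     (pre_D P - z * pre_D Q) / eval2 \<iota> Q x y = (pre_D P' - z * pre_D Q') / eval2 \<iota> Q' x y"
    using assms by blast
  fix w assume "\<exists>P' Q'. eval2 \<iota> Q' x y \<noteq> 0 \<and> z * eval2 \<iota> Q' x y = eval2 \<iota> P' x y \<and>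
     w = (pre_D P' - z * pre_D Q') / eval2 \<iota> Q' x y"
  then obtain P' Q' where w: "eval2 \<iota> Q' x y \<noteq> 0" "z * eval2 \<iota> Q' x y = eval2 \<iota> P' x y"
    "w = (pre_D P' - z * pre_D Q') / eval2 \<iota> Q' x y" by blast
  have "pre_D (P * Q') = pre_D (P' * Q)"
    by (rule pre_D_cong) (simp add: ev.hom_mult z[symmetric] w(2)[symmetric] mult_ac)
  then have "pre_D P * eval2 \<iota> Q' x y + z * eval2 \<iota> Q x y * pre_D Q'
      = pre_D P' * eval2 \<iota> Q x y + z * eval2 \<iota> Q' x y * pre_D Q"
    unfolding pre_D_mult z[symmetric] w(2)[symmetric] .
  then have "(pre_D P - z * pre_D Q) * eval2 \<iota> Q' x y = (pre_D P' - z * pre_D Q') * eval2 \<iota> Q x y"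
    by (simp add: algebra_simps)
  then show "w = (pre_D P - z * pre_D Q) / eval2 \<iota> Q x y"
    unfolding w(3) using Q w(1) by (simp add: frac_eq_eq)
qed

lemma fraction_representation:
  obtains P Q where "eval2 \<iota> Q x y \<noteq> 0" "z * eval2 \<iota> Q x y = eval2 \<iota> P x y"
  using quotients[of z] by auto

lemma d_dx_eval2: "d_dx (eval2 \<iota> P x y) = pre_D P"
proof -
  have "pre_D 1 = 0"
    by (simp add: pre_D_def map_poly_1 pderiv_1 eval2_def)
  then show ?thesis using d_dx_eq[of 1 "eval2 \<iota> P x y" P] by simp
qed

lemma derivation_d_dx: "derivation_d_dx \<iota> x d_dx"
proof unfold_locales
  fix z w
  obtain P Q where z: "eval2 \<iota> Q x y \<noteq> 0" "z * eval2 \<iota> Q x y = eval2 \<iota> P x y" by (rule fraction_representation)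
  obtain P' Q' where w: "eval2 \<iota> Q' x y \<noteq> 0" "w * eval2 \<iota> Q' x y = eval2 \<iota> P' x y" by (rule fraction_representation)
  let ?q = "eval2 \<iota> Q x y" and ?q' = "eval2 \<iota> Q' x y"
  have nz: "eval2 \<iota> (Q * Q') x y \<noteq> 0" using z w by (simp add: ev.hom_mult)
  have dz: "d_dx z = (pre_D P - z * pre_D Q) / ?q" and dw: "d_dx w = (pre_D P' - w * pre_D Q') / ?q'"
    by (rule d_dx_eq[OF z], rule d_dx_eq[OF w])
  have "(z + w) * eval2 \<iota> (Q * Q') x y = eval2 \<iota> (P * Q' + P' * Q) x y"
    by (simp add: ev.hom_mult ev.hom_add z(2)[symmetric] w(2)[symmetric] algebra_simps)
  from d_dx_eq[OF nz this] have "d_dx (z + w) * (?q * ?q')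
      = pre_D (P * Q' + P' * Q) - (z + w) * pre_D (Q * Q')"
    using nz by (simp add: ev.hom_mult)
  also have "\<dots> = (pre_D P - z * pre_D Q) * ?q' + (pre_D P' - w * pre_D Q') * ?q"
    unfolding pre_D_add pre_D_mult z(2)[symmetric] w(2)[symmetric] by (simp add: algebra_simps)
  also have "\<dots> = (d_dx z + d_dx w) * (?q * ?q')"
    unfolding dz dw using z(1) w(1) by (simp add: field_simps)
  finally show "d_dx (z + w) = d_dx z + d_dx w" using z(1) w(1) by simp
  have "(z * w) * eval2 \<iota> (Q * Q') x y = eval2 \<iota> (P * P') x y"
    by (simp add: ev.hom_mult z(2)[symmetric] w(2)[symmetric] mult_ac)
  from d_dx_eq[OF nz this] have "d_dx (z * w) * (?q * ?q') = pre_D (P * P') - (z * w) * pre_D (Q * Q')"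
    using nz by (simp add: ev.hom_mult)
  also have "\<dots> = (pre_D P - z * pre_D Q) * (w * ?q') + z * ?q * (pre_D P' - w * pre_D Q')"
    unfolding pre_D_mult z(2)[symmetric] w(2)[symmetric] by (simp add: algebra_simps)
  also have "\<dots> = (d_dx z * w + z * d_dx w) * (?q * ?q')"
    unfolding dz dw using z(1) w(1) by (simp add: field_simps)
  finally show "d_dx (z * w) = d_dx z * w + z * d_dx w" using z(1) w(1) by simp
next
  fix c
  have "pre_D [:[:c:]:] = 0"
    by (simp add: pre_D_def Polynomial.map_poly_pCons eval2_def)
  then show "d_dx (\<iota> c) = 0" using d_dx_eval2[of "[:[:c:]:]"] by simp
next
  have "pre_D [:[:0, 1:]:] = 1"
    using ev.hom_one by (simp add: pre_D_def Polynomial.map_poly_pCons pderiv_pCons flip: one_pCons)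
  then show "d_dx x = 1" using d_dx_eval2[of "[:[:0, 1:]:]"] by simp
qed

end

section \<open>Kaehler differentials\<close>

lemma lookup_pm_scale: "Poly_Mapping.lookup (pm_scale c v) g = c * Poly_Mapping.lookup v g"
  unfolding pm_scale_def by (simp add: Poly_Mapping.map.rep_eq when_def)

lemma pm_scale_single: "pm_scale c (Poly_Mapping.single g f) = Poly_Mapping.single g (c * f)"
  by (rule poly_mapping_eqI) (simp add: lookup_pm_scale lookup_single when_def)

interpretation pm: Modules.module pm_scale
  by unfold_locales (rule poly_mapping_eqI, simp add: lookup_pm_scale lookup_add algebra_simps)+

context derivation_d_dx
begin

lemma D_comb_superset:
  assumes "finite S" "Poly_Mapping.keys v \<subseteq> S"
  shows "D_comb v = (\<Sum>g\<in>S. Poly_Mapping.lookup v g * D g)"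
  unfolding D_comb_def using assms by (intro sum.mono_neutral_left) (auto simp: in_keys_iff)

lemma D_comb_add: "D_comb (v + w) = D_comb v + D_comb w"
proof -
  let ?S = "Poly_Mapping.keys v \<union> Poly_Mapping.keys w"
  have "D_comb (v + w) = (\<Sum>g\<in>?S. Poly_Mapping.lookup (v + w) g * D g)"
    by (rule D_comb_superset) (use keys_add[of v w] in auto)
  also have "\<dots> = (\<Sum>g\<in>?S. Poly_Mapping.lookup v g * D g) + (\<Sum>g\<in>?S. Poly_Mapping.lookup w g * D g)"
    by (simp add: lookup_add distrib_right sum.distrib)
  also have "\<dots> = D_comb v + D_comb w"
    using D_comb_superset[of ?S v] D_comb_superset[of ?S w] by simp
  finally show ?thesis .
qed

lemma D_comb_scale: "D_comb (pm_scale c v) = c * D_comb v"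
proof -
  have "D_comb (pm_scale c v) = (\<Sum>g\<in>Poly_Mapping.keys v. Poly_Mapping.lookup (pm_scale c v) g * D g)"
    by (rule D_comb_superset) (auto simp: in_keys_iff lookup_pm_scale)
  then show ?thesis unfolding D_comb_def sum_distrib_left by (simp add: lookup_pm_scale mult.assoc)
qed

lemma D_comb_zero: "D_comb 0 = 0"
  by (simp add: D_comb_def)

lemma D_comb_diff: "D_comb (v - w) = D_comb v - D_comb w"
  using D_comb_add[of "v - w" w] by simp

lemma D_comb_relators: "v \<in> kaehler_relators \<iota> \<Longrightarrow> D_comb v = 0"
  unfolding kaehler_relators_def
  by (auto simp: D_comb_diff D_comb_single D_add D_mult D_const)

lemma D_comb_span:
  assumes "v \<in> pm.span (kaehler_relators \<iota>)"
  shows "D_comb v = 0"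
  using assms
proof (induction rule: pm.span_induct_alt)
  case base
  show ?case by (rule D_comb_zero)
next
  case (step c u w)
  then show ?case by (simp add: D_comb_add D_comb_scale D_comb_relators)
qed

end

section \<open>The rational forms are one-dimensional with basis dx\<close>

context perfect_plane_curve_D
begin

abbreviation rel_span :: "('K \<Rightarrow>\<^sub>0 'K) set" where
  "rel_span \<equiv> pm.span (kaehler_relators \<iota>)"

abbreviation d :: "'K \<Rightarrow> ('K \<Rightarrow>\<^sub>0 'K)" where
  "d g \<equiv> Poly_Mapping.single g 1"

definition eqv :: "('K \<Rightarrow>\<^sub>0 'K) \<Rightarrow> ('K \<Rightarrow>\<^sub>0 'K) \<Rightarrow> bool" where
  "eqv v w \<longleftrightarrow> v - w \<in> rel_span"

lemma eqv_refl: "eqv v v"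
  by (simp add: eqv_def pm.span_zero)

lemma eqv_sym: "eqv v w \<Longrightarrow> eqv w v"
  unfolding eqv_def using pm.span_neg[of "v - w"] by simp

lemma eqv_trans: "eqv u v \<Longrightarrow> eqv v w \<Longrightarrow> eqv u w"
  unfolding eqv_def using pm.span_add[of "u - v" _ "v - w"] by simp

lemma eqv_add: "eqv u v \<Longrightarrow> eqv u' v' \<Longrightarrow> eqv (u + u') (v + v')"
  unfolding eqv_def using pm.span_add[of "u - v" _ "u' - v'"] by (simp add: algebra_simps)

lemma eqv_scale: "eqv u v \<Longrightarrow> eqv (pm_scale c u) (pm_scale c v)"
  unfolding eqv_def using pm.span_scale[of "u - v" _ c] by (simp add: pm.scale_right_diff_distrib)

lemma eqv_d_add: "eqv (d (a + b)) (d a + d b)"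
proof -
  have "d (a + b) - d a - d b \<in> rel_span"
    by (rule pm.span_base) (auto simp: kaehler_relators_def)
  then show ?thesis by (simp add: eqv_def diff_diff_eq)
qed

lemma eqv_d_mult: "eqv (d (a * b)) (pm_scale a (d b) + pm_scale b (d a))"
proof -
  have "d (a * b) - Poly_Mapping.single b a - Poly_Mapping.single a b \<in> rel_span"
    by (rule pm.span_base) (auto simp: kaehler_relators_def)
  then show ?thesis by (simp add: eqv_def diff_diff_eq pm_scale_single)
qed

lemma eqv_d_const: "eqv (d (\<iota> c)) 0"
proof -
  have "d (\<iota> c) \<in> rel_span" by (rule pm.span_base) (auto simp: kaehler_relators_def)
  then show ?thesis by (simp add: eqv_def)
qed

text \<open>The relation dg = D(g) dx modulo the relators. It holds for constants and x, passes to
  sums and products, and is extended to y, to \<open>A\<close> and finally to all of K.\<close>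

definition ddx :: "'K \<Rightarrow> bool" where
  "ddx g \<longleftrightarrow> eqv (d g) (pm_scale (D g) (d x))"

lemma ddx_const: "ddx (\<iota> c)"
  using eqv_d_const[of c] by (simp add: ddx_def D_const)

lemma ddx_x: "ddx x"
  by (simp add: ddx_def D_x eqv_refl)

lemma ddx_add: "ddx a \<Longrightarrow> ddx b \<Longrightarrow> ddx (a + b)"
  unfolding ddx_def D_add pm.scale_left_distrib
  using eqv_trans[OF eqv_d_add eqv_add] by blast

lemma ddx_mult:
  assumes "ddx a" "ddx b"
  shows "ddx (a * b)"
proof -
  have "eqv (pm_scale a (d b) + pm_scale b (d a)) (pm_scale a (pm_scale (D b) (d x)) + pm_scale b (pm_scale (D a) (d x)))"
    using assms unfolding ddx_def by (intro eqv_add eqv_scale)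
  also have "pm_scale a (pm_scale (D b) (d x)) + pm_scale b (pm_scale (D a) (d x)) = pm_scale (D (a * b)) (d x)"
    by (simp add: D_mult pm.scale_left_distrib add.commute mult.commute)
  finally show ?thesis unfolding ddx_def by (rule eqv_trans[OF eqv_d_mult])
qed

lemma ddx_xpoly: "ddx (xpoly q)"
proof (induction q)
  case 0
  show ?case using ddx_const[of 0] by simp
next
  case (pCons c q)
  have "xpoly (pCons c q) = \<iota> c + x * xpoly q"
    by (simp add: xpoly_def Polynomial.map_poly_pCons)
  then show ?case using ddx_add[OF ddx_const ddx_mult[OF ddx_x pCons.IH]] by simp
qed

lemma eqv_d_eval2:
  "eqv (d (eval2 \<iota> P x y)) (pm_scale (eval2 \<iota> (dX P) x y) (d x) + pm_scale (eval2 \<iota> (pderiv P) x y) (d y))"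
proof (induction P)
  case 0
  show ?case using eqv_d_const[of 0] by (simp add: eval2_def)
next
  case (pCons a P)
  let ?e = "eval2 \<iota> P x y" and ?ex = "eval2 \<iota> (dX P) x y" and ?ey = "eval2 \<iota> (pderiv P) x y"
  have 1: "eqv (d (xpoly a + y * ?e)) (d (xpoly a) + d (y * ?e))" by (rule eqv_d_add)
  have 2: "eqv (d (xpoly a) + d (y * ?e))
     (pm_scale (xpoly (pderiv a)) (d x) + (pm_scale y (pm_scale ?ex (d x) + pm_scale ?ey (d y)) + pm_scale ?e (d y)))"
  proof (rule eqv_add)
    show "eqv (d (xpoly a)) (pm_scale (xpoly (pderiv a)) (d x))"
      using ddx_xpoly[of a] by (simp add: ddx_def D_xpoly)
    show "eqv (d (y * ?e)) (pm_scale y (pm_scale ?ex (d x) + pm_scale ?ey (d y)) + pm_scale ?e (d y))"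
      by (rule eqv_trans[OF eqv_d_mult eqv_add[OF eqv_scale[OF pCons.IH] eqv_refl]])
  qed
  have 3: "pm_scale (xpoly (pderiv a)) (d x) + (pm_scale y (pm_scale ?ex (d x) + pm_scale ?ey (d y)) + pm_scale ?e (d y))
    = pm_scale (eval2 \<iota> (dX (pCons a P)) x y) (d x) + pm_scale (eval2 \<iota> (pderiv (pCons a P)) x y) (d y)"
  proof -
    have e1: "eval2 \<iota> (dX (pCons a P)) x y = xpoly (pderiv a) + y * ?ex"
      by (simp add: Polynomial.map_poly_pCons eval2_pCons)
    have e2: "eval2 \<iota> (pderiv (pCons a P)) x y = ?e + y * ?ey"
      by (simp add: pderiv_pCons ev.hom_add eval2_pCons)
    show ?thesis unfolding e1 e2 pm.scale_left_distrib pm.scale_right_distrib by (simp add: ac_simps)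
  qed
  from eqv_trans[OF 1 2] show ?case unfolding 3 unfolding eval2_pCons[of a P] .
qed

text \<open>Differentiating F(x,y) = 0 gives F_x dx + F_y dy = 0, which determines dy because
  \<open>Fy\<close> is nonzero; D satisfies the same equation.\<close>

lemma ddx_y: "ddx y"
proof -
  let ?fx = "eval2 \<iota> (dX F) x y"
  have "eqv 0 (pm_scale ?fx (d x) + pm_scale Fy (d y))"
    using eqv_d_eval2[of F] eqv_d_const[of 0] root by (metis base.hom_zero eqv_sym eqv_trans)
  then have "eqv (pm_scale (- 1 / Fy) 0) (pm_scale (- 1 / Fy) (pm_scale ?fx (d x) + pm_scale Fy (d y)))"
    by (rule eqv_scale)
  moreover have "pm_scale (- 1 / Fy) (pm_scale ?fx (d x) + pm_scale Fy (d y)) = pm_scale (- ?fx / Fy) (d x) - d y"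
    using Fy_nonzero by (simp add: pm.scale_right_distrib)
  ultimately have "eqv 0 (pm_scale (- ?fx / Fy) (d x) - d y)" by simp
  then have "eqv (0 + d y) (pm_scale (- ?fx / Fy) (d x) - d y + d y)" by (rule eqv_add[OF _ eqv_refl])
  moreover have "D y = - ?fx / Fy"
  proof -
    have "?fx + Fy * D y = 0" using D_eval2[of F y] root D_zero by simp
    then have "Fy * D y = - ?fx" by (simp add: eq_neg_iff_add_eq_0 add.commute)
    then show ?thesis using Fy_nonzero by (simp add: field_simps)
  qed
  ultimately show ?thesis by (simp add: ddx_def)
qed

lemma ddx_A: "a \<in> A \<Longrightarrow> ddx a"
proof -
  have "ddx (eval2 \<iota> P x y)" for P
  proof (induction P)
    case 0
    show ?case using ddx_const[of 0] by (simp add: eval2_def)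
  next
    case (pCons a P)
    show ?case unfolding eval2_pCons by (rule ddx_add[OF ddx_xpoly ddx_mult[OF ddx_y pCons.IH]])
  qed
  then show "ddx a" if "a \<in> A" using that by (auto simp: coord_ring_def)
qed

text \<open>With v in k[x] clearing the denominator of z, the relation holds for v and v z; the
  Leibniz rule for v z is solved for dz.\<close>

lemma ddx_all: "ddx z"
proof -
  obtain a c where ac: "a \<in> A" "c \<noteq> 0" "xpoly c * z = a" by (rule quotient_xpoly)
  define v where "v = xpoly c"
  have v: "v \<noteq> 0" using ac(2) by (simp add: v_def xpoly_eq_0_iff)
  have "eqv (d (v * z)) (pm_scale (D (v * z)) (d x))"
    using ddx_A[OF ac(1)] unfolding ac(3)[symmetric] ddx_def v_def .
  from eqv_trans[OF eqv_sym[OF eqv_d_mult] this]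
  have "eqv (pm_scale v (d z) + pm_scale z (d v)) (pm_scale (D (v * z)) (d x))" .
  moreover have "eqv (pm_scale (- z) (d v)) (pm_scale (- z) (pm_scale (D v) (d x)))"
    using ddx_xpoly[of c] unfolding ddx_def v_def by (rule eqv_scale)
  ultimately have "eqv (pm_scale v (d z) + pm_scale z (d v) + pm_scale (- z) (d v))
      (pm_scale (D (v * z)) (d x) + pm_scale (- z) (pm_scale (D v) (d x)))" by (rule eqv_add)
  moreover have "pm_scale v (d z) + pm_scale z (d v) + pm_scale (- z) (d v) = pm_scale v (d z)"
    by simp
  moreover have "pm_scale (D (v * z)) (d x) + pm_scale (- z) (pm_scale (D v) (d x)) = pm_scale (v * D z) (d x)"
    by (simp add: D_mult pm.scale_left_distrib mult.commute)
  ultimately have "eqv (pm_scale v (d z)) (pm_scale (v * D z) (d x))" by simp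
  then have "eqv (pm_scale (1 / v) (pm_scale v (d z))) (pm_scale (1 / v) (pm_scale (v * D z) (d x)))"
    by (rule eqv_scale)
  then show ?thesis unfolding ddx_def using v by simp
qed

lemma eqv_D_comb: "eqv v (pm_scale (D_comb v) (d x))"
proof -
  have s: "eqv (\<Sum>g\<in>S. Poly_Mapping.single g (Poly_Mapping.lookup v g))
      (pm_scale (\<Sum>g\<in>S. Poly_Mapping.lookup v g * D g) (d x))" if "finite S" for S
    using that
  proof (induction S)
    case empty
    show ?case by (simp add: eqv_refl)
  next
    case (insert g S)
    have "eqv (pm_scale (Poly_Mapping.lookup v g) (d g)) (pm_scale (Poly_Mapping.lookup v g) (pm_scale (D g) (d x)))"
      using ddx_all[of g] unfolding ddx_def by (rule eqv_scale)
    from eqv_add[OF this insert.IH] show ?case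
      unfolding sum.insert[OF insert.hyps] pm.scale_left_distrib pm_scale_single[of _ g] mult_1_right pm.scale_scale .
  qed
  have "(\<Sum>g\<in>Poly_Mapping.keys v. Poly_Mapping.single g (Poly_Mapping.lookup v g)) = v"
    by (rule poly_mapping_eqI) (simp add: lookup_sum lookup_single when_def in_keys_iff)
  then show ?thesis using s[OF finite_keys[of v]] unfolding D_comb_def by simp
qed

text \<open>\<open>D_comb\<close> kills the relators, hence is well defined on classes; conversely
  every v is equivalent to \<open>D_comb v\<close> times dx. So classes of forms correspond to
  elements of K.\<close>

lemma kaehler_rel_iff: "(v, w) \<in> kaehler_rel \<iota> \<longleftrightarrow> D_comb v = D_comb w"
proof
  assume "(v, w) \<in> kaehler_rel \<iota>"
  then have "D_comb (v - w) = 0" by (intro D_comb_span) (simp add: kaehler_rel_def)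
  then show "D_comb v = D_comb w" by (simp add: D_comb_diff)
next
  assume e: "D_comb v = D_comb w"
  have "eqv v w"
    using eqv_trans[OF eqv_D_comb[of v]] eqv_sym[OF eqv_D_comb[of w]] unfolding e by blast
  then show "(v, w) \<in> kaehler_rel \<iota>" by (simp add: kaehler_rel_def eqv_def)
qed

lemma kaehler_class: "kaehler_rel \<iota> `` {v} = {w. D_comb w = D_comb v}"
  by (auto simp: kaehler_rel_iff)

lemma form_eq: "form \<iota> f x = {w. D_comb w = f}"
  by (simp add: form_def kaehler_class D_comb_single D_x)

lemma form_inject: "form \<iota> f x = form \<iota> g x \<Longrightarrow> f = g"
proof -
  assume e: "form \<iota> f x = form \<iota> g x"
  have "Poly_Mapping.single x f \<in> form \<iota> f x" by (simp add: form_eq D_comb_single D_x)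
  then show "f = g" unfolding e by (simp add: form_eq D_comb_single D_x)
qed

lemma rational_forms_eq: "rational_forms \<iota> = range (\<lambda>f. form \<iota> f x)"
proof (intro equalityI subsetI)
  fix \<omega> assume "\<omega> \<in> rational_forms \<iota>"
  then obtain v where "\<omega> = kaehler_rel \<iota> `` {v}" by (auto simp: rational_forms_def quotient_def)
  then have "\<omega> = form \<iota> (D_comb v) x" by (simp add: kaehler_class form_eq)
  then show "\<omega> \<in> range (\<lambda>f. form \<iota> f x)" by simp
qed (auto simp: rational_forms_def quotient_def form_def)

lemma regular_at_form_iff: "regular_at \<iota> R (form \<iota> f x) \<longleftrightarrow> f \<in> D_module R"
proof
  assume "regular_at \<iota> R (form \<iota> f x)"
  then obtain v where v: "Poly_Mapping.keys v \<subseteq> R" "\<forall>g. Poly_Mapping.lookup v g \<in> R"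
    "form \<iota> f x = kaehler_rel \<iota> `` {v}" unfolding regular_at_def by blast
  then have "form \<iota> f x = form \<iota> (D_comb v) x" by (simp add: kaehler_class form_eq)
  then have "f = D_comb v" by (rule form_inject)
  then show "f \<in> D_module R" using v(1,2) unfolding D_module_def by blast
next
  assume "f \<in> D_module R"
  then obtain v where v: "Poly_Mapping.keys v \<subseteq> R" "\<forall>g. Poly_Mapping.lookup v g \<in> R" "f = D_comb v"
    unfolding D_module_def by blast
  then have "form \<iota> f x = kaehler_rel \<iota> `` {v}" by (simp add: kaehler_class form_eq)
  then show "regular_at \<iota> R (form \<iota> f x)" unfolding regular_at_def using v(1,2) by blast
qed

end

section \<open>The chart at infinity\<close>

text \<open>The maximum in \<open>total_degree\<close> bounds its members only because the set is
  finite: the exponents lie in a finite union of boxes.\<close>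

lemma coeff_eq_0_if_total_degree:
  assumes "total_degree P \<le> n" "n < i + j"
  shows "coeff (coeff P j) i = 0"
proof (rule ccontr)
  assume nz: "coeff (coeff P j) i \<noteq> 0"
  let ?S = "{i + j |i j. coeff (coeff P j) i \<noteq> 0}"
  have "?S \<subseteq> (\<lambda>(i, j). i + j) ` (\<Union>j\<le>degree P. {..degree (coeff P j)} \<times> {j})"
  proof
    fix s assume "s \<in> ?S"
    then obtain a b where ab: "s = a + b" "coeff (coeff P b) a \<noteq> 0" by blast
    have "coeff P b \<noteq> 0" using ab(2) by auto
    then have "b \<le> degree P" by (rule le_degree)
    moreover have "a \<le> degree (coeff P b)" by (rule le_degree[OF ab(2)])
    ultimately have "(a, b) \<in> (\<Union>j\<le>degree P. {..degree (coeff P j)} \<times> {j})" by blast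
    then show "s \<in> (\<lambda>(i, j). i + j) ` (\<Union>j\<le>degree P. {..degree (coeff P j)} \<times> {j})"
      unfolding ab(1) by (rule image_eqI[rotated]) simp
  qed
  moreover have "finite ((\<lambda>(i, j). i + j) ` (\<Union>j\<le>degree P. {..degree (coeff P j)} \<times> {j}))" by simp
  ultimately have "finite ?S" by (rule finite_subset)
  then have "i + j \<le> total_degree P"
    unfolding total_degree_def using nz by (intro Max_ge) auto
  then show False using assms by simp
qed

lemma total_degree_le:
  assumes "\<And>i j. coeff (coeff P j) i \<noteq> 0 \<Longrightarrow> i + j \<le> n"
  shows "total_degree P \<le> n"
proof -
  have "{i + j |i j. coeff (coeff P j) i \<noteq> 0} \<subseteq> {..n}" using assms by auto
  from finite_subset[OF this finite_atMost]
  have "finite (insert 0 {i + j |i j. coeff (coeff P j) i \<noteq> 0})" by simp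
  then show ?thesis unfolding total_degree_def using assms by auto
qed

text \<open>The polynomial \<open>P(x,y) / x\<^sup>n\<close> in the coordinates \<open>1/x, y/x\<close>.\<close>

definition infinity_chart :: "nat \<Rightarrow> 'k::field poly poly \<Rightarrow> 'k poly poly" where
  "infinity_chart n P = (\<Sum>j\<le>n. monom (\<Sum>i\<le>n - j. monom (coeff (coeff P j) i) (n - j - i)) j)"

lemma coeff_infinity_chart:
  "coeff (infinity_chart n P) j = (if j \<le> n then \<Sum>i\<le>n - j. monom (coeff (coeff P j) i) (n - j - i) else 0)"
proof -
  have "coeff (infinity_chart n P) j
      = (\<Sum>l\<le>n. if l = j then \<Sum>i\<le>n - l. monom (coeff (coeff P l) i) (n - l - i) else 0)"
    by (simp add: infinity_chart_def coeff_sum coeff_monom)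
  then show ?thesis by (simp only: sum.delta[OF finite_atMost] atMost_iff)
qed

lemma coeff_coeff_infinity_chart:
  assumes "i + j \<le> n"
  shows "coeff (coeff (infinity_chart n P) j) (n - j - i) = coeff (coeff P j) i"
proof -
  have "coeff (coeff (infinity_chart n P) j) (n - j - i)
      = (\<Sum>l\<le>n - j. if l = i then coeff (coeff P j) l else 0)"
  proof -
    have "coeff (coeff (infinity_chart n P) j) (n - j - i)
        = (\<Sum>l\<le>n - j. coeff (monom (coeff (coeff P j) l) (n - j - l)) (n - j - i))"
      using assms by (simp only: coeff_infinity_chart coeff_sum le_add2 add_leD2 if_True)
    also have "\<dots> = (\<Sum>l\<le>n - j. if l = i then coeff (coeff P j) l else 0)"
      using assms by (intro sum.cong) (auto simp: coeff_monom)
    finally show ?thesis .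
  qed
  also have "\<dots> = coeff (coeff P j) i" using assms by (subst sum.delta) auto
  finally show ?thesis .
qed

context rational_subfield
begin

lemma x_nonzero: "x \<noteq> 0"
  using xpoly_eq_0_iff[of "[:0, 1:]"] by simp

lemma iota_eq_0_iff: "\<iota> c = 0 \<longleftrightarrow> c = 0"
  using xpoly_eq_0_iff[of "[:c:]"] by simp

lemma degree_map_iota: "degree (map_poly \<iota> q) = degree q"
  by (rule degree_map_poly) (simp add: iota_eq_0_iff)

lemma eval_sum_bound:
  assumes "degree q \<le> n"
  shows "poly (map_poly \<iota> q) z = (\<Sum>i\<le>n. \<iota> (coeff q i) * z ^ i)"
proof -
  have "poly (map_poly \<iota> q) z = (\<Sum>i\<le>n. coeff (map_poly \<iota> q) i * z ^ i)"
    unfolding poly_altdef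
    by (rule sum.mono_neutral_left) (use assms in \<open>auto simp: coeff_eq_0 degree_map_iota iota_eq_0_iff\<close>)
  then show ?thesis by (simp add: coeff_map_poly)
qed

lemma eval2_sum_bound:
  assumes "degree P \<le> n"
  shows "eval2 \<iota> P u v = (\<Sum>j\<le>n. poly (map_poly \<iota> (coeff P j)) u * v ^ j)"
proof -
  let ?f = "\<lambda>q. poly (map_poly \<iota> q) u"
  have "eval2 \<iota> P u v = (\<Sum>j\<le>n. coeff (map_poly ?f P) j * v ^ j)"
    unfolding eval2_def poly_altdef
    by (rule sum.mono_neutral_left) (auto simp: coeff_eq_0 intro: order.trans[OF degree_map_poly_le assms])
  then show ?thesis by (simp add: coeff_map_poly)
qed

lemma eval2_infinity_chart:
  assumes td: "total_degree P \<le> n"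
  shows "eval2 \<iota> P x y = x ^ n * eval2 \<iota> (infinity_chart n P) (1 / x) (y / x)"
proof -
  have dP: "degree P \<le> n"
  proof (rule degree_le, intro allI impI)
    fix j assume "n < j"
    then show "coeff P j = 0" using coeff_eq_0_if_total_degree[OF td] by (intro poly_eqI) simp
  qed
  have dc: "degree (coeff P j) \<le> n - j" if "j \<le> n" for j
  proof (rule degree_le, intro allI impI)
    fix i assume "n - j < i"
    then show "coeff (coeff P j) i = 0" using that by (intro coeff_eq_0_if_total_degree[OF td]) simp
  qed
  have di: "degree (infinity_chart n P) \<le> n"
    by (rule degree_le) (simp add: coeff_infinity_chart)
  have c: "x ^ n * (poly (map_poly \<iota> (coeff (infinity_chart n P) j)) (1 / x) * (y / x) ^ j)
      = poly (map_poly \<iota> (coeff P j)) x * y ^ j" if j: "j \<le> n" for j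
  proof -
    interpret m: map_poly_idom_hom \<iota> ..
    have ev: "poly (map_poly \<iota> (coeff (infinity_chart n P) j)) (1 / x)
        = (\<Sum>i\<le>n - j. \<iota> (coeff (coeff P j) i) * (1 / x) ^ (n - j - i))"
      using j by (simp add: coeff_infinity_chart m.hom_sum poly_sum map_poly_monom poly_monom)
    have "x ^ n * ((1 / x) ^ (n - j - i) * (y / x) ^ j) = x ^ i * y ^ j" if "i \<le> n - j" for i
    proof -
      have "x ^ n = x ^ (n - j - i) * x ^ i * x ^ j" using that j by (simp flip: power_add)
      then show ?thesis using x_nonzero by (simp add: power_divide)
    qed
    note eq = this
    have "x ^ n * (poly (map_poly \<iota> (coeff (infinity_chart n P) j)) (1 / x) * (y / x) ^ j)
        = (\<Sum>i\<le>n - j. \<iota> (coeff (coeff P j) i) * (x ^ n * ((1 / x) ^ (n - j - i) * (y / x) ^ j)))"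
      unfolding ev sum_distrib_left sum_distrib_right by (rule sum.cong) (simp_all only: mult_ac)
    also have "\<dots> = (\<Sum>i\<le>n - j. \<iota> (coeff (coeff P j) i) * (x ^ i * y ^ j))"
      by (rule sum.cong) (simp_all only: eq atMost_iff)
    finally have "x ^ n * (poly (map_poly \<iota> (coeff (infinity_chart n P) j)) (1 / x) * (y / x) ^ j)
        = (\<Sum>i\<le>n - j. \<iota> (coeff (coeff P j) i) * (x ^ i * y ^ j))" .
    also have "\<dots> = poly (map_poly \<iota> (coeff P j)) x * y ^ j"
      unfolding eval_sum_bound[OF dc[OF j]] by (simp add: sum_distrib_right mult.assoc)
    finally show ?thesis .
  qed
  show ?thesis
    unfolding eval2_sum_bound[OF dP] eval2_sum_bound[OF di] sum_distrib_left
    by (rule sum.cong) (simp_all only: atMost_iff c)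
qed

text \<open>A relation for 1/x, multiplied by a power of x, is the reflected polynomial evaluated at
  x.\<close>

lemma transcendental_inverse: "transcendental_over \<iota> (1 / x)"
  unfolding transcendental_over_def
proof (intro allI impI)
  fix q :: "'k poly" assume q: "q \<noteq> 0"
  have "poly (map_poly \<iota> q) (1 / x) * x ^ degree q = xpoly (reflect_poly q)"
  proof -
    have "map_poly \<iota> (reflect_poly q) = reflect_poly (map_poly \<iota> q)"
      by (rule poly_eqI) (simp add: coeff_map_poly coeff_reflect_poly degree_map_iota)
    then show ?thesis
      using x_nonzero by (simp add: xpoly_def poly_reflect_poly_nz inverse_eq_divide mult.commute degree_map_iota)
  qed
  then show "poly (map_poly \<iota> q) (1 / x) \<noteq> 0"
    using q xpoly_eq_0_iff[of "reflect_poly q"] by auto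
qed

end

lemma infinity_chart_degree_y:
  assumes "total_degree P \<le> n"
  shows "degree (infinity_chart n P) \<le> n" "coeff (infinity_chart n P) n = [:coeff (coeff P n) 0:]"
proof -
  show "degree (infinity_chart n P) \<le> n" by (rule degree_le) (simp add: coeff_infinity_chart)
  show "coeff (infinity_chart n P) n = [:coeff (coeff P n) 0:]" by (simp add: coeff_infinity_chart monom_0)
qed

section \<open>The curve in the coordinates 1/x and y/x\<close>

locale projective_plane_curve = perfect_plane_curve_D \<iota> x y F D
  for \<iota> :: "'k::field \<Rightarrow> 'K::field" and x y F D +
  assumes total_degree_F: "total_degree F = degree F"
begin

abbreviation F' :: "'k poly poly" where "F' \<equiv> infinity_chart N F"

text \<open>The total degree forbids terms x^i y^N with i > 0, so the coefficient of y'^N in F' is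
  the constant 1. This is what makes the second chart a plane model of the same kind.\<close>

lemma degree_F': "degree F' = N" and monic_F': "lead_coeff F' = 1"
proof -
  have "coeff (coeff F N) i = (if i = 0 then 1 else 0)" for i
    using monic coeff_eq_0_if_total_degree[of F N i N] total_degree_F by auto
  then have c: "coeff F' N = 1"
    using infinity_chart_degree_y(2)[of F N] total_degree_F by (simp add: one_pCons)
  then have "N \<le> degree F'" by (intro le_degree) simp
  then show d: "degree F' = N" using infinity_chart_degree_y(1)[of F N] total_degree_F by simp
  then show "lead_coeff F' = 1" using c by simp
qed

lemma inverse_coordinates: "1 / (1 / x) = x" "(y / x) / (1 / x) = y"
  using x_nonzero by simp_all

sublocale inverse: rational_subfield \<iota> "1 / x"
  by unfold_locales (rule transcendental_inverse)

lemma eval2_inverse: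
  assumes "total_degree P \<le> n"
  shows "eval2 \<iota> P (1 / x) (y / x) = (1 / x) ^ n * eval2 \<iota> (infinity_chart n P) x y"
  using inverse.eval2_infinity_chart[OF assms, of "y / x"] unfolding inverse_coordinates .

text \<open>The change of coordinates is an involution, so a relation for 1/x and y/x becomes one
  for x and y after clearing powers of x, with no larger degree in y.\<close>

lemma homogeneous_relation:
  assumes P: "degree P < N" "eval2 \<iota> P (1 / x) (y / x) = 0"
  shows "P = 0"
proof -
  let ?n = "total_degree P"
  have "eval2 \<iota> (infinity_chart ?n P) x y = 0"
    using P(2) x_nonzero unfolding eval2_inverse[OF order.refl] by simp
  moreover have "degree (infinity_chart ?n P) < N"
    by (rule degree_lessI) (use P(1) N_pos in \<open>simp_all add: coeff_infinity_chart coeff_eq_0\<close>)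
  ultimately have 0: "infinity_chart ?n P = 0" by (intro no_smaller_relation)
  show ?thesis
  proof (rule poly_eqI, rule poly_eqI)
    fix j i
    show "coeff (coeff P j) i = coeff (coeff 0 j) i"
    proof (cases "i + j \<le> ?n")
      case True
      then show ?thesis using coeff_coeff_infinity_chart[of i j ?n P] by (simp add: 0)
    next
      case False
      then show ?thesis using coeff_eq_0_if_total_degree[of P ?n i j] by simp
    qed
  qed
qed

lemma quotients_at_infinity:
  "\<exists>P Q. eval2 \<iota> Q (1 / x) (y / x) \<noteq> 0 \<and> z = eval2 \<iota> P (1 / x) (y / x) / eval2 \<iota> Q (1 / x) (y / x)"
proof -
  interpret e: idom_hom "\<lambda>P. eval2 \<iota> P (1 / x) (y / x)" by (rule inverse.eval2_hom)
  obtain P Q where PQ: "eval2 \<iota> Q x y \<noteq> 0" "z = eval2 \<iota> P x y / eval2 \<iota> Q x y" using quotients by blast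
  let ?n = "total_degree P" and ?m = "total_degree Q"
  have xp: "eval2 \<iota> [:monom 1 l:] (1 / x) (y / x) = (1 / x) ^ l" for l
    by (simp add: inverse.xpoly_def map_poly_monom poly_monom)
  have p: "(1 / x) ^ ?n * eval2 \<iota> P x y = eval2 \<iota> (infinity_chart ?n P) (1 / x) (y / x)"
    and q: "(1 / x) ^ ?m * eval2 \<iota> Q x y = eval2 \<iota> (infinity_chart ?m Q) (1 / x) (y / x)"
    using eval2_infinity_chart[OF order.refl, of P y] eval2_infinity_chart[OF order.refl, of Q y] x_nonzero
    by (simp_all add: power_divide)
  let ?P = "[:monom 1 ?m:] * infinity_chart ?n P" and ?Q = "[:monom 1 ?n:] * infinity_chart ?m Q"
  have Pe: "eval2 \<iota> ?P (1 / x) (y / x) = (1 / x) ^ ?m * ((1 / x) ^ ?n * eval2 \<iota> P x y)"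
    unfolding e.hom_mult xp p ..
  have Qe: "eval2 \<iota> ?Q (1 / x) (y / x) = (1 / x) ^ ?n * ((1 / x) ^ ?m * eval2 \<iota> Q x y)"
    unfolding e.hom_mult xp q ..
  have "eval2 \<iota> ?Q (1 / x) (y / x) \<noteq> 0" unfolding Qe using PQ(1) x_nonzero by simp
  moreover have "z = eval2 \<iota> ?P (1 / x) (y / x) / eval2 \<iota> ?Q (1 / x) (y / x)"
    unfolding Pe Qe PQ(2) using x_nonzero by (simp add: power_divide)
  ultimately show ?thesis by blast
qed

text \<open>Differentiation in y lowers the total degree by one and commutes with the passage to the
  chart: both multiply the coefficient of y^(j+1) by j + 1.\<close>

lemma Fy_at_infinity: "Fy = x ^ (N - 1) * eval2 \<iota> (pderiv F') (1 / x) (y / x)"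
proof -
  have td: "total_degree F \<le> N" using total_degree_F by simp
  have "total_degree (pderiv F) \<le> N - 1"
  proof (rule total_degree_le)
    fix i j assume nz: "coeff (coeff (pderiv F) j) i \<noteq> 0"
    have "coeff (coeff F (Suc j)) i \<noteq> 0"
    proof
      assume "coeff (coeff F (Suc j)) i = 0"
      then show False using nz by (simp add: coeff_pderiv of_nat_poly flip: of_nat_Suc)
    qed
    then have "i + Suc j \<le> N" using coeff_eq_0_if_total_degree[OF td, of i "Suc j"] by (meson not_le)
    then show "i + j \<le> N - 1" by simp
  qed
  from eval2_infinity_chart[OF this, of y]
  have "Fy = x ^ (N - 1) * eval2 \<iota> (infinity_chart (N - 1) (pderiv F)) (1 / x) (y / x)" .
  also have "infinity_chart (N - 1) (pderiv F) = pderiv F'"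
  proof (rule poly_eqI)
    fix j
    have s: "monom (coeff (of_nat (Suc j) * coeff F (Suc j)) i) l = of_nat (Suc j) * monom (coeff (coeff F (Suc j)) i) l" for i l
      by (simp add: of_nat_poly smult_monom del: of_nat_Suc)
    show "coeff (infinity_chart (N - 1) (pderiv F)) j = coeff (pderiv F') j"
      using N_pos by (simp add: coeff_infinity_chart coeff_pderiv s sum_distrib_left del: of_nat_Suc)
  qed
  finally show ?thesis .
qed

lemma separable_at_infinity: "separable_plane_curve \<iota> (1 / x) (y / x) F'"
proof unfold_locales
  show "lead_coeff F' = 1" by (rule monic_F')
  have "x ^ N * eval2 \<iota> F' (1 / x) (y / x) = 0"
    using eval2_infinity_chart[of F N y] total_degree_F root by simp
  then show "eval2 \<iota> F' (1 / x) (y / x) = 0" using x_nonzero by simp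
  show "P = 0" if "degree P < degree F'" "eval2 \<iota> P (1 / x) (y / x) = 0" for P
    using homogeneous_relation that by (simp add: degree_F')
  show "\<exists>P Q. eval2 \<iota> Q (1 / x) (y / x) \<noteq> 0 \<and> z = eval2 \<iota> P (1 / x) (y / x) / eval2 \<iota> Q (1 / x) (y / x)" for z
    by (rule quotients_at_infinity)
  show "eval2 \<iota> (pderiv F') (1 / x) (y / x) \<noteq> 0"
    using Fy_at_infinity Fy_nonzero by auto
qed

definition D' :: "'K \<Rightarrow> 'K" where "D' z = - (x ^ 2) * D z"

lemma derivation_at_infinity: "derivation_d_dx \<iota> (1 / x) D'"
proof unfold_locales
  have "D (1 / x) = - 1 / x ^ 2"
    using D_divide[OF x_nonzero, of 1] by (simp add: D_one D_x)
  then show "D' (1 / x) = 1" using x_nonzero by (simp add: D'_def)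
qed (simp_all add: D'_def D_add D_mult D_const algebra_simps)

sublocale infinity: perfect_plane_curve_D \<iota> "1 / x" "y / x" F' D'
proof -
  interpret s: separable_plane_curve \<iota> "1 / x" "y / x" F' by (rule separable_at_infinity)
  interpret d: derivation_d_dx \<iota> "1 / x" D' by (rule derivation_at_infinity)
  show "perfect_plane_curve_D \<iota> (1 / x) (y / x) F' D'"
    by unfold_locales (rule perfect_field)
qed

lemma D_module_at_infinity: "f \<in> D_module R \<longleftrightarrow> - (x ^ 2) * f \<in> infinity.D_module R"
proof -
  have "infinity.D_comb v = - (x ^ 2) * D_comb v" for v
    unfolding D_comb_def infinity.D_comb_def D'_def sum_distrib_left by (rule sum.cong) (simp_all add: mult_ac)
  then show ?thesis unfolding D_module_def infinity.D_module_def using x_nonzero by simp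
qed

text \<open>f dx = -x^2 f dx' and F_y = x^(N-1) F'_y' combine to the exponent N - 3, possibly
  negative, whence the integer power. The sign is absorbed because the conductor is closed under
  negation.\<close>

lemma conductor_at_infinity:
  "infinity.Fy * (- (x ^ 2) * f) \<in> conductor infinity.A \<longleftrightarrow>
   Fy * f / x powi (int N - 3) \<in> conductor infinity.A"
proof -
  have "x powi (int N - 3) = x powi (int (N - 1) - int 2)" using N_pos by (simp add: of_nat_diff)
  also have "\<dots> = x ^ (N - 1) / x ^ 2"
    using x_nonzero by (subst power_int_diff) (simp_all only: power_int_of_nat, simp)
  finally have "Fy * f / x powi (int N - 3) = - 1 * (infinity.Fy * (- (x ^ 2) * f))"
    unfolding Fy_at_infinity using x_nonzero by simp
  moreover have neg: "- 1 * z \<in> conductor infinity.A" if "z \<in> conductor infinity.A" for z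
    by (rule infinity.conductor_module[OF that inverse.kx_bar.uminus_mem[OF inverse.kx_bar.one_mem]])
  ultimately show ?thesis
    using neg[of "infinity.Fy * (- (x ^ 2) * f)"] neg[of "- 1 * (infinity.Fy * (- (x ^ 2) * f))"] by auto
qed

lemma regular_at_infinity:
  "(\<forall>P. primeideal P infinity.kx_bar_ring \<longrightarrow> f \<in> D_module (localization inverse.kx_bar P))
   \<longleftrightarrow> Fy * f / x powi (int N - 3) \<in> conductor infinity.A"
  unfolding D_module_at_infinity infinity.regular_everywhere_iff_conductor conductor_at_infinity ..

text \<open>Writing the element as P(x,y) and, after division by x^(N-3), as Q(1/x, y/x), and
  clearing denominators, gives x^(n+3) P = x^N times the chart polynomial of Q with n =
  \<open>total_degree Q\<close>. Comparing exponents bounds those of P.\<close>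

lemma degree_bound:
  assumes \<phi>: "\<phi> \<in> A" and \<phi>': "\<phi> / x powi (int N - 3) \<in> infinity.A"
  shows "\<exists>P. \<phi> = eval2 \<iota> P x y \<and> (P = 0 \<or> int (total_degree P) \<le> int N - 3)"
proof -
  obtain P where P: "degree P < N" "\<phi> = eval2 \<iota> P x y" using \<phi> by (rule A_cases)
  obtain Q where Q: "degree Q < N" "\<phi> / x powi (int N - 3) = eval2 \<iota> Q (1 / x) (y / x)"
    using \<phi>' by (rule infinity.A_cases) (simp add: degree_F')
  let ?n = "total_degree Q"
  have xm: "eval2 \<iota> [:monom 1 l:] x y = x ^ l" for l
    by (simp add: xpoly_def map_poly_monom poly_monom)
  have "x powi (int N - 3) = x powi (int N - int 3)" by simp
  also have "\<dots> = x ^ N / x ^ 3"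
    using x_nonzero by (subst power_int_diff) (simp_all only: power_int_of_nat, simp)
  finally have pw: "x powi (int N - 3) = x ^ N / x ^ 3" .
  have "\<phi> * x ^ 3 = x ^ N * ((1 / x) ^ ?n * eval2 \<iota> (infinity_chart ?n Q) x y)"
    using Q(2) x_nonzero unfolding eval2_inverse[OF order.refl] pw by (simp add: divide_eq_eq mult.commute)
  then have eq: "\<phi> * x ^ 3 * x ^ ?n = x ^ N * eval2 \<iota> (infinity_chart ?n Q) x y"
    using x_nonzero by (simp add: power_divide)
  let ?L = "[:monom 1 (?n + 3):] * P" and ?R = "[:monom 1 N:] * infinity_chart ?n Q"
  have "eval2 \<iota> (?L - ?R) x y = 0"
    unfolding ev.hom_minus ev.hom_mult xm P(2)[symmetric] using eq by (simp add: power_add mult_ac)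
  \<comment> \<open>Both sides have degree below \<open>N\<close> in y, so the equality of values is
    an equality of polynomials and not merely one modulo F.\<close>
  moreover have "degree (?L - ?R) < N"
    by (rule degree_lessI) (use P(1) Q(1) N_pos in \<open>simp_all add: coeff_infinity_chart coeff_eq_0\<close>)
  ultimately have "?L - ?R = 0" by (intro no_smaller_relation)
  then have LR: "?L = ?R" by simp
  have bound: "i + j + 3 \<le> N" if nz: "coeff (coeff P j) i \<noteq> 0" for i j
  proof -
    have "coeff (coeff ?L j) (i + (?n + 3)) = coeff (coeff P j) i"
      by (simp add: coeff_monom_mult)
    then have r: "coeff (monom 1 N * coeff (infinity_chart ?n Q) j) (i + (?n + 3)) \<noteq> 0"
      using nz unfolding LR by simp
    then have le: "N \<le> i + (?n + 3)" and nz': "coeff (coeff (infinity_chart ?n Q) j) (i + (?n + 3) - N) \<noteq> 0"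
      by (auto simp: coeff_monom_mult split: if_splits)
    have jn: "j \<le> ?n" using nz' by (auto simp: coeff_infinity_chart split: if_splits)
    have "i + (?n + 3) - N \<le> ?n - j"
    proof (rule ccontr)
      assume "\<not> i + (?n + 3) - N \<le> ?n - j"
      then have "coeff (coeff (infinity_chart ?n Q) j) (i + (?n + 3) - N) = 0"
        using jn by (auto simp: coeff_infinity_chart coeff_sum coeff_monom intro!: sum.neutral)
      then show False using nz' by simp
    qed
    then show ?thesis using le jn by simp
  qed
  have "P = 0 \<or> int (total_degree P) \<le> int N - 3"
  proof (cases "P = 0")
    case False
    then obtain j where "coeff P j \<noteq> 0" by (auto simp: poly_eq_iff)
    then obtain i where "coeff (coeff P j) i \<noteq> 0" by (auto simp: poly_eq_iff)
    \<comment> \<open>A nonzero coefficient forces N to be at least 3, so the natural number N - 3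
      is the true difference.\<close>
    then have "3 \<le> N" using bound by fastforce
    moreover have "total_degree P \<le> N - 3"
      by (rule total_degree_le) (use bound in fastforce)
    ultimately have "int (total_degree P) \<le> int N - 3" by linarith
    then show ?thesis ..
  qed simp
  then show ?thesis using P(2) by blast
qed

end

section \<open>The third chart\<close>

lemma coord_ring_least:
  assumes \<iota>: "idom_hom \<iota>" and S: "unital_subring S" and "\<And>c. \<iota> c \<in> S" "u \<in> S" "v \<in> S"
  shows "coord_ring \<iota> u v \<subseteq> S"
proof -
  interpret idom_hom \<iota> by fact
  interpret unital_subring S by fact
  have "poly (map_poly \<iota> q) u \<in> S" for q
    by (rule poly_mem) (simp_all add: coeff_map_poly assms)
  then have "eval2 \<iota> P u v \<in> S" for P
    unfolding eval2_def by (intro poly_mem) (simp_all add: coeff_map_poly assms)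
  then show ?thesis by (auto simp: coord_ring_def)
qed

text \<open>For the third chart x/y may be algebraic over k, so the facts on coordinate rings over a
  transcendental first coordinate do not apply.\<close>

lemma coord_ring_generated:
  assumes "idom_hom \<iota>"
  shows "field_subring (coord_ring \<iota> u v)" and "u \<in> coord_ring \<iota> u v" and "v \<in> coord_ring \<iota> u v"
    and "\<iota> c \<in> coord_ring \<iota> u v"
proof -
  interpret idom_hom \<iota> by fact
  interpret m: map_poly_idom_hom \<iota> ..
  interpret e: idom_hom "\<lambda>q. poly (map_poly \<iota> q) u"
    by unfold_locales (simp_all add: m.hom_add m.hom_mult)
  interpret m2: map_poly_idom_hom "\<lambda>q. poly (map_poly \<iota> q) u" ..
  interpret ev: idom_hom "\<lambda>P. eval2 \<iota> P u v"
    by unfold_locales (simp_all add: eval2_def m2.hom_add m2.hom_mult)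
  have mem: "eval2 \<iota> P u v \<in> coord_ring \<iota> u v" for P by (auto simp: coord_ring_def)
  show "field_subring (coord_ring \<iota> u v)"
  proof
    show "1 \<in> coord_ring \<iota> u v" using mem[of 1] by simp
    show "a - b \<in> coord_ring \<iota> u v" "a * b \<in> coord_ring \<iota> u v"
      if "a \<in> coord_ring \<iota> u v" "b \<in> coord_ring \<iota> u v" for a b
      using that unfolding coord_ring_def by (auto simp flip: ev.hom_minus ev.hom_mult)
  qed
  show "u \<in> coord_ring \<iota> u v"
    using mem[of "[:[:0, 1:]:]"] by (simp add: eval2_def Polynomial.map_poly_pCons)
  show "v \<in> coord_ring \<iota> u v"
    using mem[of "[:0, 1:]"] by (simp add: eval2_def Polynomial.map_poly_pCons)
  show "\<iota> c \<in> coord_ring \<iota> u v"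
    using mem[of "[:[:c:]:]"] by (simp add: eval2_def Polynomial.map_poly_pCons)
qed

context field_subring
begin

lemma subring_with_denominators:
  assumes v: "v \<in> S"
  shows "unital_subring {a. \<exists>m. v ^ m * a \<in> S}"
proof
  show "1 \<in> {a. \<exists>m. v ^ m * a \<in> S}" using one_mem by (auto intro!: exI[of _ 0])
  fix a b assume "a \<in> {a. \<exists>m. v ^ m * a \<in> S}" "b \<in> {a. \<exists>m. v ^ m * a \<in> S}"
  then obtain m n where mn: "v ^ m * a \<in> S" "v ^ n * b \<in> S" by blast
  have "v ^ (m + n) * (a - b) = v ^ n * (v ^ m * a) - v ^ m * (v ^ n * b)"
    by (simp add: power_add algebra_simps)
  also have "\<dots> \<in> S" by (intro diff_mem mult_mem power_mem v mn)
  finally show "a - b \<in> {a. \<exists>m. v ^ m * a \<in> S}" by blast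
  have "v ^ (m + n) * (a * b) = (v ^ m * a) * (v ^ n * b)"
    by (simp add: power_add mult_ac)
  also have "\<dots> \<in> S" by (intro mult_mem mn)
  finally show "a * b \<in> {a. \<exists>m. v ^ m * a \<in> S}" by blast
qed

text \<open>One power v^M clears all coefficients of a monic equation of z. Scaling the roots by v^M
  then gives a monic equation over S.\<close>

lemma integral_closure_denominators:
  assumes v: "v \<in> S" and B: "\<And>b. b \<in> B \<Longrightarrow> \<exists>m. v ^ m * b \<in> S" and z: "z \<in> integral_closure B"
  shows "\<exists>m. v ^ m * z \<in> integral_closure S"
proof -
  obtain q where q: "lead_coeff q = 1" "\<And>i. coeff q i \<in> B" "poly q z = 0"
    using z by (rule integral_closureE) (rule that)
  let ?n = "degree q"
  have "\<forall>i. \<exists>m. v ^ m * coeff q i \<in> S" using B q(2) by simp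
  then obtain m where m: "\<forall>i. v ^ (m i) * coeff q i \<in> S" by (rule choice[elim_format]) (elim exE)
  define M where "M = (\<Sum>i\<le>?n. m i)"
  have vM: "v ^ M * coeff q i \<in> S" if "i \<le> ?n" for i
  proof -
    have le: "m i \<le> M" unfolding M_def by (rule member_le_sum) (use that in auto)
    have "v ^ M * coeff q i = v ^ (M - m i) * (v ^ m i * coeff q i)"
      unfolding mult.assoc[symmetric] power_add[symmetric] using le by simp
    also have "\<dots> \<in> S" by (rule mult_mem[OF power_mem[OF v]]) (simp add: m)
    finally show ?thesis .
  qed
  \<comment> \<open>The polynomial with roots scaled by v^M: coefficient i acquires v^(M (n - i)),
    which suffices for every i < n and leaves the leading coefficient 1.\<close>
  define r where "r = (\<Sum>i\<le>?n. monom (v ^ (M * (?n - i)) * coeff q i) i)"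
  have cr: "coeff r i = (if i \<le> ?n then v ^ (M * (?n - i)) * coeff q i else 0)" for i
  proof -
    have "coeff r i = (\<Sum>l\<le>?n. if l = i then v ^ (M * (?n - l)) * coeff q l else 0)"
      by (simp add: r_def coeff_sum coeff_monom)
    then show ?thesis by (simp only: sum.delta[OF finite_atMost] atMost_iff)
  qed
  have "degree r \<le> ?n" by (rule degree_le) (simp add: cr)
  moreover have cn: "coeff r ?n = 1" using q(1) by (simp add: cr)
  ultimately have "degree r = ?n" by (metis le_degree le_antisym zero_neq_one)
  then have "lead_coeff r = 1" using cn by simp
  moreover have "coeff r i \<in> S" for i
  proof (cases "i < ?n")
    case True
    then obtain d where d: "?n - i = Suc d" by (metis Suc_diff_Suc)
    have "coeff r i = v ^ (M * d) * (v ^ M * coeff q i)"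
      using True by (simp add: cr d power_add mult_ac)
    also have "\<dots> \<in> S" using True by (intro mult_mem power_mem v vM) simp
    finally show ?thesis .
  next
    case False
    then show ?thesis using cn one_mem zero_mem by (cases "i = ?n") (auto simp: cr)
  qed
  moreover have "poly r (v ^ M * z) = 0"
  proof -
    have "poly r (v ^ M * z) = (\<Sum>i\<le>?n. v ^ (M * (?n - i)) * coeff q i * (v ^ M * z) ^ i)"
      by (simp add: r_def poly_sum poly_monom)
    also have "\<dots> = (\<Sum>i\<le>?n. v ^ (M * ?n) * (coeff q i * z ^ i))"
    proof (rule sum.cong)
      fix i assume "i \<in> {..?n}"
      then have "v ^ (M * ?n) = v ^ (M * (?n - i)) * v ^ (M * i)"
        by (simp flip: power_add distrib_left)
      then show "v ^ (M * (?n - i)) * coeff q i * (v ^ M * z) ^ i = v ^ (M * ?n) * (coeff q i * z ^ i)"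
        by (simp add: power_mult_distrib power_mult[symmetric] mult_ac)
    qed simp
    also have "\<dots> = 0" using q(3) by (simp add: poly_altdef flip: sum_distrib_left)
    finally show ?thesis .
  qed
  ultimately have "v ^ M * z \<in> integral_closure S" by (intro integral_closureI)
  then show ?thesis ..
qed

end

text \<open>
  The spectrum of the integral closure of \<open>B\<close> contains the nonvanishing locus of \<open>v\<close> in the spectrum of
  the integral closure of \<open>C\<close>, as soon as \<open>B \<subseteq> C[1/v]\<close>.
\<close>

lemma localization_other_chart:
  assumes B: "field_subring B" and C: "field_subring C"
    and P: "primeideal P (ring_of_type_algebra\<lparr>carrier := integral_closure C\<rparr>)"
    and v: "v \<in> C" "v \<notin> P" and BC: "\<And>b. b \<in> B \<Longrightarrow> \<exists>m. v ^ m * b \<in> C"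
  shows "\<exists>Q. primeideal Q (ring_of_type_algebra\<lparr>carrier := integral_closure B\<rparr>) \<and>
    localization (integral_closure B) Q \<subseteq> localization (integral_closure C) P"
proof -
  interpret C: field_subring C by fact
  interpret CC: field_subring "integral_closure C" by (rule C.field_subring_integral_closure)
  interpret BB: field_subring "integral_closure B" by (rule field_subring.field_subring_integral_closure[OF B])
  from P have P: "P \<subseteq> integral_closure C" "0 \<in> P" "\<forall>u\<in>P. \<forall>w\<in>P. u + w \<in> P"
    "\<forall>a\<in>integral_closure C. \<forall>u\<in>P. a * u \<in> P" "1 \<notin> P"
    "\<forall>a\<in>integral_closure C. \<forall>b\<in>integral_closure C. a * b \<in> P \<longrightarrow> a \<in> P \<or> b \<in> P"
    unfolding primeideal_subring_iff[OF CC.unital_subring_axioms] by blast+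
  note P_add = bspec[OF bspec[OF P(3)]] and P_mult = bspec[OF bspec[OF P(4)]]
    and P_prime = mp[OF bspec[OF bspec[OF P(6)]]]
  have vC: "v \<in> integral_closure C" using v(1) C.subset_integral_closure by blast
  have vpow: "v ^ m \<in> integral_closure C" for m by (rule CC.power_mem[OF vC])
  have v0: "v \<noteq> 0" using v(2) P(2) by blast
  have pow: "v ^ m \<notin> P" for m
  proof (induction m)
    case (Suc m)
    then show ?case using P_prime[OF vC vpow[of m]] v(2) by (metis power_Suc)
  qed (simp add: P(5))
  have den: "\<exists>m. v ^ m * z \<in> integral_closure C" if "z \<in> integral_closure B" for z
    by (rule C.integral_closure_denominators[OF v(1) BC that])
  \<comment> \<open>The contraction to the closure of B of the prime that P generates after v is
    inverted.\<close>
  define Q where "Q = {z \<in> integral_closure B. \<exists>m. v ^ m * z \<in> P}"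
  have QI: "z \<in> Q" if "z \<in> integral_closure B" "v ^ m * z \<in> P" for z m
    using that unfolding Q_def by (intro CollectI conjI exI[of _ m])
  have QE: "\<exists>m. v ^ m * z \<in> P" and QB: "z \<in> integral_closure B" if "z \<in> Q" for z
    using that unfolding Q_def by simp_all
  have "primeideal Q (ring_of_type_algebra\<lparr>carrier := integral_closure B\<rparr>)"
    unfolding primeideal_subring_iff[OF BB.unital_subring_axioms]
  proof (intro conjI ballI impI)
    show "Q \<subseteq> integral_closure B" using QB by (rule subsetI)
    show "0 \<in> Q" by (rule QI[of 0 0]) (simp_all add: BB.zero_mem P(2))
    show "1 \<notin> Q"
    proof
      assume "1 \<in> Q"
      from QE[OF this] obtain m where "v ^ m * 1 \<in> P" by (elim exE)
      then show False using pow[of m] by simp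
    qed
    fix u w
    show "u + w \<in> Q" if u: "u \<in> Q" and w: "w \<in> Q"
    proof -
      obtain m where m: "v ^ m * u \<in> P" using QE[OF u] by (elim exE)
      obtain n where n: "v ^ n * w \<in> P" using QE[OF w] by (elim exE)
      have "v ^ (m + n) * (u + w) = v ^ n * (v ^ m * u) + v ^ m * (v ^ n * w)"
        by (simp add: power_add algebra_simps)
      also have "\<dots> \<in> P" by (intro P_add P_mult vpow m n)
      finally show ?thesis by (rule QI[OF BB.add_mem[OF QB[OF u] QB[OF w]]])
    qed
    show "u * w \<in> Q" if u: "u \<in> integral_closure B" and w: "w \<in> Q"
    proof -
      obtain m where m: "v ^ m * u \<in> integral_closure C" using den[OF u] by (elim exE)
      obtain n where n: "v ^ n * w \<in> P" using QE[OF w] by (elim exE)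
      have "v ^ (m + n) * (u * w) = (v ^ m * u) * (v ^ n * w)"
        by (simp add: power_add mult_ac)
      also have "\<dots> \<in> P" by (rule P_mult[OF m n])
      finally show ?thesis by (rule QI[OF BB.mult_mem[OF u QB[OF w]]])
    qed
    show "u \<in> Q \<or> w \<in> Q" if u: "u \<in> integral_closure B" and w: "w \<in> integral_closure B" and uw: "u * w \<in> Q"
    proof -
      obtain l where l: "v ^ l * (u * w) \<in> P" using QE[OF uw] by (elim exE)
      obtain m where m: "v ^ m * u \<in> integral_closure C" using den[OF u] by (elim exE)
      obtain n where n: "v ^ n * w \<in> integral_closure C" using den[OF w] by (elim exE)
      have "v ^ l * ((v ^ m * u) * (v ^ n * w)) = (v ^ m * v ^ n) * (v ^ l * (u * w))"
        by (simp only: mult_ac)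
      also have "\<dots> \<in> P" by (rule P_mult[OF CC.mult_mem[OF vpow vpow] l])
      finally have "(v ^ m * u) * (v ^ n * w) \<in> P"
        using P_prime[OF vpow[of l] CC.mult_mem[OF m n]] pow[of l] by blast
      from P_prime[OF m n this] show ?thesis
      proof
        assume "v ^ m * u \<in> P"
        from QI[OF u this] show ?thesis ..
      next
        assume "v ^ n * w \<in> P"
        from QI[OF w this] show ?thesis ..
      qed
    qed
  qed
  moreover have "localization (integral_closure B) Q \<subseteq> localization (integral_closure C) P"
  proof
    fix z assume "z \<in> localization (integral_closure B) Q"
    then obtain a s where as: "z = a / s" "a \<in> integral_closure B" "s \<in> integral_closure B" "s \<notin> Q"
      by (auto simp: localization_def)
    obtain m where m: "v ^ m * a \<in> integral_closure C" using den[OF as(2)] by (elim exE)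
    obtain n where n: "v ^ n * s \<in> integral_closure C" using den[OF as(3)] by (elim exE)
    have "v ^ m * (v ^ n * s) \<notin> P"
      using QI[OF as(3), of "m + n"] as(4) by (auto simp: power_add mult.assoc)
    moreover have "z = (v ^ n * (v ^ m * a)) / (v ^ m * (v ^ n * s))"
      using v0 unfolding as(1) by simp
    moreover have "v ^ n * (v ^ m * a) \<in> integral_closure C" "v ^ m * (v ^ n * s) \<in> integral_closure C"
      by (intro CC.mult_mem vpow m n)+
    ultimately show "z \<in> localization (integral_closure C) P" unfolding localization_def by blast
  qed
  ultimately show ?thesis by blast
qed

context projective_plane_curve
begin

text \<open>Dividing F(x,y) = 0 by y^N gives 1 plus monomials of positive degree in x/y and 1/y. So
  a prime cannot contain both coordinates, and at any prime one of them can be inverted, which leads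
  to one of the other two charts.\<close>

lemma third_chart:
  assumes y: "y \<noteq> 0"
    and P: "primeideal P (ring_of_type_algebra\<lparr>carrier := integral_closure (coord_ring \<iota> (x / y) (1 / y))\<rparr>)"
  shows "\<exists>B\<in>{A, infinity.A}. \<exists>Q. primeideal Q (ring_of_type_algebra\<lparr>carrier := integral_closure B\<rparr>) \<and>
    localization (integral_closure B) Q \<subseteq> localization (integral_closure (coord_ring \<iota> (x / y) (1 / y))) P"
proof -
  let ?C = "coord_ring \<iota> (x / y) (1 / y)"
  note C = coord_ring_generated[OF base.idom_hom_axioms, where u = "x / y" and v = "1 / y"]
  interpret C: field_subring ?C by (rule C(1))
  have den: "\<exists>m. v ^ m * b \<in> ?C"
    if v: "v \<in> ?C" and st: "v * s \<in> ?C" "v * t \<in> ?C" and b: "b \<in> coord_ring \<iota> s t" for v s t b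
  proof -
    let ?S = "{a. \<exists>m. v ^ m * a \<in> ?C}"
    have "\<iota> c \<in> ?S" for c using C(4) by (auto intro!: exI[of _ 0])
    moreover have "s \<in> ?S" "t \<in> ?S" using st by (auto intro!: exI[of _ 1])
    ultimately have "coord_ring \<iota> s t \<subseteq> ?S"
      by (intro coord_ring_least base.idom_hom_axioms C.subring_with_denominators v)
    then show ?thesis using b by blast
  qed
  consider "1 / y \<notin> P" | "x / y \<notin> P" | "1 / y \<in> P" "x / y \<in> P" by blast
  then show ?thesis
  proof cases
    case 1
    have "\<exists>m. (1 / y) ^ m * b \<in> ?C" if "b \<in> A" for b
      by (rule den[OF C(3) _ _ that]) (use y C(2) C.one_mem in simp_all)
    from localization_other_chart[OF A.field_subring_axioms C(1) P C(3) 1 this]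
    show ?thesis by (rule bexI[where x = A]) simp_all
  next
    case 2
    have "\<exists>m. (x / y) ^ m * b \<in> ?C" if "b \<in> infinity.A" for b
      by (rule den[OF C(2) _ _ that]) (use y x_nonzero C(3) C.one_mem in simp_all)
    from localization_other_chart[OF infinity.A.field_subring_axioms C(1) P C(2) 2 this]
    show ?thesis by (rule bexI[where x = infinity.A]) simp_all
  next
    case 3
    let ?CC = "integral_closure ?C"
    interpret CC: field_subring ?CC by (rule C.field_subring_integral_closure)
    from P have P: "P \<subseteq> ?CC" "0 \<in> P" "\<forall>u\<in>P. \<forall>w\<in>P. u + w \<in> P"
      "\<forall>a\<in>?CC. \<forall>u\<in>P. a * u \<in> P" "1 \<notin> P"
      unfolding primeideal_subring_iff[OF CC.unital_subring_axioms] by blast+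
    note P_add = bspec[OF bspec[OF P(3)]] and P_mult = bspec[OF bspec[OF P(4)]]
    have CCI: "a \<in> ?CC" if "a \<in> ?C" for a using that C.subset_integral_closure by blast
    have P_sum: "sum f I \<in> P" if "\<And>i. i \<in> I \<Longrightarrow> f i \<in> P" for f :: "nat \<Rightarrow> 'K" and I
      using that
    proof (induction I rule: infinite_finite_induct)
      case (insert i I)
      show ?case unfolding sum.insert[OF insert.hyps]
        by (rule P_add[OF insert.prems[OF insertI1] insert.IH]) (rule insert.prems[OF insertI2])
    qed (simp_all add: P(2))
    have pow: "u ^ Suc k \<in> P" if "u \<in> P" for u k
      unfolding power_Suc2 by (rule P_mult[OF CC.power_mem that]) (use that P(1) in blast)
    have monomial: "\<iota> c * ((x / y) ^ i * (1 / y) ^ l) \<in> P" if il: "0 < i + l" for c i l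
    proof -
      have "(x / y) ^ i * (1 / y) ^ l \<in> P"
      proof (cases i)
        case 0
        then obtain l' where "l = Suc l'" using il by (cases l) simp_all
        then show ?thesis using pow[OF 3(1), of l'] 0 by simp
      next
        case (Suc i')
        have "(1 / y) ^ l * (x / y) ^ i \<in> P"
          unfolding Suc by (rule P_mult[OF CC.power_mem[OF CCI[OF C(3)]] pow[OF 3(2)]])
        then show ?thesis by (simp only: mult.commute)
      qed
      then show ?thesis by (rule P_mult[OF CCI[OF C(4)]])
    qed
    have td: "total_degree F \<le> N" using total_degree_F by simp
    have le: "degree (coeff F j) \<le> N - j" if "j \<le> N" for j
    proof (rule degree_le, intro allI impI)
      fix i assume "N - j < i"
      then show "coeff (coeff F j) i = 0" using that by (intro coeff_eq_0_if_total_degree[OF td]) simp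
    qed
    \<comment> \<open>The monomial x^i y^j / y^N is (x/y)^i (1/y)^(N-j-i), of total degree N - j >
      0; only j = N escapes and yields the 1.\<close>
    have summand: "(1 / y) ^ N * (poly (map_poly \<iota> (coeff F j)) x * y ^ j) \<in> P" if j: "j < N" for j
    proof -
      have "(1 / y) ^ N * (poly (map_poly \<iota> (coeff F j)) x * y ^ j)
          = (\<Sum>i\<le>N - j. \<iota> (coeff (coeff F j) i) * ((1 / y) ^ N * (x ^ i * y ^ j)))"
        unfolding eval_sum_bound[OF le[OF less_imp_le[OF j]]] sum_distrib_left sum_distrib_right
        by (rule sum.cong) (simp_all only: mult_ac)
      also have "\<dots> = (\<Sum>i\<le>N - j. \<iota> (coeff (coeff F j) i) * ((x / y) ^ i * (1 / y) ^ (N - j - i)))"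
      proof (rule sum.cong)
        fix i assume "i \<in> {..N - j}"
        then have "y ^ N = y ^ (N - j - i) * y ^ i * y ^ j" using j by (simp flip: power_add)
        then have "(1 / y) ^ N * (x ^ i * y ^ j) = (x / y) ^ i * (1 / y) ^ (N - j - i)"
          using y by (simp add: power_divide)
        then show "\<iota> (coeff (coeff F j) i) * ((1 / y) ^ N * (x ^ i * y ^ j))
            = \<iota> (coeff (coeff F j) i) * ((x / y) ^ i * (1 / y) ^ (N - j - i))" by (simp only:)
      qed simp
      also have "\<dots> \<in> P" by (rule P_sum, rule monomial) (use j in simp)
      finally show ?thesis .
    qed
    have "0 = (1 / y) ^ N * eval2 \<iota> F x y" by (simp add: root)
    also have "\<dots> = (\<Sum>j\<le>N. (1 / y) ^ N * (poly (map_poly \<iota> (coeff F j)) x * y ^ j))"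
      unfolding eval2_sum_bound[OF order.refl] sum_distrib_left ..
    also have "\<dots> = (\<Sum>j<N. (1 / y) ^ N * (poly (map_poly \<iota> (coeff F j)) x * y ^ j)) + 1"
      unfolding lessThan_Suc_atMost[symmetric] using y monic by (simp add: power_divide)
    finally have "(\<Sum>j<N. (1 / y) ^ N * (poly (map_poly \<iota> (coeff F j)) x * y ^ j)) + 1 = 0" by (rule sym)
    then have one: "(- 1) * (\<Sum>j<N. (1 / y) ^ N * (poly (map_poly \<iota> (coeff F j)) x * y ^ j)) = 1"
      unfolding mult_minus1 by (rule minus_unique)
    have "(- 1) * (\<Sum>j<N. (1 / y) ^ N * (poly (map_poly \<iota> (coeff F j)) x * y ^ j)) \<in> P"
      by (rule P_mult[OF CC.uminus_mem[OF CC.one_mem]], rule P_sum, rule summand) simp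
    then have "1 \<in> P" unfolding one .
    with P(5) show ?thesis by (rule notE)
  qed
qed

text \<open>Each local ring of the third chart contains a local ring of one of the other two, and
  regularity is inherited by larger rings.\<close>

theorem global_regular_form_iff:
  "(\<forall>R\<in>normalization_local_rings \<iota> x y. regular_at \<iota> R (form \<iota> f x)) \<longleftrightarrow>
   Fy * f \<in> conductor A \<and> Fy * f / x powi (int N - 3) \<in> conductor infinity.A"
proof -
  let ?reg = "\<lambda>B. \<forall>P. primeideal P (ring_of_type_algebra\<lparr>carrier := integral_closure B\<rparr>) \<longrightarrow>
      f \<in> D_module (localization (integral_closure B) P)"
  have A: "?reg A \<longleftrightarrow> Fy * f \<in> conductor A"
    unfolding integral_closure_A by (rule regular_everywhere_iff_conductor)
  have A': "?reg infinity.A \<longleftrightarrow> Fy * f / x powi (int N - 3) \<in> conductor infinity.A"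
    unfolding infinity.integral_closure_A by (rule regular_at_infinity)
  have C: "?reg (coord_ring \<iota> (x / y) (1 / y))" if "?reg A" "?reg infinity.A" "y \<noteq> 0"
  proof (intro allI impI)
    fix P assume "primeideal P (ring_of_type_algebra\<lparr>carrier := integral_closure (coord_ring \<iota> (x / y) (1 / y))\<rparr>)"
    from third_chart[OF that(3) this] obtain B Q where B: "B \<in> {A, infinity.A}"
      and Q: "primeideal Q (ring_of_type_algebra\<lparr>carrier := integral_closure B\<rparr>)"
        "localization (integral_closure B) Q \<subseteq> localization (integral_closure (coord_ring \<iota> (x / y) (1 / y))) P"
      by (elim bexE exE conjE)
    have "?reg B" using B that(1,2) by blast
    then have "f \<in> D_module (localization (integral_closure B) Q)" using Q(1) by blast
    then show "f \<in> D_module (localization (integral_closure (coord_ring \<iota> (x / y) (1 / y))) P)"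
      using D_module_mono[OF Q(2)] by blast
  qed
  have "(\<forall>R\<in>normalization_local_rings \<iota> x y. regular_at \<iota> R (form \<iota> f x)) \<longleftrightarrow>
      (\<forall>B\<in>closure_charts \<iota> x y. ?reg B)"
    unfolding regular_at_form_iff normalization_local_rings_def by blast
  also have "\<dots> \<longleftrightarrow> ?reg A \<and> ?reg infinity.A"
  proof
    assume "\<forall>B\<in>closure_charts \<iota> x y. ?reg B"
    moreover have "A \<in> closure_charts \<iota> x y" "infinity.A \<in> closure_charts \<iota> x y"
      using x_nonzero by (simp_all add: closure_charts_def)
    ultimately show "?reg A \<and> ?reg infinity.A" by blast
  next
    assume r: "?reg A \<and> ?reg infinity.A"
    show "\<forall>B\<in>closure_charts \<iota> x y. ?reg B"
    proof
      fix B assume "B \<in> closure_charts \<iota> x y"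
      then consider "B = A" | "B = infinity.A" | "B = coord_ring \<iota> (x / y) (1 / y)" "y \<noteq> 0"
        by (auto simp: closure_charts_def split: if_splits)
      then show "?reg B"
      proof cases
        case 1
        show ?thesis unfolding 1 by (rule conjunct1[OF r])
      next
        case 2
        show ?thesis unfolding 2 by (rule conjunct2[OF r])
      next
        case 3
        show ?thesis unfolding 3(1) by (rule C[OF conjunct1[OF r] conjunct2[OF r] 3(2)])
      qed
    qed
  qed
  finally show ?thesis unfolding A A' .
qed

end

text \<open>Links separability over k(x) to \<open>Fy\<close> being nonzero in K: a derivative
  divisible by F vanishes for reasons of degree, and F coprime to 0 would be a unit.\<close>

lemma pderiv_not_multiple_if_separable:
  fixes F :: "'k::field poly poly"
  assumes sep: "separable_in_y F" and monic: "lead_coeff F = 1" and deg: "0 < degree F"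
  shows "\<not> F dvd pderiv F"
proof
  assume dvd: "F dvd pderiv F"
  have 0: "pderiv F = 0"
  proof (rule ccontr)
    assume "pderiv F \<noteq> 0"
    with dvd have "degree F \<le> degree (pderiv F)" by (rule dvd_imp_degree_le)
    also have "\<dots> \<le> degree F - 1" by (rule degree_pderiv_le)
    finally show False using deg by simp
  qed
  let ?G = "map_poly to_fract F :: 'k poly fract poly"
  have nat: "to_fract (of_nat n :: 'k poly) = of_nat n" for n
    by (induction n) simp_all
  have "pderiv ?G = map_poly to_fract (pderiv F)"
  proof (rule poly_eqI)
    fix i
    have "coeff (pderiv F) i = of_nat (Suc i) * coeff F (Suc i)" by (rule coeff_pderiv)
    then have "to_fract (coeff (pderiv F) i) = of_nat (Suc i) * to_fract (coeff F (Suc i))"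
      by (simp only: to_fract_mult nat)
    then show "coeff (pderiv ?G) i = coeff (map_poly to_fract (pderiv F)) i"
      by (simp only: coeff_pderiv coeff_map_poly to_fract_0)
  qed
  then have "coprime ?G 0" using sep unfolding separable_in_y_def by (simp add: 0)
  then have "is_unit ?G" by simp
  then have "degree ?G = 0" by (simp add: is_unit_iff_degree poly_dvd_1)
  moreover have "degree ?G = degree F" by (rule degree_map_poly) simp
  ultimately show False using deg by simp
qed

theorem theorem2p2:
  fixes F :: "'k::field poly poly" and \<iota> :: "'k \<Rightarrow> 'K::field" and x y :: 'K and N :: nat
  assumes "perfect_of_pos_char TYPE('k)"
    and "geometrically_irreducible F"
    and "total_degree F = N"
    and "degree F = N" and "lead_coeff F = 1"
    and "separable_in_y F"
    and "is_function_field \<iota> F x y"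
    and "transcendental_over \<iota> x"
  defines "A \<equiv> coord_ring \<iota> x y"
    and "A' \<equiv> coord_ring \<iota> (1 / x) (y / x)"
  shows "global_regular_forms \<iota> x y =
           {form \<iota> (\<phi> / eval2 \<iota> (pderiv F) x y) x |\<phi>.
              \<phi> \<in> conductor A \<and> \<phi> / x powi (int N - 3) \<in> conductor A'}
         \<and> (\<forall>\<phi>. \<phi> \<in> conductor A \<and> \<phi> / x powi (int N - 3) \<in> conductor A' \<longrightarrow>
              (\<exists>P. \<phi> = eval2 \<iota> P x y \<and> (P = 0 \<or> int (total_degree P) \<le> int N - 3)))"
proof -
  have ff: "\<And>P. eval2 \<iota> P x y = 0 \<longleftrightarrow> F dvd P"
    "\<And>z. \<exists>P Q. eval2 \<iota> Q x y \<noteq> 0 \<and> z = eval2 \<iota> P x y / eval2 \<iota> Q x y"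
    using assms(7) unfolding is_function_field_def by blast+
  have hom: "\<iota> 1 = 1" "\<iota> (a + b) = \<iota> a + \<iota> b" "\<iota> (a * b) = \<iota> a * \<iota> b" for a b
    using assms(7) by (simp_all add: is_function_field_def Ring.ring_hom_def ring_of_type_algebra_def)
  \<comment> \<open>A \<open>ring_hom\<close> is required to respect 1, sums and products; that 0
    goes to 0 is recovered by cancellation.\<close>
  have "\<iota> 0 + \<iota> 0 = \<iota> 0 + 0" using hom(2)[of 0 0] by (simp only: add_0_right)
  then have "\<iota> 0 = 0" by (rule add_left_imp_eq)
  then interpret \<iota>: idom_hom \<iota> by unfold_locales (simp_all add: hom)
  interpret rational_subfield \<iota> x by unfold_locales (rule assms(8))
  interpret plane_curve \<iota> x y F
  proof unfold_locales
    show "eval2 \<iota> F x y = 0" by (simp add: ff(1))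
    show "P = 0" if "degree P < degree F" "eval2 \<iota> P x y = 0" for P
      using that dvd_imp_degree_le[of F P] by (auto simp: ff(1))
  qed (fact assms(5) ff(2))+
  interpret separable_plane_curve \<iota> x y F
    by unfold_locales (simp add: ff(1) pderiv_not_multiple_if_separable[OF assms(6,5) N_pos])
  interpret derivation_d_dx \<iota> x d_dx by (rule derivation_d_dx)
  interpret projective_plane_curve \<iota> x y F d_dx
    by unfold_locales (simp_all add: assms(1,3,4))
  have N: "degree F = N" by (rule assms(4))
  note glob = global_regular_form_iff[unfolded N, folded A_def A'_def]
  have "global_regular_forms \<iota> x y =
      {form \<iota> (\<phi> / eval2 \<iota> (pderiv F) x y) x |\<phi>. \<phi> \<in> conductor A \<and> \<phi> / x powi (int N - 3) \<in> conductor A'}"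
    (is "_ = ?W")
  proof (intro equalityI subsetI)
    fix \<omega> assume "\<omega> \<in> global_regular_forms \<iota> x y"
    then obtain f where f: "\<omega> = form \<iota> f x"
      and reg: "\<forall>R\<in>normalization_local_rings \<iota> x y. regular_at \<iota> R (form \<iota> f x)"
      unfolding global_regular_forms_def rational_forms_eq by blast
    \<comment> \<open>The witness for \<phi> is F_y f, which converts the coefficient of dx into the
      numerator over F_y.\<close>
    have "f = eval2 \<iota> (pderiv F) x y * f / eval2 \<iota> (pderiv F) x y" using Fy_nonzero by simp
    with reg show "\<omega> \<in> ?W" unfolding glob f by (intro CollectI exI conjI) auto
  next
    fix \<omega> assume "\<omega> \<in> ?W"
    then obtain \<phi> where \<phi>: "\<omega> = form \<iota> (\<phi> / eval2 \<iota> (pderiv F) x y) x"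
      "\<phi> \<in> conductor A" "\<phi> / x powi (int N - 3) \<in> conductor A'" by blast
    have "eval2 \<iota> (pderiv F) x y * (\<phi> / eval2 \<iota> (pderiv F) x y) = \<phi>" using Fy_nonzero by simp
    with \<phi>(2,3) show "\<omega> \<in> global_regular_forms \<iota> x y"
      unfolding global_regular_forms_def rational_forms_eq \<phi>(1) mem_Collect_eq glob by simp
  qed
  moreover have "\<exists>P. \<phi> = eval2 \<iota> P x y \<and> (P = 0 \<or> int (total_degree P) \<le> int N - 3)"
    if "\<phi> \<in> conductor A" "\<phi> / x powi (int N - 3) \<in> conductor A'" for \<phi>
    using that degree_bound[unfolded N, of \<phi>] unfolding conductor_def A_def A'_def by blast
  ultimately show ?thesis by blast
qed

end
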